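(* For every $(\mu|\lambda)\in\Sigma$, $$s_{(\mu|\lambda)}=\sum_{\sigma\in\mathcal{L}(\mu|\lambda)}x^\sigma .$$
   Context: **Combinatorics.** A composition is a finite tuple $\mu=(\mu_1,\ldots,\mu_n)$ of non-negative integers (the empty one $\emptyset$ is allowed); $\ell(\mu)=n$. It is reduced if $\mu=\emptyset$ or $\mu_{\ell(\mu)}\neq 0$. A partition is a composition with $\lambda_1\ge\dots\ge\lambda_n\ge1$ ($\emptyset$ allowed). $\Sigma$ is the set of pairs $(\mu|\lambda)$ with $\mu$ a reduced composition and $\lambda$ a partition. $*$ denotes concatenation; $\mathrm{rev}(\lambda)$ is $\lambda$ with its entries in reversed order. **Almost symmetric functions.** $\mathscr{P}_n^+=\mathbb{Q}(q,t)[x_1,\ldots,x_n]$; $\mathscr{P}(k)^+=\mathbb{Q}(q,t)[x_1,\ldots,x_k]\otimes\Lambda[\mathfrak{X}_k]$, where $\Lambda[\mathfrak{X}_k]$ is the ring of symmetric functions in $x_{k+1},x_{k+2},\ldots$; $\mathscr{P}_{as}^+=\bigcup_{k\ge0}\mathscr{P}(k)^+$. **Key polynomials.** $\xi_i(f)=\frac{x_if-x_{i+1}s_i(f)}{x_i-x_{i+1}}$, where $s_i$ swaps $x_i,x_{i+1}$. The key polynomials $\mathcal{K}_\alpha(x_1,\ldots,x_n)$, $\alpha\in\mathbb{Z}_{\ge0}^n$, are determined by: $\mathcal{K}_\alpha=x^\alpha$ if $\alpha_1\ge\dots\ge\alpha_n$; and $\mathcal{K}_{s_i(\alpha)}=\xi_i(\mathcal{K}_\alpha)$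 if $\alpha_i>\alpha_{i+1}$ ($s_i(\alpha)$ swaps entries $i,i+1$). One has $\mathcal{K}_{\alpha*0}=\mathcal{K}_\alpha$. **Almost symmetric Schur functions.** Let $\mathfrak{S}_{(1^k,n-k)}\subset\mathfrak{S}_n$ be the permutations fixing $1,\ldots,k$. For $0\le k\le n$, $$W_k^{(n)}(f)=\sum_{\sigma\in\mathfrak{S}_{(1^k,n-k)}}\sigma\Big(f\prod_{k+1\le i<j\le n}\frac1{1-x_j/x_i}\Big),\qquad f\in\mathscr{P}_n^+,$$ with $\sigma$ permuting variables. These operators are compatible with setting $x_{n+1}=0$, and $W_k=\lim_nW_k^{(n)}$ is the operator on $\mathscr{P}_{as}^+$ such that $W_k(f)(x_1,\ldots,x_n,0,0,\ldots)=W_k^{(n)}(f(x_1,\ldots,x_n,0,0,\ldots))$ for all $n\ge k$. The functions $s_{(\mu|\lambda)}$, $(\mu|\lambda)\in\Sigma$, are defined recursively by $s_{(\mu|\emptyset)}=\mathcal{K}_\mu$, and, if $\mu_r\ge\lambda_1$ (and $(\mu_1,\ldots,\mu_{r-1})$ is reduced), $s_{(\mu_1,\ldots,\mu_{r-1}|\mu_r,\lambda_1,\ldots,\lambda_\ell)}=W_{r-1}\big(s_{(\mu_1,\ldots,\mu_r|\lambda_1,\ldots,\lambda_\ell)}\big)$. **Labellings.** For a composition $\alpha$ of length $n$, $dg'(\alpha)=\{(i,j):1\le i\le n,1\le j\le\alpha_i\}$ ($i$ = column, $j$ = row) and $\widehat{dg}(\alpha)=dg'(\alpha)\cup\{(i,0):1\le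 i\le n\}$. Put $\alpha=\mu*\mathrm{rev}(\lambda)$, and let $\omega$ be the first infinite ordinal, so $n<\omega<\omega+1<\cdots$ for all positive integers $n$. For $\sigma:dg'(\alpha)\to\{1,2,\ldots\}$ let $\sigma^\star$ be the labelling of $\widehat{dg}(\alpha)$ with $\sigma^\star(u)=\sigma(u)$ for $u\in dg'(\alpha)$, $\sigma^\star(j,0)=j$ for $1\le j\le\ell(\mu)$, and $\sigma^\star(j,0)=\omega+j-\ell(\mu)-1$ for $\ell(\mu)+1\le j\le\ell(\mu)+\ell(\lambda)$. Two distinct boxes attack each other if they lie in the same row, or in consecutive rows with the lower-row box strictly to the right of the upper-row box. $\sigma^\star$ is non-attacking if $\sigma^\star(u)\ne\sigma^\star(v)$ for all attacking $u,v\in\widehat{dg}(\alpha)$. $\mathrm{Des}(\sigma^\star)$ is the set of $u=(i,j)\in dg'(\alpha)$ with $\sigma^\star(i,j)>\sigma^\star(i,j-1)$. $\mathrm{coinv}(\sigma^\star)$ is the number of co-inversion triples: triples $(u,v,w)$ of boxes of $\widehat{dg}(\alpha)$ with $u=(i,j)$, $j\ge1$, $w=(i,j-1)$ and either (Type 1) $v=(i',j-1)$ with $i'>i$ and $\alpha_i>\alpha_{i'}$, or (Type 2) $v=(i',j)$ with $i'<i$ and $\alpha_{i'}\le\alpha_i$, such that $\sigma^\star(u)<\sigma^\star(v)<\sigma^\star(w)$ or $\sigma^\star(v)<\sigma^\star(w)<\sigma^\star(u)$ or $\sigma^\star(w)<\sigma^\star(u)<\sigma^\star(v)$. $\mathcal{L}(\mu|\lambda)$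 is the set of $\sigma:dg'(\mu*\mathrm{rev}(\lambda))\to\{1,2,\ldots\}$ such that $\sigma^\star$ is non-attacking, $\mathrm{coinv}(\sigma^\star)=0$ and $\mathrm{Des}(\sigma^\star)=\emptyset$. Finally $x^\sigma=\prod_{i\ge1}x_i^{|\sigma^{-1}(i)|}$; the (generally infinite) sum is a formal series in $x_1,x_2,\ldots$. *)

theory Defs
  imports
    "HOL-Library.Poly_Mapping"
    "HOL-Library.FuncSet"
    "HOL-Computational_Algebra.Polynomial"
    "HOL-Computational_Algebra.Fraction_Field"
    "HOL-Combinatorics.Permutations"
begin

section \<open>Compositions\<close>

text \<open>A composition is a \<open>nat list\<close>; the mathematical entry \<open>\<alpha>\<^sub>i\<close> is \<open>\<alpha> ! (i - 1)\<close>.\<close>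

definition reduced :: "nat list \<Rightarrow> bool" where
  "reduced \<mu> \<longleftrightarrow> \<mu> = [] \<or> last \<mu> \<noteq> 0"

definition is_partition :: "nat list \<Rightarrow> bool" where
  "is_partition la \<longleftrightarrow> sorted_wrt (\<ge>) la \<and> (\<forall>x\<in>set la. 1 \<le> x)"

definition Sigma_pairs :: "(nat list \<times> nat list) set" where
  "Sigma_pairs = {(\<mu>, la). reduced \<mu> \<and> is_partition la}"


section \<open>Polynomials and formal series over \<open>\<rat>(q,t)\<close>\<close>

text \<open>The fraction field of \<open>\<rat>[q][t]\<close>.\<close>
type_synonym qt = "rat poly poly fract"

text \<open>Exponent vectors. The variables are \<open>x\<^sub>1, x\<^sub>2, \<dots>\<close>: index 0 is not used.\<close>
type_synonym mon = "nat \<Rightarrow>\<^sub>0 nat"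

type_synonym pol = "mon \<Rightarrow>\<^sub>0 qt"

text \<open>A formal series is its family of coefficients.\<close>
type_synonym series = "mon \<Rightarrow> qt"

definition Var :: "nat \<Rightarrow> pol" where
  "Var i = Poly_Mapping.single (Poly_Mapping.single i 1) 1"

definition polys :: "nat \<Rightarrow> pol set" where
  "polys n = {p. \<forall>m\<in>Poly_Mapping.keys p. Poly_Mapping.keys m \<subseteq> {1..n}}"

definition mon_degree :: "mon \<Rightarrow> nat" where
  "mon_degree m = (\<Sum>i\<in>Poly_Mapping.keys m. Poly_Mapping.lookup m i)"

text \<open>
  The substitution \<open>x\<^sub>i \<mapsto> x\<^bsub>\<sigma> i\<^esub>\<close> for a permutation \<open>\<sigma>\<close>: the coefficient of \<open>m\<close> in \<open>\<sigma> p\<close> is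
  the coefficient in \<open>p\<close> of the exponent vector \<open>i \<mapsto> m (\<sigma> i)\<close>.
\<close>
definition permute_vars :: "(nat \<Rightarrow> nat) \<Rightarrow> pol \<Rightarrow> pol" where
  "permute_vars \<sigma> p = Poly_Mapping.map_key (Poly_Mapping.map_key \<sigma>) p"

definition to_frac :: "pol \<Rightarrow> pol fract" where
  "to_frac p = Fraction_Field.Fract p 1"

text \<open>Meaningful for rational functions that happen to be polynomials.\<close>
definition poly_of_frac :: "pol fract \<Rightarrow> pol" where
  "poly_of_frac r = (THE p. to_frac p = r)"


section \<open>Almost symmetric functions\<close>

definition series_mult :: "series \<Rightarrow> series \<Rightarrow> series" where
  "series_mult f g = (\<lambda>m. \<Sum>(a, b)\<in>{(a, b). a + b = m}. f a * g b)"

text \<open>Symmetric functions (series of bounded degree) in \<open>x\<^bsub>k+1\<^esub>, x\<^bsub>k+2\<^esub>, \<dots>\<close>.\<close>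
definition Sym_fun :: "nat \<Rightarrow> series set" where
  "Sym_fun k = {f. (\<forall>m. f m \<noteq> 0 \<longrightarrow> Poly_Mapping.keys m \<subseteq> {k<..}) \<and>
                   (\<exists>d. \<forall>m. f m \<noteq> 0 \<longrightarrow> mon_degree m \<le> d) \<and>
                   (\<forall>\<sigma> m. \<sigma> permutes {k<..} \<longrightarrow> f (Poly_Mapping.map_key \<sigma> m) = f m)}"

text \<open>
  The tensor product of the polynomials in \<open>x\<^sub>1, \<dots>, x\<^sub>k\<close> with \<open>Sym_fun k\<close>, identified with its
  image under the (injective) multiplication map into formal series.
\<close>
definition P_plus :: "nat \<Rightarrow> series set" where
  "P_plus k = {f. \<exists>(N::nat) p g. (\<forall>i<N. p i \<in> polys k \<and> g i \<in> Sym_fun k) \<and>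
                  f = (\<lambda>m. \<Sum>i<N. series_mult (Poly_Mapping.lookup (p i)) (g i) m)}"

definition P_as :: "series set" where
  "P_as = (\<Union>k. P_plus k)"

text \<open>\<open>f(x\<^sub>1, \<dots>, x\<^sub>n, 0, 0, \<dots>)\<close>, a polynomial because \<open>f\<close> has bounded degree.\<close>
definition trunc_vars :: "nat \<Rightarrow> series \<Rightarrow> pol" where
  "trunc_vars n f = Abs_poly_mapping (\<lambda>m. if Poly_Mapping.keys m \<subseteq> {1..n} then f m else 0)"


section \<open>Key polynomials\<close>

definition xi :: "nat \<Rightarrow> pol \<Rightarrow> pol" where
  "xi i f = poly_of_frac
     (to_frac (Var i * f - Var (i + 1) * permute_vars (transpose i (i + 1)) f) /
      to_frac (Var i - Var (i + 1)))"

definition swap_entries :: "nat \<Rightarrow> nat list \<Rightarrow> nat list" where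
  "swap_entries i \<alpha> = \<alpha>[i - 1 := \<alpha> ! i, i := \<alpha> ! (i - 1)]"

definition key_poly :: "nat list \<Rightarrow> pol" where
  "key_poly = (THE K.
     (\<forall>\<alpha>. sorted_wrt (\<ge>) \<alpha> \<longrightarrow> K \<alpha> = (\<Prod>i = 1..length \<alpha>. Var i ^ (\<alpha> ! (i - 1)))) \<and>
     (\<forall>\<alpha> i. 1 \<le> i \<and> i < length \<alpha> \<and> \<alpha> ! (i - 1) > \<alpha> ! i \<longrightarrow>
        K (swap_entries i \<alpha>) = xi i (K \<alpha>)))"


section \<open>Almost symmetric Schur functions\<close>

text \<open>
  Here \<open>\<sigma>(f \<Prod> 1 / (1 - x\<^sub>j / x\<^sub>i))\<close> is written out as
  \<open>\<sigma>(f) \<Prod> 1 / (1 - x\<^bsub>\<sigma> j\<^esub> / x\<^bsub>\<sigma> i\<^esub>)\<close> in the field of rational functions.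
\<close>
definition W_fin :: "nat \<Rightarrow> nat \<Rightarrow> pol \<Rightarrow> pol" where
  "W_fin k n f = poly_of_frac
     (\<Sum>\<sigma>\<in>{\<sigma>. \<sigma> permutes {k+1..n}}.
        to_frac (permute_vars \<sigma> f) *
        (\<Prod>(i, j)\<in>{(i, j). k + 1 \<le> i \<and> i < j \<and> j \<le> n}.
           1 / (1 - to_frac (Var (\<sigma> j)) / to_frac (Var (\<sigma> i)))))"

definition W :: "nat \<Rightarrow> series \<Rightarrow> series" where
  "W k f = (THE g. g \<in> P_as \<and> (\<forall>n\<ge>k. trunc_vars n g = W_fin k n (trunc_vars n f)))"

text \<open>
  The recursion is stated for all pairs of lists. Starting from a pair in \<open>Sigma_pairs\<close> it only
  visits pairs in \<open>Sigma_pairs\<close> and always moves an entry that dominates the remaining ones.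
\<close>
fun as_schur :: "nat list \<Rightarrow> nat list \<Rightarrow> series" where
  "as_schur \<mu> [] = Poly_Mapping.lookup (key_poly \<mu>)"
| "as_schur \<mu> (x # la) = W (length \<mu>) (as_schur (\<mu> @ [x]) la)"


section \<open>Labellings\<close>

text \<open>The ordinals below \<open>\<omega> + \<omega>\<close>: \<open>Omega j\<close> is \<open>\<omega> + j\<close>.\<close>
datatype label = Fin nat | Omega nat

instantiation label :: linorder
begin

fun less_eq_label :: "label \<Rightarrow> label \<Rightarrow> bool" where
  "Fin a \<le> Fin b \<longleftrightarrow> a \<le> b"
| "Fin a \<le> Omega b \<longleftrightarrow> True"
| "Omega a \<le> Fin b \<longleftrightarrow> False"
| "Omega a \<le> Omega b \<longleftrightarrow> a \<le> b"

definition less_label :: "label \<Rightarrow> label \<Rightarrow> bool" where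
  "less_label x y \<longleftrightarrow> x \<le> y \<and> \<not> y \<le> x"

instance
proof
  fix x y z :: label
  show "x < y \<longleftrightarrow> x \<le> y \<and> \<not> y \<le> x" by (rule less_label_def)
  show "x \<le> x" by (cases x) auto
  show "x \<le> y \<Longrightarrow> y \<le> z \<Longrightarrow> x \<le> z" by (cases x; cases y; cases z) auto
  show "x \<le> y \<Longrightarrow> y \<le> x \<Longrightarrow> x = y" by (cases x; cases y) auto
  show "x \<le> y \<or> y \<le> x" by (cases x; cases y) auto
qed

end

text \<open>A box \<open>(i, j)\<close> lies in column \<open>i\<close> and row \<open>j\<close>.\<close>
type_synonym box = "nat \<times> nat"

definition dg :: "nat list \<Rightarrow> box set" where
  "dg \<alpha> = {(i, j). 1 \<le> i \<and> i \<le> length \<alpha> \<and> 1 \<le> j \<and> j \<le> \<alpha> ! (i - 1)}"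

definition dg_hat :: "nat list \<Rightarrow> box set" where
  "dg_hat \<alpha> = dg \<alpha> \<union> {(i, 0) | i. 1 \<le> i \<and> i \<le> length \<alpha>}"

definition star :: "nat list \<Rightarrow> (box \<Rightarrow> nat) \<Rightarrow> box \<Rightarrow> label" where
  "star \<mu> \<sigma> = (\<lambda>(i, j).
     if j = 0 then (if i \<le> length \<mu> then Fin i else Omega (i - length \<mu> - 1))
     else Fin (\<sigma> (i, j)))"

definition attacking :: "box \<Rightarrow> box \<Rightarrow> bool" where
  "attacking u v \<longleftrightarrow> u \<noteq> v \<and>
     (snd u = snd v \<or>
      (snd u = snd v + 1 \<and> fst u < fst v) \<or>
      (snd v = snd u + 1 \<and> fst v < fst u))"

definition non_attacking :: "nat list \<Rightarrow> (box \<Rightarrow> label) \<Rightarrow> bool" where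
  "non_attacking \<alpha> \<tau> \<longleftrightarrow> (\<forall>u\<in>dg_hat \<alpha>. \<forall>v\<in>dg_hat \<alpha>. attacking u v \<longrightarrow> \<tau> u \<noteq> \<tau> v)"

definition Des :: "nat list \<Rightarrow> (box \<Rightarrow> label) \<Rightarrow> box set" where
  "Des \<alpha> \<tau> = {(i, j). (i, j) \<in> dg \<alpha> \<and> \<tau> (i, j) > \<tau> (i, j - 1)}"

definition type1_triple :: "nat list \<Rightarrow> box \<Rightarrow> box \<Rightarrow> box \<Rightarrow> bool" where
  "type1_triple \<alpha> u v w \<longleftrightarrow> (\<exists>i j i'. j \<ge> 1 \<and> u = (i, j) \<and> w = (i, j - 1) \<and>
     v = (i', j - 1) \<and> i' > i \<and> \<alpha> ! (i - 1) > \<alpha> ! (i' - 1))"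

definition type2_triple :: "nat list \<Rightarrow> box \<Rightarrow> box \<Rightarrow> box \<Rightarrow> bool" where
  "type2_triple \<alpha> u v w \<longleftrightarrow> (\<exists>i j i'. j \<ge> 1 \<and> u = (i, j) \<and> w = (i, j - 1) \<and>
     v = (i', j) \<and> i' < i \<and> \<alpha> ! (i' - 1) \<le> \<alpha> ! (i - 1))"

definition coinv_triples :: "nat list \<Rightarrow> (box \<Rightarrow> label) \<Rightarrow> (box \<times> box \<times> box) set" where
  "coinv_triples \<alpha> \<tau> = {(u, v, w). u \<in> dg_hat \<alpha> \<and> v \<in> dg_hat \<alpha> \<and> w \<in> dg_hat \<alpha> \<and>
     (type1_triple \<alpha> u v w \<or> type2_triple \<alpha> u v w) \<and>
     (\<tau> u < \<tau> v \<and> \<tau> v < \<tau> w \<or> \<tau> v < \<tau> w \<and> \<tau> w < \<tau> u \<or> \<tau> w < \<tau> u \<and> \<tau> u < \<tau> v)}"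

definition coinv :: "nat list \<Rightarrow> (box \<Rightarrow> label) \<Rightarrow> nat" where
  "coinv \<alpha> \<tau> = card (coinv_triples \<alpha> \<tau>)"

text \<open>Extensional functions, so that each labelling of the diagram occurs exactly once.\<close>
definition labellings :: "nat list \<Rightarrow> nat list \<Rightarrow> (box \<Rightarrow> nat) set" where
  "labellings \<mu> la = {\<sigma> \<in> dg (\<mu> @ rev la) \<rightarrow>\<^sub>E {1..}.
     non_attacking (\<mu> @ rev la) (star \<mu> \<sigma>) \<and>
     coinv (\<mu> @ rev la) (star \<mu> \<sigma>) = 0 \<and>
     Des (\<mu> @ rev la) (star \<mu> \<sigma>) = {}}"

definition label_content :: "nat list \<Rightarrow> (box \<Rightarrow> nat) \<Rightarrow> mon" where
  "label_content \<alpha> \<sigma> = Abs_poly_mapping (\<lambda>i. card {u \<in> dg \<alpha>. \<sigma> u = i})"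

text \<open>\<open>x\<^sup>\<sigma>\<close> as a formal series.\<close>
definition x_pow :: "nat list \<Rightarrow> (box \<Rightarrow> nat) \<Rightarrow> series" where
  "x_pow \<alpha> \<sigma> = Poly_Mapping.lookup (Poly_Mapping.single (label_content \<alpha> \<sigma>) 1)"

text \<open>
  \<open>g\<close> is the formal sum of the series \<open>F a\<close>, \<open>a \<in> A\<close>: every coefficient receives only finitely
  many nonzero contributions, and these add up to the coefficient of \<open>g\<close>.
\<close>
definition has_formal_sum :: "('a \<Rightarrow> series) \<Rightarrow> 'a set \<Rightarrow> series \<Rightarrow> bool" where
  "has_formal_sum F A g \<longleftrightarrow>
     (\<forall>m. finite {a \<in> A. F a m \<noteq> 0} \<and> g m = (\<Sum>a\<in>{a \<in> A. F a m \<noteq> 0}. F a m))"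

end

theory Submission
  imports Defs
begin

text \<open>
  The heart of the matter is a statement about finitely many variables: the generating polynomial
  \<open>key_sum \<alpha>\<close> of the labellings of \<open>dg \<alpha>\<close> above the basement \<open>1, 2, \<dots>\<close> that are non-attacking and
  have neither descents nor co-inversion triples is the key polynomial of \<open>\<alpha>\<close>
  (\<open>key_poly_eq_key_sum\<close>).

  Without descents, the conditions on a labelling relate only consecutive rows, and \<open>filling_sum\<close>
  adds up the labellings row by row; what it has to remember are the remaining heights and the
  topmost labels of the columns. Two local facts carry the proof. First, two neighbouring columns
  may change places, together with their labels, if the left one is taller and has the smaller
  label (\<open>exchange_columns\<close>); so the columns can be sorted by height, which turns the basement
  \<open>1, 2, \<dots>\<close> into a permutation. Secondly, for weakly increasing heights and \<open>i\<close> to the left of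
  \<open>i + 1\<close> in the basement, the sum is \<open>\<xi>\<^sub>i\<close> of the sum with \<open>i\<close> and \<open>i + 1\<close> exchanged in the basement
  (\<open>filling_sum_xi\<close>). If \<open>\<alpha>\<^sub>i > \<alpha>\<^bsub>i+1\<^esub>\<close>, then sorting \<open>\<alpha>\<close> and \<open>s\<^sub>i(\<alpha>)\<close> leads to the same heights, with basements
  that differ by this exchange; hence \<open>key_sum\<close> obeys the rule \<open>K (s\<^sub>i(\<alpha>)) = \<xi>\<^sub>i (K \<alpha>)\<close>
  (\<open>key_sum_swap\<close>). For a weakly decreasing \<open>\<alpha>\<close> there is only one labelling, and the two rules
  together determine key polynomials.

  The operator \<open>W\<^sub>k\<^sup>n\<close> in \<open>n\<close> variables satisfies \<open>W\<^sub>k\<^sup>n (\<xi>\<^sub>i f) = W\<^sub>k\<^sup>n f\<close> for \<open>k < i < n\<close> and fixes the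
  polynomials that are symmetric in \<open>x\<^bsub>k+1\<^esub>, \<dots>, x\<^sub>n\<close>. Moving the entry \<open>x\<close> of \<open>(\<mu>, x, 0, \<dots>, 0, rev \<lambda>)\<close> to the
  right end applies a chain of operators \<open>\<xi>\<^sub>i\<close> to the key polynomial and ends at a polynomial that is
  symmetric in these variables, so this is what \<open>W\<^sub>k\<close> does to it; a chain stays a chain, only a
  shorter one, when variables are set to zero. Therefore the coefficients of \<open>s\<^bsub>(\<mu>|\<lambda>)\<^esub>\<close> are those of
  the key polynomials of \<open>(\<mu>, 0, \<dots>, 0, rev \<lambda>)\<close> with enough zeros. These are counted by labellings
  above a finite basement: columns of height zero impose no condition, and for labels that are at
  most \<open>N\<close> the basement \<open>\<omega>, \<omega> + 1, \<dots>\<close> is as good as \<open>N + 1, N + 2, \<dots>\<close>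
  (\<open>schur_series_coeff\<close>).
\<close>

section \<open>Substitutions in polynomials\<close>

abbreviation "lookup \<equiv> Poly_Mapping.lookup"
abbreviation "keys \<equiv> Poly_Mapping.keys"
abbreviation "single \<equiv> Poly_Mapping.single"
abbreviation "map_key \<equiv> Poly_Mapping.map_key"

abbreviation adj :: "nat \<Rightarrow> nat \<Rightarrow> nat" where
  "adj i \<equiv> transpose i (Suc i)"

lemma pol_eq_sum_singles:
  "p = (\<Sum>m\<in>keys p. single m (lookup p m))"
  for p :: "'a \<Rightarrow>\<^sub>0 'b::comm_monoid_add"
proof (rule poly_mapping_eqI)
  fix k
  have "(\<Sum>m\<in>keys p. lookup (single m (lookup p m)) k)
      = (\<Sum>m\<in>keys p. if m = k then lookup p m else 0)"
    by (intro sum.cong) (auto simp: lookup_single when_def)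
  also have "\<dots> = lookup p k"
    by (simp add: sum.delta in_keys_iff)
  finally show "lookup p k = lookup
     (\<Sum>m\<in>keys p. single m (lookup p m)) k"
    by (simp add: lookup_sum)
qed

lemma additive_induct [case_names zero single add]:
  fixes p :: "'a \<Rightarrow>\<^sub>0 'b::comm_monoid_add"
  assumes "P 0" and single: "\<And>m c. P (single m c)" and add: "\<And>p q. P p \<Longrightarrow> P q \<Longrightarrow> P (p + q)"
  shows "P p"
proof -
  have "P (\<Sum>m\<in>A. single m (lookup p m))" if "finite A" for A
    using that by (induction A) (auto intro: assms)
  from this[of "keys p"] show ?thesis by (simp flip: pol_eq_sum_singles)
qed

text \<open>
  Permuting variables and setting variables to zero are both additive maps that visibly respect
  products of monomials.
\<close>
lemma multiplicative_if_on_monomials: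
  fixes T :: "pol \<Rightarrow> pol"
  assumes add: "\<And>p q. T (p + q) = T p + T q"
    and mono: "\<And>a b c d. T (single (a + b) (c * d)) =
                  T (single a c) * T (single b d)"
  shows "T (p * q) = T p * T q"
proof -
  have zero: "T 0 = 0" using add[of 0 0] by simp
  have 1: "T (single a c * q) = T (single a c) * T q" for a c
    by (induction q rule: additive_induct) (auto simp: zero add mult_single mono distrib_left)
  show ?thesis
    by (induction p rule: additive_induct) (auto simp: zero add 1 distrib_right)
qed

lemma single_eq_prod_Var:
  "single m c = single 0 c * (\<Prod>j\<in>keys m. Var j ^ lookup m j)"
proof -
  have pw: "Var j ^ k = single (single j k) 1" for j k
    by (induction k) (auto simp: Var_def mult_single simp flip: single_add)
  have "(\<Prod>j\<in>A. Var j ^ lookup m j) =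
        single (\<Sum>j\<in>A. single j (lookup m j)) 1" if "finite A" for A
    using that by (induction A) (auto simp: pw mult_single)
  from this[of "keys m"] show ?thesis
    by (simp add: mult_single flip: pol_eq_sum_singles)
qed

lemma pol_induct [case_names const Var add mult]:
  fixes p :: pol
  assumes const: "\<And>c. P (single 0 c)" and Var: "\<And>j. P (Var j)"
    and add: "\<And>p q. P p \<Longrightarrow> P q \<Longrightarrow> P (p + q)" and mult: "\<And>p q. P p \<Longrightarrow> P q \<Longrightarrow> P (p * q)"
  shows "P p"
proof (induction p rule: additive_induct)
  case zero
  show ?case using const[of 0] by simp
next
  case (single m c)
  have one: "P 1" using const[of 1] by simp
  have pow: "P (Var j ^ k)" for j k by (induction k) (auto intro: assms one)
  have "P (\<Prod>j\<in>A. Var j ^ lookup m j)" if "finite A" for A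
    using that by (induction A) (auto intro: mult one pow)
  then have "P (single 0 c * (\<Prod>j\<in>keys m. Var j ^ lookup m j))"
    by (intro mult const) simp
  then show ?case by (simp only: single_eq_prod_Var[of m c])
qed (auto intro: add)

lemma lookup_map_key: "inj f \<Longrightarrow> lookup (map_key f p) i = lookup p (f i)"
  by (simp add: map_key.rep_eq)

lemma inj_map_key: "bij f \<Longrightarrow> inj (map_key f :: ('a \<Rightarrow>\<^sub>0 'c::zero) \<Rightarrow> 'b \<Rightarrow>\<^sub>0 'c)"
proof (rule injI, rule poly_mapping_eqI)
  fix a b :: "'a \<Rightarrow>\<^sub>0 'c" and k
  assume f: "bij f" and eq: "map_key f a = map_key f b"
  obtain j where "k = f j" using f by (metis bij_pointE)
  then show "lookup a k = lookup b k"
    using arg_cong[OF eq, of "\<lambda>m. lookup m j"] f by (simp add: lookup_map_key bij_is_inj)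
qed

lemma lookup_permute_vars:
  "bij \<sigma> \<Longrightarrow> lookup (permute_vars \<sigma> p) m = lookup p (map_key \<sigma> m)"
  by (simp add: permute_vars_def lookup_map_key inj_map_key)

lemma permute_vars_add: "bij \<sigma> \<Longrightarrow> permute_vars \<sigma> (p + q) = permute_vars \<sigma> p + permute_vars \<sigma> q"
  by (simp add: permute_vars_def map_key_plus inj_map_key)

lemma permute_vars_single:
  assumes "bij \<sigma>"
  shows "permute_vars \<sigma> (single m c) = single (map_key (inv \<sigma>) m) c"
proof -
  have "m = map_key \<sigma> (map_key (inv \<sigma>) m)"
    using assms by (intro poly_mapping_eqI) (simp add: lookup_map_key bij_is_inj bij_imp_bij_inv)
  then show ?thesis
    using map_key_single[OF inj_map_key[OF assms], of "map_key (inv \<sigma>) m" c]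
    by (simp add: permute_vars_def)
qed

lemma permute_vars_mult:
  assumes "bij \<sigma>"
  shows "permute_vars \<sigma> (p * q) = permute_vars \<sigma> p * permute_vars \<sigma> q"
  by (rule multiplicative_if_on_monomials)
    (auto simp: assms permute_vars_add permute_vars_single mult_single map_key_plus bij_is_inj bij_imp_bij_inv)

lemma permute_vars_Var: "bij \<sigma> \<Longrightarrow> permute_vars \<sigma> (Var i) = Var (\<sigma> i)"
  using map_key_single[of "inv \<sigma>" "\<sigma> i" "1::nat"]
  by (simp add: Var_def permute_vars_single bij_is_inj bij_imp_bij_inv inv_f_f)

lemma permute_vars_const: "bij \<sigma> \<Longrightarrow> permute_vars \<sigma> (single 0 c) = single 0 c"
  by (simp add: permute_vars_single bij_is_inj bij_imp_bij_inv)

lemma permute_vars_0: "bij \<sigma> \<Longrightarrow> permute_vars \<sigma> 0 = 0"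
  using permute_vars_const[of \<sigma> 0] by simp

lemma permute_vars_1: "bij \<sigma> \<Longrightarrow> permute_vars \<sigma> 1 = 1"
  using permute_vars_const[of \<sigma> 1] by simp

lemma permute_vars_diff: "bij \<sigma> \<Longrightarrow> permute_vars \<sigma> (p - q) = permute_vars \<sigma> p - permute_vars \<sigma> q"
  using permute_vars_add[of \<sigma> "p - q" q] by (simp only: diff_add_cancel add_diff_cancel_right')

lemma permute_vars_compose:
  assumes "bij \<sigma>" "bij \<tau>"
  shows "permute_vars \<sigma> (permute_vars \<tau> p) = permute_vars (\<sigma> \<circ> \<tau>) p"
proof (rule poly_mapping_eqI)
  fix m :: mon
  have "bij (\<sigma> \<circ> \<tau>)" using assms by (rule bij_comp[rotated])
  moreover have "map_key \<tau> (map_key \<sigma> m) = map_key (\<sigma> \<circ> \<tau>) m"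
    using assms by (intro map_key_compose) (auto intro: bij_is_inj)
  ultimately show "lookup (permute_vars \<sigma> (permute_vars \<tau> p)) m =
      lookup (permute_vars (\<sigma> \<circ> \<tau>) p) m"
    using assms by (simp add: lookup_permute_vars)
qed

lemma permute_vars_adj_adj: "permute_vars (adj i) (permute_vars (adj i) p) = p"
proof -
  have "permute_vars id p = p"
    by (simp add: permute_vars_def id_def map_key_id[abs_def])
  then show ?thesis by (simp add: permute_vars_compose)
qed

section \<open>Isobaric divided differences\<close>

lemma Var_eq_iff: "Var i = Var j \<longleftrightarrow> i = j"
  by (metis Var_def keys_single one_neq_zero singleton_inject)

lemma Var_nonzero: "Var i \<noteq> 0"
  by (simp add: Var_def) (metis lookup_single_eq lookup_zero one_neq_zero)

lemma Var_diff_nonzero: "i \<noteq> j \<Longrightarrow> Var i - Var j \<noteq> 0"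
  by (simp add: Var_eq_iff)

lemma to_frac_eq_iff: "to_frac p = to_frac q \<longleftrightarrow> p = q"
  by (simp add: to_frac_def eq_fract)

lemma poly_of_frac_to_frac: "poly_of_frac (to_frac p) = p"
  by (simp add: poly_of_frac_def to_frac_eq_iff)

lemma to_frac_mult: "to_frac (p * q) = to_frac p * to_frac q"
  by (simp add: to_frac_def)

lemma to_frac_diff: "to_frac (p - q) = to_frac p - to_frac q"
  by (simp add: to_frac_def)

lemma to_frac_0: "to_frac 0 = 0"
  by (simp add: to_frac_def Zero_fract_def)

lemma to_frac_eq_0_iff: "to_frac p = 0 \<longleftrightarrow> p = 0"
  using to_frac_eq_iff[of p 0] by (simp add: to_frac_0)

text \<open>
  The difference \<open>f - s\<^sub>i f\<close> obeys the twisted Leibniz rule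
  \<open>fg - s\<^sub>i(fg) = f (g - s\<^sub>i g) + s\<^sub>i g (f - s\<^sub>i f)\<close>, so it is enough to look at the variables.
\<close>
lemma Var_diff_dvd: "Var i - Var (Suc i) dvd f - permute_vars (adj i) f"
proof (induction f rule: pol_induct)
  case (const c)
  then show ?case by (simp add: permute_vars_const)
next
  case (Var j)
  have "Var i - Var (Suc i) dvd Var (Suc i) - Var i"
    by (metis dvd_minus_iff dvd_refl minus_diff_eq)
  then show ?case by (cases "j = i"; cases "j = Suc i"; simp add: permute_vars_Var)
next
  case (add p q)
  have "p + q - permute_vars (adj i) (p + q) = (p - permute_vars (adj i) p) + (q - permute_vars (adj i) q)"
    by (simp only: permute_vars_add bij_transpose add_diff_add)
  then show ?case by (simp only: dvd_add[OF add])
next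
  case (mult p q)
  let ?s = "permute_vars (adj i)"
  have "p * q - ?s p * ?s q = p * (q - ?s q) + ?s q * (p - ?s p)"
    by (simp only: right_diff_distrib mult.commute[of "?s q"]) simp
  then show ?case
    unfolding permute_vars_mult[OF bij_transpose] by (metis mult dvd_add dvd_mult)
qed

text \<open>
  So the quotient in the definition of \<open>xi\<close> is a polynomial, and this equation determines it. All
  further rules for \<open>xi\<close> come from here.
\<close>
lemma xi_char: "(Var i - Var (Suc i)) * xi i f = Var i * f - Var (Suc i) * permute_vars (adj i) f"
proof -
  let ?s = "permute_vars (adj i)"
  obtain g where g: "f - ?s f = (Var i - Var (Suc i)) * g"
    using Var_diff_dvd[of i f] by blast
  have "Var i * f - Var (Suc i) * ?s f = (Var i - Var (Suc i)) * f + Var (Suc i) * (f - ?s f)"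
    by (simp only: left_diff_distrib right_diff_distrib) simp
  also have "\<dots> = (Var i - Var (Suc i)) * (f + Var (Suc i) * g)"
    by (simp only: g distrib_left mult.left_commute)
  finally have eq: "Var i * f - Var (Suc i) * ?s f = (Var i - Var (Suc i)) * (f + Var (Suc i) * g)" .
  have "to_frac (Var i - Var (Suc i)) \<noteq> 0"
    unfolding to_frac_eq_0_iff by (rule Var_diff_nonzero) (rule n_not_Suc_n)
  then have "xi i f = f + Var (Suc i) * g"
    unfolding xi_def Suc_eq_plus1[symmetric] eq to_frac_mult
    by (simp only: nonzero_mult_div_cancel_left poly_of_frac_to_frac not_False_eq_True)
  then show ?thesis by (simp only: eq)
qed

lemma xi_unique:
  assumes "(Var i - Var (Suc i)) * g = Var i * f - Var (Suc i) * permute_vars (adj i) f"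
  shows "xi i f = g"
proof -
  have "(Var i - Var (Suc i)) * xi i f = (Var i - Var (Suc i)) * g"
    by (simp only: xi_char assms)
  then show ?thesis
    by (rule iffD1[OF mult_left_cancel[OF Var_diff_nonzero[OF n_not_Suc_n]]])
qed

lemma xi_symmetric: "permute_vars (adj i) f = f \<Longrightarrow> xi i f = f"
  by (rule xi_unique) (simp only: left_diff_distrib)

lemma permute_vars_xi: "permute_vars (adj i) (xi i f) = xi i f"
proof -
  let ?s = "permute_vars (adj i)"
  have "?s ((Var i - Var (Suc i)) * xi i f) = ?s (Var i * f - Var (Suc i) * ?s f)"
    by (simp add: xi_char)
  then have "(Var (Suc i) - Var i) * ?s (xi i f) = Var (Suc i) * ?s f - Var i * f"
    by (simp add: permute_vars_mult permute_vars_diff permute_vars_Var permute_vars_adj_adj)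
  then have "- ((Var (Suc i) - Var i) * ?s (xi i f)) = - (Var (Suc i) * ?s f - Var i * f)"
    by (rule arg_cong)
  then have "(Var i - Var (Suc i)) * ?s (xi i f) = Var i * f - Var (Suc i) * ?s f"
    by (simp only: minus_mult_left minus_diff_eq)
  from xi_unique[OF this] show ?thesis by simp
qed

lemma xi_add: "xi i (f + g) = xi i f + xi i g"
proof (rule xi_unique)
  have "(Var i - Var (Suc i)) * (xi i f + xi i g) =
      (Var i - Var (Suc i)) * xi i f + (Var i - Var (Suc i)) * xi i g"
    by (rule distrib_left)
  then show "(Var i - Var (Suc i)) * (xi i f + xi i g) =
      Var i * (f + g) - Var (Suc i) * permute_vars (adj i) (f + g)"
    unfolding xi_char by (simp add: permute_vars_add algebra_simps)
qed

lemma xi_0: "xi i 0 = 0"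
  by (rule xi_unique) (simp only: permute_vars_0 bij_transpose mult_zero_right diff_0_right)

lemma xi_sum: "xi i (sum f A) = (\<Sum>a\<in>A. xi i (f a))"
  by (induction A rule: infinite_finite_induct) (auto simp: xi_0 xi_add)

lemma xi_symmetric_mult:
  assumes "permute_vars (adj i) h = h"
  shows "xi i (h * f) = h * xi i f"
proof (rule xi_unique)
  have "(Var i - Var (Suc i)) * (h * xi i f) = h * ((Var i - Var (Suc i)) * xi i f)"
    by (rule mult.left_commute)
  then show "(Var i - Var (Suc i)) * (h * xi i f) =
      Var i * (h * f) - Var (Suc i) * permute_vars (adj i) (h * f)"
    unfolding xi_char by (simp add: permute_vars_mult assms algebra_simps)
qed

text \<open>
  This rule and the next one decide what \<open>xi i\<close> does to a row of labels that contains exactly one of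
  \<open>i\<close> and \<open>i + 1\<close>: the summands with \<open>i + 1\<close> vanish, and those with \<open>i\<close> split into two.
\<close>
lemma xi_Var_Suc_symmetric:
  assumes "permute_vars (adj i) f = f"
  shows "xi i (Var (Suc i) * f) = 0"
  by (rule xi_unique) (simp only: permute_vars_mult permute_vars_Var assms bij_transpose
      transpose_apply_second mult_zero_right mult.left_commute[of "Var i"] diff_self)

lemma xi_Var_mult: "xi i (Var i * f) = Var i * f + Var (Suc i) * xi i f"
proof (rule xi_unique)
  have "(Var i - Var (Suc i)) * (Var i * f + Var (Suc i) * xi i f) =
     (Var i - Var (Suc i)) * (Var i * f) + Var (Suc i) * ((Var i - Var (Suc i)) * xi i f)"
    by (simp add: algebra_simps)
  then show "(Var i - Var (Suc i)) * (Var i * f + Var (Suc i) * xi i f) =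
      Var i * (Var i * f) - Var (Suc i) * permute_vars (adj i) (Var i * f)"
    unfolding xi_char by (simp add: permute_vars_mult permute_vars_Var algebra_simps)
qed

section \<open>Setting variables to zero\<close>

lemma lookup_trunc_vars:
  assumes "finite {m. keys m \<subseteq> {1..n} \<and> f m \<noteq> 0}"
  shows "lookup (trunc_vars n f) m = (if keys m \<subseteq> {1..n} then f m else 0)"
proof -
  have "{m. (if keys m \<subseteq> {1..n} then f m else 0) \<noteq> 0} = {m. keys m \<subseteq> {1..n} \<and> f m \<noteq> 0}"
    by auto
  then show ?thesis using assms by (simp add: trunc_vars_def)
qed

text \<open>
  The truncation of series as a substitution in polynomials: \<open>x\<^sub>j = 0\<close> for \<open>j > n\<close> and for \<open>j = 0\<close>.
\<close>
definition restrict_vars :: "nat \<Rightarrow> pol \<Rightarrow> pol" where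
  "restrict_vars n p = trunc_vars n (lookup p)"

lemma lookup_restrict_vars:
  "lookup (restrict_vars n p) m = (if keys m \<subseteq> {1..n} then lookup p m else 0)"
  unfolding restrict_vars_def
  by (rule lookup_trunc_vars, rule finite_subset[of _ "keys p"]) (auto simp: in_keys_iff)

lemma restrict_vars_add: "restrict_vars n (p + q) = restrict_vars n p + restrict_vars n q"
  by (rule poly_mapping_eqI) (simp add: lookup_restrict_vars lookup_add)

lemma restrict_vars_diff: "restrict_vars n (p - q) = restrict_vars n p - restrict_vars n q"
  by (rule poly_mapping_eqI) (simp add: lookup_restrict_vars lookup_minus)

lemma restrict_vars_single:
  "restrict_vars n (single m c) = (if keys m \<subseteq> {1..n} then single m c else 0)"
  by (rule poly_mapping_eqI) (auto simp: lookup_restrict_vars lookup_single when_def)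

lemma keys_add_mon: "keys (a + b) = keys a \<union> keys (b :: mon)"
  by (auto simp: in_keys_iff lookup_add)

lemma restrict_vars_mult: "restrict_vars n (p * q) = restrict_vars n p * restrict_vars n q"
  by (rule multiplicative_if_on_monomials)
    (auto simp: restrict_vars_add restrict_vars_single keys_add_mon mult_single)

lemma restrict_vars_Var: "restrict_vars n (Var i) = (if i \<in> {1..n} then Var i else 0)"
  by (simp add: Var_def restrict_vars_single)

lemma restrict_vars_restrict_vars: "m \<le> n \<Longrightarrow> restrict_vars m (restrict_vars n p) = restrict_vars m p"
  by (rule poly_mapping_eqI) (auto simp: lookup_restrict_vars)

lemma keys_map_key_adj_subset:
  assumes "1 \<le> i" "i < n"
  shows "keys (map_key (adj i) m) \<subseteq> {1..n} \<longleftrightarrow> keys m \<subseteq> {1..n}"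
proof -
  have "adj i j \<in> {1..n} \<longleftrightarrow> j \<in> {1..n}" for j
    using assms by (auto simp: transpose_def)
  moreover have "keys (map_key (adj i) m) = adj i -` keys m"
    by (simp add: keys_map_key)
  ultimately show ?thesis
    by (smt (verit, best) subset_iff transpose_involutory vimage_eq)
qed

lemma restrict_vars_permute_vars:
  assumes "1 \<le> i" "i < n"
  shows "restrict_vars n (permute_vars (adj i) p) = permute_vars (adj i) (restrict_vars n p)"
  by (rule poly_mapping_eqI)
    (simp only: lookup_restrict_vars lookup_permute_vars keys_map_key_adj_subset[OF assms] bij_transpose)

lemma restrict_vars_xi:
  assumes "1 \<le> i" "i < n"
  shows "restrict_vars n (xi i p) = xi i (restrict_vars n p)"
proof (rule xi_unique[symmetric])
  show "(Var i - Var (Suc i)) * restrict_vars n (xi i p) =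
      Var i * restrict_vars n p - Var (Suc i) * permute_vars (adj i) (restrict_vars n p)"
    using arg_cong[OF xi_char[of i p], of "restrict_vars n"] assms
    by (simp add: restrict_vars_mult restrict_vars_diff restrict_vars_Var restrict_vars_permute_vars)
qed

text \<open>With \<open>x\<^bsub>n+1\<^esub> = 0\<close> the quotient defining \<open>\<xi>\<^sub>n\<close> becomes \<open>x\<^sub>n f / x\<^sub>n\<close>.\<close>
lemma restrict_vars_xi_top:
  assumes "1 \<le> n"
  shows "restrict_vars n (xi n p) = restrict_vars n p"
proof -
  have "Var n * restrict_vars n (xi n p) = Var n * restrict_vars n p"
    using arg_cong[OF xi_char[of n p], of "restrict_vars n"] assms
    by (simp add: restrict_vars_mult restrict_vars_diff restrict_vars_Var)
  then show ?thesis by (rule iffD1[OF mult_left_cancel[OF Var_nonzero]])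
qed

section \<open>Filling a diagram row by row\<close>

text \<open>
  A column \<open>(k, u)\<close> has \<open>u\<close> as its topmost label so far and \<open>k - 1\<close> boxes still to be filled. The value
  \<open>k = 1\<close> marks a column whose topmost box lies in the current row: its label still restricts the
  next row. A column with \<open>k = 0\<close> ended earlier and restricts nothing. Only differences of the \<open>k\<close> matter
  when two columns are compared, so they can stand for the heights of the columns. A step
  \<open>(k, u, v)\<close> adds the label \<open>v\<close> of the next box, where \<open>v = 0\<close> if there is none.
\<close>
type_synonym column = "nat \<times> nat"
type_synonym step = "nat \<times> nat \<times> nat"

definition step_ok :: "step \<Rightarrow> bool" where
  "step_ok = (\<lambda>(k, u, v). if 2 \<le> k then 1 \<le> v \<and> v \<le> u else v = 0)"

text \<open>
  The conditions on a column and another one to the right of it. Since labels weakly decrease along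
  the columns, a triple \<open>(u, v, w)\<close> can only be a co-inversion triple in the order \<open>u < v < w\<close>. If the
  left column is not taller, triples of type 2 and attacks between its new label \<open>v\<close> and the labels
  \<open>u'\<close>, \<open>v'\<close> of the right column exclude \<open>v' \<le> v \<le> u'\<close>. If it is taller, triples of type 1 and the
  attacks exclude \<open>v \<le> u' < u\<close> and \<open>v = v'\<close>; an attack \<open>v = u'\<close> with \<open>u < u'\<close> cannot occur, as \<open>v \<le> u\<close>.
\<close>
definition pair_ok :: "step \<Rightarrow> step \<Rightarrow> bool" where
  "pair_ok = (\<lambda>(k, u, v) (k', u', v'). 2 \<le> k \<and> 1 \<le> k' \<longrightarrow>
     (if k \<le> k' then u' < v \<or> v < v' else \<not> (v \<le> u' \<and> u' < u) \<and> (2 \<le> k' \<longrightarrow> v \<noteq> v')))"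

definition old_column :: "step \<Rightarrow> column" where
  "old_column = (\<lambda>(k, u, v). (k, u))"

definition new_column :: "step \<Rightarrow> column" where
  "new_column = (\<lambda>(k, u, v). (k - 1, v))"

definition row_steps :: "column list \<Rightarrow> step list set" where
  "row_steps cols = {ts. map old_column ts = cols \<and> (\<forall>t\<in>set ts. step_ok t)}"

definition weight :: "step list \<Rightarrow> pol" where
  "weight ts = prod_list (map (\<lambda>(k, u, v). if 2 \<le> k then Var v else 1) ts)"

fun filling_sum :: "nat \<Rightarrow> column list \<Rightarrow> pol" where
  "filling_sum 0 cols = 1"
| "filling_sum (Suc n) cols = (\<Sum>ts\<in>row_steps cols.
     if sorted_wrt pair_ok ts then weight ts * filling_sum n (map new_column ts) else 0)"

lemma step_simps [simp]:
  "old_column (k, u, v) = (k, u)" "new_column (k, u, v) = (k - 1, v)"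
  by (auto simp: old_column_def new_column_def)

lemma weight_simps [simp]:
  "weight [] = 1" "weight ((k, u, v) # ts) = (if 2 \<le> k then Var v else 1) * weight ts"
  "weight (ts @ ts') = weight ts * weight ts'"
  by (auto simp: weight_def)

definition step_values :: "column \<Rightarrow> nat set" where
  "step_values = (\<lambda>(k, u). if 2 \<le> k then {1..u} else {0})"

lemma finite_step_values [simp]: "finite (step_values c)"
  by (auto simp: step_values_def split: prod.splits)

lemma row_steps_Nil [simp]: "row_steps [] = {[]}"
  by (auto simp: row_steps_def)

lemma row_steps_Cons:
  "row_steps ((k, u) # cols) = (\<lambda>(v, ts). (k, u, v) # ts) ` (step_values (k, u) \<times> row_steps cols)"
  by (auto simp: row_steps_def step_ok_def step_values_def old_column_def map_eq_Cons_conv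
      image_iff split: if_splits)

lemma finite_row_steps [simp]: "finite (row_steps cols)"
  by (induction cols) (auto simp: row_steps_Cons)

lemma sum_row_steps_Cons:
  "sum f (row_steps ((k, u) # cols)) = (\<Sum>v\<in>step_values (k, u). \<Sum>ts\<in>row_steps cols. f ((k, u, v) # ts))"
  by (simp add: row_steps_Cons sum.reindex inj_on_def sum.cartesian_product split_def)

lemma sum_row_steps_append:
  "sum f (row_steps (cols @ cols')) = (\<Sum>l\<in>row_steps cols. \<Sum>r\<in>row_steps cols'. f (l @ r))"
proof (induction cols arbitrary: f)
  case (Cons c cols)
  obtain k u where "c = (k, u)" by (cases c)
  then show ?case by (simp add: sum_row_steps_Cons Cons)
qed simp

lemma row_stepsD: "l \<in> row_steps L \<Longrightarrow> t \<in> set l \<Longrightarrow> step_ok t \<and> old_column t \<in> set L"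
  by (auto simp: row_steps_def)

lemma row_steps_map: "l \<in> row_steps L \<Longrightarrow> L = map old_column l"
  by (auto simp: row_steps_def)

text \<open>
  A column that has come to its end restricts only the taller columns to its left, and only those
  with a larger label: it can exclude \<open>v \<le> b < u\<close>.
\<close>
lemma filling_sum_drop_column:
  assumes "k = 0 \<or> (k = 1 \<and> (\<forall>c\<in>set L. snd c < b))"
  shows "filling_sum n (L @ (k, b) # R) = filling_sum n (L @ R)"
  using assms
proof (induction n arbitrary: L k b R)
  case (Suc n)
  have k: "step_values (k, b) = {0}"
    using Suc.prems by (auto simp: step_values_def)
  have *: "(if sorted_wrt pair_ok (l @ (k, b, 0) # r)
        then weight (l @ (k, b, 0) # r) * filling_sum n (map new_column (l @ (k, b, 0) # r)) else 0) =
      (if sorted_wrt pair_ok (l @ r) then weight (l @ r) * filling_sum n (map new_column (l @ r)) else 0)"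
    if l: "l \<in> row_steps L" for l r
  proof -
    have 1: "pair_ok t (k, b, 0)" if "t \<in> set l" for t
    proof -
      obtain k' u' v' where t: "t = (k', u', v')" by (cases t)
      have "(k', u') \<in> set L" using row_stepsD[OF l that] by (simp add: t)
      then show ?thesis using Suc.prems by (auto simp: pair_ok_def t)
    qed
    have 2: "pair_ok (k, b, 0) t" for t
      using Suc.prems by (auto simp: pair_ok_def split: prod.splits)
    have "k - 1 = 0" "\<not> 2 \<le> k" using Suc.prems by auto
    then show ?thesis
      using Suc.IH[of 0 "map new_column l" 0 "map new_column r"]
      by (simp add: sorted_wrt_append 1 2)
  qed
  show ?case
    by (simp add: sum_row_steps_append sum_row_steps_Cons k * cong: sum.cong)
qed simp

section \<open>Exchanging two neighbouring columns\<close>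

text \<open>
  Columns to the left (or right) of a tall and a short column that treat these two differently,
  because their height is in between, and whose label separates the labels \<open>p < q\<close> of the two. The
  ties in height fall on the side on which \<open>pair_ok\<close> switches its branch.
\<close>
definition blocks_left :: "nat \<Rightarrow> nat \<Rightarrow> nat \<Rightarrow> nat \<Rightarrow> column \<Rightarrow> bool" where
  "blocks_left ks kt p q = (\<lambda>(k, u). ks < k \<and> k \<le> kt \<and> p < u \<and> u < q)"

definition blocks_right :: "nat \<Rightarrow> nat \<Rightarrow> nat \<Rightarrow> nat \<Rightarrow> column \<Rightarrow> bool" where
  "blocks_right ks kt p q = (\<lambda>(k, u). ks \<le> k \<and> k < kt \<and> p < u \<and> u < q)"

definition blocked :: "nat \<Rightarrow> nat \<Rightarrow> nat \<Rightarrow> nat \<Rightarrow> column list \<Rightarrow> column list \<Rightarrow> bool" where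
  "blocked ks kt p q L R \<longleftrightarrow> (\<exists>c\<in>set L. blocks_left ks kt p q c) \<or> (\<exists>c\<in>set R. blocks_right ks kt p q c)"

text \<open>
  The conditions between the outer columns and the two exchanged ones: the tall column has the old
  label \<open>a\<close> and the new label \<open>x\<close>, the short one has \<open>b\<close> and \<open>y\<close>.
\<close>
definition fits :: "nat \<Rightarrow> nat \<Rightarrow> nat \<Rightarrow> nat \<Rightarrow> nat \<Rightarrow> nat \<Rightarrow> step list \<Rightarrow> step list \<Rightarrow> bool" where
  "fits ks kt a b x y l r \<longleftrightarrow>
     (\<forall>t\<in>set l. pair_ok t (kt, a, x) \<and> pair_ok t (ks, b, y)) \<and>
     (\<forall>t\<in>set r. pair_ok (kt, a, x) t \<and> pair_ok (ks, b, y) t)"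

text \<open>
  The next three lemmas compare the ways of putting labels \<open>x < y\<close> on the tall and the short column
  in the next row, when the present labels of the two are \<open>p < q\<close> in either order. Each outer
  column can be checked for itself. A column that is taller or shorter than both imposes the same
  condition on the two arrangements that are compared. Only a column of intermediate height can make
  a difference, and it does so if its old or new label lies strictly between those of the two
  columns.
\<close>
lemmas step_unfolds = step_ok_def pair_ok_def blocks_left_def blocks_right_def prod.case step_simps fst_conv snd_conv

lemma fits_exchange_new:
  assumes "\<forall>t\<in>set l \<union> set r. step_ok t"
    "\<forall>c\<in>old_column ` (set l \<union> set r). 1 \<le> fst c \<longrightarrow> snd c \<noteq> p \<and> snd c \<noteq> q"
    "2 \<le> ks" "ks < kt" "x < y" "y \<le> p" "p < q"
  shows "fits ks kt p q x y l r \<longleftrightarrow> fits ks kt p q y x l r \<and>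
    \<not> blocked (ks - 1) (kt - 1) x y (map new_column l) (map new_column r)"
proof -
  have "pair_ok t (kt, p, x) \<and> pair_ok t (ks, q, y) \<longleftrightarrow>
      pair_ok t (kt, p, y) \<and> pair_ok t (ks, q, x) \<and> \<not> blocks_left (ks - 1) (kt - 1) x y (new_column t)"
    if "t \<in> set l" for t
  proof -
    obtain k u v where t: "t = (k, u, v)" by (cases t)
    have "step_ok t" "1 \<le> fst (old_column t) \<Longrightarrow> snd (old_column t) \<noteq> p \<and> snd (old_column t) \<noteq> q"
      using assms(1,2) that by auto
    then show ?thesis
      using assms(3-) unfolding t step_unfolds by (simp split: if_splits) auto
  qed
  moreover have "pair_ok (kt, p, x) t \<and> pair_ok (ks, q, y) t \<longleftrightarrow>
      pair_ok (kt, p, y) t \<and> pair_ok (ks, q, x) t \<and> \<not> blocks_right (ks - 1) (kt - 1) x y (new_column t)"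
    if "t \<in> set r" for t
  proof -
    obtain k u v where t: "t = (k, u, v)" by (cases t)
    have "step_ok t" "1 \<le> fst (old_column t) \<Longrightarrow> snd (old_column t) \<noteq> p \<and> snd (old_column t) \<noteq> q"
      using assms(1,2) that by auto
    then show ?thesis
      using assms(3-) unfolding t step_unfolds by (simp split: if_splits) auto
  qed
  ultimately show ?thesis unfolding fits_def blocked_def set_map by blast
qed

lemma fits_exchange_old:
  assumes "\<forall>t\<in>set l \<union> set r. step_ok t"
    "\<forall>c\<in>old_column ` (set l \<union> set r). 1 \<le> fst c \<longrightarrow> snd c \<noteq> p \<and> snd c \<noteq> q"
    "1 \<le> ks" "ks < kt" "x < y" "y \<le> p" "p < q"
  shows "fits ks kt q p y x l r \<longleftrightarrow> fits ks kt p q y x l r \<and>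
    \<not> blocked ks kt p q (map old_column l) (map old_column r)"
proof -
  have "pair_ok t (kt, q, y) \<and> pair_ok t (ks, p, x) \<longleftrightarrow>
      \<not> blocks_left ks kt p q (old_column t) \<and> pair_ok t (kt, p, y) \<and> pair_ok t (ks, q, x)"
    if "t \<in> set l" for t
  proof -
    obtain k u v where t: "t = (k, u, v)" by (cases t)
    have "step_ok t" "1 \<le> fst (old_column t) \<Longrightarrow> snd (old_column t) \<noteq> p \<and> snd (old_column t) \<noteq> q"
      using assms(1,2) that by auto
    then show ?thesis
      using assms(3-) unfolding t step_unfolds by (simp split: if_splits) auto
  qed
  moreover have "pair_ok (kt, q, y) t \<and> pair_ok (ks, p, x) t \<longleftrightarrow>
      \<not> blocks_right ks kt p q (old_column t) \<and> pair_ok (kt, p, y) t \<and> pair_ok (ks, q, x) t"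
    if "t \<in> set r" for t
  proof -
    obtain k u v where t: "t = (k, u, v)" by (cases t)
    have "step_ok t" "1 \<le> fst (old_column t) \<Longrightarrow> snd (old_column t) \<noteq> p \<and> snd (old_column t) \<noteq> q"
      using assms(1,2) that by auto
    then show ?thesis
      using assms(3-) unfolding t step_unfolds by (simp split: if_splits) auto
  qed
  ultimately show ?thesis unfolding fits_def blocked_def set_map by blast
qed

lemma fits_exchange_both:
  assumes "\<forall>t\<in>set l \<union> set r. step_ok t"
    "\<forall>c\<in>old_column ` (set l \<union> set r). 1 \<le> fst c \<longrightarrow> snd c \<noteq> p \<and> snd c \<noteq> q"
    "2 \<le> ks" "ks < kt" "x \<le> p" "p < y" "y \<le> q"
  shows "fits ks kt q p y x l r \<and>
      \<not> blocked (ks - 1) (kt - 1) x y (map new_column l) (map new_column r) \<longleftrightarrow>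
    fits ks kt p q x y l r \<and> \<not> blocked ks kt p q (map old_column l) (map old_column r)"
proof -
  have "pair_ok t (kt, q, y) \<and> pair_ok t (ks, p, x) \<and> \<not> blocks_left (ks - 1) (kt - 1) x y (new_column t) \<longleftrightarrow>
      \<not> blocks_left ks kt p q (old_column t) \<and> pair_ok t (kt, p, x) \<and> pair_ok t (ks, q, y)"
    if "t \<in> set l" for t
  proof -
    obtain k u v where t: "t = (k, u, v)" by (cases t)
    have "step_ok t" "1 \<le> fst (old_column t) \<Longrightarrow> snd (old_column t) \<noteq> p \<and> snd (old_column t) \<noteq> q"
      using assms(1,2) that by auto
    then show ?thesis
      using assms(3-) unfolding t step_unfolds by (simp split: if_splits) auto
  qed
  moreover have "pair_ok (kt, q, y) t \<and> pair_ok (ks, p, x) t \<and> \<not> blocks_right (ks - 1) (kt - 1) x y (new_column t) \<longleftrightarrow>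
      \<not> blocks_right ks kt p q (old_column t) \<and> pair_ok (kt, p, x) t \<and> pair_ok (ks, q, y) t"
    if "t \<in> set r" for t
  proof -
    obtain k u v where t: "t = (k, u, v)" by (cases t)
    have "step_ok t" "1 \<le> fst (old_column t) \<Longrightarrow> snd (old_column t) \<noteq> p \<and> snd (old_column t) \<noteq> q"
      using assms(1,2) that by auto
    then show ?thesis
      using assms(3-) unfolding t step_unfolds by (simp split: if_splits) auto
  qed
  ultimately show ?thesis unfolding fits_def blocked_def set_map by blast
qed

lemma sum_square_eq_if_pairs_eq:
  fixes f g :: "'b::linorder \<Rightarrow> 'b \<Rightarrow> 'a::comm_monoid_add"
  assumes "finite A"
    and pairs: "\<And>x y. x \<in> A \<Longrightarrow> y \<in> A \<Longrightarrow> x < y \<Longrightarrow> f x y + f y x = g x y + g y x"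
    and diag: "\<And>x. x \<in> A \<Longrightarrow> f x x = g x x"
  shows "(\<Sum>x\<in>A. \<Sum>y\<in>A. f x y) = (\<Sum>x\<in>A. \<Sum>y\<in>A. g x y)"
proof -
  let ?U = "{(x, y). x \<in> A \<and> y \<in> A \<and> x < y}"
  have split: "(\<Sum>x\<in>A. \<Sum>y\<in>A. h x y) = (\<Sum>(x, y)\<in>?U. h x y + h y x) + (\<Sum>x\<in>A. h x x)"
    for h :: "'b \<Rightarrow> 'b \<Rightarrow> 'a"
  proof -
    let ?V = "(\<lambda>(x, y). (y, x)) ` ?U"
    let ?D = "(\<lambda>x. (x, x)) ` A"
    have fin: "finite ?U" by (rule finite_subset[of _ "A \<times> A"]) (auto simp: assms)
    have "A \<times> A = (?U \<union> ?V) \<union> ?D" by (auto simp: image_iff)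
    moreover have "(\<Sum>(x, y)\<in>(?U \<union> ?V) \<union> ?D. h x y) = (\<Sum>(x, y)\<in>?U \<union> ?V. h x y) + (\<Sum>(x, y)\<in>?D. h x y)"
      using fin assms(1) by (intro sum.union_disjoint) auto
    moreover have "(\<Sum>(x, y)\<in>?U \<union> ?V. h x y) = (\<Sum>(x, y)\<in>?U. h x y) + (\<Sum>(x, y)\<in>?V. h x y)"
      using fin by (intro sum.union_disjoint) auto
    moreover have "(\<Sum>(x, y)\<in>?V. h x y) = (\<Sum>(x, y)\<in>?U. h y x)"
      by (subst sum.reindex) (auto simp: inj_on_def split_def)
    moreover have "(\<Sum>(x, y)\<in>?D. h x y) = (\<Sum>x\<in>A. h x x)"
      by (subst sum.reindex) (auto simp: inj_on_def)
    ultimately show ?thesis by (simp add: sum.cartesian_product sum.distrib split_def)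
  qed
  show ?thesis
    unfolding split using pairs diag by (intro arg_cong2[of _ _ _ _ "(+)"] sum.cong) auto
qed

text \<open>
  The conditions on a next row are separated into those that involve two neighbouring columns and
  those on the remaining ones.
\<close>
lemma row_sum_two_columns:
  "filling_sum (Suc n) (L @ [(k1, a), (k2, b)] @ R) =
    (\<Sum>l\<in>row_steps L. \<Sum>r\<in>row_steps R. \<Sum>x\<in>step_values (k1, a). \<Sum>y\<in>step_values (k2, b).
      if sorted_wrt pair_ok (l @ r) \<and> pair_ok (k1, a, x) (k2, b, y) \<and>
        (\<forall>t\<in>set l. pair_ok t (k1, a, x) \<and> pair_ok t (k2, b, y)) \<and>
        (\<forall>t\<in>set r. pair_ok (k1, a, x) t \<and> pair_ok (k2, b, y) t)
      then weight (l @ r) * weight [(k1, a, x), (k2, b, y)] *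
        filling_sum n (map new_column l @ [(k1 - 1, x), (k2 - 1, y)] @ map new_column r)
      else 0)"
proof -
  have "filling_sum (Suc n) (L @ [(k1, a), (k2, b)] @ R) =
    (\<Sum>l\<in>row_steps L. \<Sum>x\<in>step_values (k1, a). \<Sum>y\<in>step_values (k2, b). \<Sum>r\<in>row_steps R.
      if sorted_wrt pair_ok (l @ (k1, a, x) # (k2, b, y) # r)
      then weight (l @ (k1, a, x) # (k2, b, y) # r) *
        filling_sum n (map new_column (l @ (k1, a, x) # (k2, b, y) # r))
      else 0)"
    by (simp only: filling_sum.simps sum_row_steps_append sum_row_steps_Cons row_steps_Nil append_Cons append_Nil)
  also have "\<dots> = (\<Sum>l\<in>row_steps L. \<Sum>r\<in>row_steps R. \<Sum>x\<in>step_values (k1, a). \<Sum>y\<in>step_values (k2, b).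
      if sorted_wrt pair_ok (l @ (k1, a, x) # (k2, b, y) # r)
      then weight (l @ (k1, a, x) # (k2, b, y) # r) *
        filling_sum n (map new_column (l @ (k1, a, x) # (k2, b, y) # r))
      else 0)"
    by (subst (2) sum.swap, subst sum.swap) (rule refl)
  also have "\<dots> = (\<Sum>l\<in>row_steps L. \<Sum>r\<in>row_steps R. \<Sum>x\<in>step_values (k1, a). \<Sum>y\<in>step_values (k2, b).
      if sorted_wrt pair_ok (l @ r) \<and> pair_ok (k1, a, x) (k2, b, y) \<and>
        (\<forall>t\<in>set l. pair_ok t (k1, a, x) \<and> pair_ok t (k2, b, y)) \<and>
        (\<forall>t\<in>set r. pair_ok (k1, a, x) t \<and> pair_ok (k2, b, y) t)
      then weight (l @ r) * weight [(k1, a, x), (k2, b, y)] *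
        filling_sum n (map new_column l @ [(k1 - 1, x), (k2 - 1, y)] @ map new_column r)
      else 0)"
    by (intro sum.cong refl if_cong) (auto simp: sorted_wrt_append mult_ac)
  finally show ?thesis .
qed


lemma sum_restrict_square:
  fixes a b N :: nat
  assumes "a \<le> N" "b \<le> N"
  shows "(\<Sum>x\<in>{1..a}. \<Sum>y\<in>{1..b}. f x y) =
    (\<Sum>x\<in>{1..N}. \<Sum>y\<in>{1..N}. if x \<le> a \<and> y \<le> b then f x y else (0::'a::comm_monoid_add))"
proof -
  have "(\<Sum>y\<in>{1..N}. if x \<le> a \<and> y \<le> b then f x y else 0) = (if x \<le> a then \<Sum>y\<in>{1..b}. f x y else 0)" for x
    using assms by (auto simp: sum.inter_filter[symmetric] intro!: sum.cong)
  moreover have "(\<Sum>x\<in>{1..N}. if x \<le> a then \<Sum>y\<in>{1..b}. f x y else 0) = (\<Sum>x\<in>{1..a}. \<Sum>y\<in>{1..b}. f x y)"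
    using assms by (auto simp: sum.inter_filter[symmetric] intro!: sum.cong)
  ultimately show ?thesis by simp
qed

definition new_labels_differ :: "nat \<Rightarrow> nat \<Rightarrow> column list \<Rightarrow> bool" where
  "new_labels_differ p q cols \<longleftrightarrow> (\<forall>c\<in>set cols. 1 \<le> fst c \<longrightarrow> snd c \<noteq> p \<and> snd c \<noteq> q)"

lemma fits_labels_differ:
  assumes "\<forall>t\<in>set l \<union> set r. step_ok t" "fits ks kt a b x y l r" "x \<le> a" "y \<le> b" "2 \<le> ks" "2 \<le> kt"
  shows "new_labels_differ x y (map new_column l @ map new_column r)"
proof -
  have "snd (new_column t) \<noteq> x \<and> snd (new_column t) \<noteq> y"
    if "1 \<le> fst (new_column t)" "t \<in> set l \<union> set r" for t
  proof (cases t)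
    case (fields k u v)
    have "step_ok t" using assms(1) that(2) by blast
    moreover have "pair_ok t (kt, a, x) \<and> pair_ok t (ks, b, y) \<or> pair_ok (kt, a, x) t \<and> pair_ok (ks, b, y) t"
      using assms(2) that(2) by (auto simp: fits_def)
    ultimately show ?thesis
      using assms(3-) that(1) unfolding fields step_ok_def pair_ok_def step_simps prod.case fst_conv snd_conv
      by (auto split: if_splits)
  qed
  then show ?thesis unfolding new_labels_differ_def set_append set_map by blast
qed

text \<open>
  For fixed outer columns, let \<open>G a b\<close> and \<open>H a b\<close> be the sums for a tall column with label \<open>a\<close> and a
  short one with label \<open>b\<close>, with the tall column on the left in \<open>G\<close> and on the right in \<open>H\<close>. For
  \<open>p < q\<close> the aim is \<open>G p q = H p q\<close>. An induction over the rows cannot prove this alone, because the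
  next row may put the larger label on the tall column. In that case \<open>G q p = H q p - H p q\<close>, and the
  correction \<open>H p q\<close> is absent if some outer column is blocking. Both equations are proved
  simultaneously: for a given next row outside the two columns, the induction hypothesis turns
  everything into values \<open>H x y\<close> and \<open>H y x\<close> for pairs \<open>x < y\<close> of new labels, whose coefficients agree
  by the previous lemmas.
\<close>
lemma exchange_columns:
  assumes "1 \<le> ks" "ks < kt" "kt \<le> Suc n" "p < q" "new_labels_differ p q (L @ R)"
  shows "filling_sum n (L @ [(kt, p), (ks, q)] @ R) = filling_sum n (L @ [(ks, q), (kt, p)] @ R) \<and>
    filling_sum n (L @ [(kt, q), (ks, p)] @ R) +
      (if blocked ks kt p q L R then 0 else filling_sum n (L @ [(ks, q), (kt, p)] @ R)) =
    filling_sum n (L @ [(ks, p), (kt, q)] @ R)"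
  using assms
proof (induction n arbitrary: ks kt p q L R)
  case 0
  then show ?case by simp
next
  case (Suc n)
  have kt: "2 \<le> kt" using Suc.prems by simp
  have IH: "filling_sum n (L @ [(kt - 1, x), (ks - 1, y)] @ R) = filling_sum n (L @ [(ks - 1, y), (kt - 1, x)] @ R) \<and>
    filling_sum n (L @ [(kt - 1, y), (ks - 1, x)] @ R) +
      (if blocked (ks - 1) (kt - 1) x y L R then 0 else filling_sum n (L @ [(ks - 1, y), (kt - 1, x)] @ R)) =
    filling_sum n (L @ [(ks - 1, x), (kt - 1, y)] @ R)"
    if "2 \<le> ks" "x < y" "new_labels_differ x y (L @ R)" for x y L R
    using Suc.prems that by (intro Suc.IH) auto
  have ok: "\<forall>t\<in>set l \<union> set r. step_ok t" "L = map old_column l" "R = map old_column r"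
    "\<forall>c\<in>old_column ` (set l \<union> set r). 1 \<le> fst c \<longrightarrow> snd c \<noteq> p \<and> snd c \<noteq> q"
    if "l \<in> row_steps L" "r \<in> row_steps R" for l r
  proof -
    show "L = map old_column l" "R = map old_column r" using that by (auto dest: row_steps_map)
    show "\<forall>t\<in>set l \<union> set r. step_ok t" using that by (auto dest: row_stepsD)
    show "\<forall>c\<in>old_column ` (set l \<union> set r). 1 \<le> fst c \<longrightarrow> snd c \<noteq> p \<and> snd c \<noteq> q"
      using Suc.prems(5) unfolding new_labels_differ_def row_steps_map[OF that(1)] row_steps_map[OF that(2)]
      by (simp only: set_append set_map image_Un)
  qed
  show ?case
  proof (cases "ks = 1")
    case True
    \<comment> \<open>The short column gets no box in the next row; afterwards both arrangements coincide.\<close>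
    define f where "f a b l r x = (if x \<le> a \<and> fits ks kt a b x 0 l r
        then Var x * filling_sum n (map new_column l @ [(kt - 1, x)] @ map new_column r) else 0)" for a b l r x
    define S where "S g = (\<Sum>l\<in>row_steps L. \<Sum>r\<in>row_steps R. \<Sum>x\<in>{1..q}.
        if sorted_wrt pair_ok (l @ r) then weight (l @ r) * g l r x else 0)" for g :: "step list \<Rightarrow> step list \<Rightarrow> nat \<Rightarrow> pol"
    have drop: "filling_sum n (map new_column l @ [(kt - 1, x), (ks - 1, 0)] @ map new_column r) =
        filling_sum n (map new_column l @ [(kt - 1, x)] @ map new_column r)"
      "filling_sum n (map new_column l @ [(ks - 1, 0), (kt - 1, x)] @ map new_column r) =
        filling_sum n (map new_column l @ [(kt - 1, x)] @ map new_column r)" for l r x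
      using filling_sum_drop_column[of 0 "map new_column l @ [(kt - 1, x)]" 0 n "map new_column r"]
        filling_sum_drop_column[of 0 "map new_column l" 0 n "(kt - 1, x) # map new_column r"] True by simp_all
    have weights: "weight [(kt, a, x), (ks, b, 0)] = Var x" "weight [(ks, b, 0), (kt, a, x)] = Var x" for a b x
      using kt True by simp_all
    have sv: "step_values (ks, b) = {0}" "step_values (kt, b) = {1..b}" for b
      using True kt by (auto simp: step_values_def)
    have restrict: "(\<Sum>x\<in>{1..a}. g x) = (\<Sum>x\<in>{1..q}. if x \<le> a then g x else 0)" if "a \<le> q" for a and g :: "nat \<Rightarrow> pol"
      using that by (auto simp: sum.inter_filter[symmetric] intro!: sum.cong)
    have sum_zero: "(\<Sum>y\<in>{0}. g y) = g 0" for g :: "nat \<Rightarrow> pol" by simp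
    have short_left: "pair_ok (ks, b, y) c = True" for b y c using True by (auto simp: pair_ok_def split: prod.split)
    have TL: "filling_sum (Suc n) (L @ [(kt, a), (ks, b)] @ R) =
        S (\<lambda>l r x. if pair_ok (kt, a, x) (ks, b, 0) then f a b l r x else 0)" if "a \<le> q" for a b
      unfolding row_sum_two_columns S_def sv restrict[OF that]
      by (intro sum.cong refl, simp only: sum_zero drop weights f_def fits_def short_left simp_thms if_True,
          simp only: mult.assoc mult_zero_right if_distrib[of "\<lambda>z. _ * z"] True split: if_split, blast)
    have TR: "filling_sum (Suc n) (L @ [(ks, b), (kt, a)] @ R) = S (\<lambda>l r x. f a b l r x)" if "a \<le> q" for a b
      unfolding row_sum_two_columns S_def sv restrict[OF that] sum_zero
      by (intro sum.cong refl, simp only: sum_zero drop weights f_def fits_def short_left simp_thms if_True,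
          simp only: mult.assoc mult_zero_right if_distrib[of "\<lambda>z. _ * z"] True split: if_split, blast)
    have ptrue: "pair_ok (kt, p, x) (ks, q, 0)" and piff: "pair_ok (kt, q, x) (ks, p, 0) \<longleftrightarrow> p < x" for x
      using kt True Suc.prems(4) by (auto simp: pair_ok_def)
    have "S (\<lambda>l r x. (if p < x then f q p l r x else 0) + (if blocked ks kt p q L R then 0 else f p q l r x)) =
        S (\<lambda>l r x. f q p l r x)"
      unfolding S_def
    proof (intro sum.cong refl if_cong arg_cong2[of _ _ _ _ "(*)"])
      fix l r x assume lr: "l \<in> row_steps L" "r \<in> row_steps R" and x: "x \<in> {1..q}"
      show "(if p < x then f q p l r x else 0) + (if blocked ks kt p q L R then 0 else f p q l r x) = f q p l r x"
      proof (cases "p < x")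
        case False
        then have "fits ks kt q p x 0 l r \<longleftrightarrow> fits ks kt p q x 0 l r \<and> \<not> blocked ks kt p q L R"
          using fits_exchange_old[OF ok(1,4)[OF lr], of ks kt 0 x] Suc.prems x ok(2,3)[OF lr] by auto
        then show ?thesis using False Suc.prems(4) by (simp add: f_def)
      qed (simp add: f_def)
    qed
    moreover have "S (\<lambda>l r x. g l r x + (if c then 0 else h l r x)) = S g + (if c then 0 else S h)"
      for g h :: "step list \<Rightarrow> step list \<Rightarrow> nat \<Rightarrow> pol" and c
      unfolding S_def by (cases c) (simp_all add: sum.distrib[symmetric] distrib_left if_distrib cong: if_cong)
    ultimately have "S (\<lambda>l r x. if p < x then f q p l r x else 0) + (if blocked ks kt p q L R then 0 else S (f p q)) = S (f q p)"
      by simp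
    then show ?thesis
      using Suc.prems(4) by (simp only: TL TR less_imp_le le_refl ptrue piff if_True)
  next
    case False
    then have ks: "2 \<le> ks" using Suc.prems by simp
    define G where "G l r x y = filling_sum n (map new_column l @ [(kt - 1, x), (ks - 1, y)] @ map new_column r)" for l r x y
    define H where "H l r x y = filling_sum n (map new_column l @ [(ks - 1, y), (kt - 1, x)] @ map new_column r)" for l r x y
    define w where "w l r x y = weight (l @ r) * (Var x * Var y)" for l r x y
    define tG where "tG a b l r x y = (if sorted_wrt pair_ok (l @ r) \<and> (x \<le> a \<and> y \<le> b) \<and> fits ks kt a b x y l r \<and>
        pair_ok (kt, a, x) (ks, b, y) then w l r x y * G l r x y else 0)" for a b l r x y
    define tH where "tH a b l r x y = (if sorted_wrt pair_ok (l @ r) \<and> (x \<le> a \<and> y \<le> b) \<and> fits ks kt a b x y l r \<and>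
        pair_ok (ks, b, y) (kt, a, x) then w l r x y * H l r x y else 0)" for a b l r x y
    have sv: "step_values (ks, b) = {1..b}" "step_values (kt, b) = {1..b}" for b
      using ks kt by (auto simp: step_values_def)
    have weights: "weight [(kt, a, x), (ks, b, y)] = Var x * Var y" "weight [(ks, b, y), (kt, a, x)] = Var x * Var y" for a b x y
      using ks kt by (simp_all add: mult.commute)
    have TL: "filling_sum (Suc n) (L @ [(kt, a), (ks, b)] @ R) =
        (\<Sum>l\<in>row_steps L. \<Sum>r\<in>row_steps R. \<Sum>x\<in>{1..q}. \<Sum>y\<in>{1..q}. tG a b l r x y)" if "a \<le> q" "b \<le> q" for a b
      unfolding row_sum_two_columns sv sum_restrict_square[OF that]
      by (intro sum.cong refl, simp only: tG_def fits_def G_def w_def weights split: if_split, blast)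
    have TR: "filling_sum (Suc n) (L @ [(ks, b), (kt, a)] @ R) =
        (\<Sum>l\<in>row_steps L. \<Sum>r\<in>row_steps R. \<Sum>x\<in>{1..q}. \<Sum>y\<in>{1..q}. tH a b l r x y)" if "a \<le> q" "b \<le> q" for a b
      unfolding row_sum_two_columns sv sum_restrict_square[OF that(2,1)]
      by (subst sum.swap[of _ "{1..q}" "{1..q}"], intro sum.cong refl,
          simp only: tH_def fits_def H_def w_def weights split: if_split, blast)
    have diag: "tG a b l r x x = 0" "tH a b l r x x = 0" for a b l r x
      using ks kt Suc.prems(2) by (auto simp: tG_def tH_def pair_ok_def)
    have w_sym: "w l r y x = w l r x y" for l r x y
      by (simp add: w_def mult_ac)
    have pair: "pair_ok (kt, a, x) (ks, b, y) \<longleftrightarrow> \<not> (x \<le> b \<and> b < a) \<and> x \<noteq> y"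
      "pair_ok (ks, b, y) (kt, a, x) \<longleftrightarrow> a < y \<or> y < x" for a b x y
      using ks kt Suc.prems(2) by (auto simp: pair_ok_def)
    \<comment> \<open>The coefficients of the pair \<open>x < y\<close> in the two equations.\<close>
    have pairs1: "tG p q l r x y + tG p q l r y x = tH p q l r x y + tH p q l r y x"
      and pairs2: "(tG q p l r x y + (if blocked ks kt p q L R then 0 else tH p q l r x y)) +
        (tG q p l r y x + (if blocked ks kt p q L R then 0 else tH p q l r y x)) = tH q p l r x y + tH q p l r y x"
      if lr: "l \<in> row_steps L" "r \<in> row_steps R" and "x < y" for l r x y
    proof -
      let ?b = "blocked (ks - 1) (kt - 1) x y (map new_column l) (map new_column r)"
      note okl = ok[OF lr]
      have IH1: "G l r x y = H l r x y" and IH2: "G l r y x + (if ?b then 0 else H l r x y) = H l r y x"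
        if "new_labels_differ x y (map new_column l @ map new_column r)"
        using IH[OF ks \<open>x < y\<close> that] by (auto simp: G_def H_def)
      have differ: "new_labels_differ x y (map new_column l @ map new_column r)"
        if "fits ks kt a b x y l r \<and> x \<le> a \<and> y \<le> b \<or> fits ks kt a b y x l r \<and> y \<le> a \<and> x \<le> b" for a b
        using that fits_labels_differ[OF okl(1) _ _ _ ks kt, of a b x y] fits_labels_differ[OF okl(1) _ _ _ ks kt, of a b y x]
        by (auto simp: new_labels_differ_def)
      have IH3: "w l r x y * G l r y x + (if ?b then 0 else w l r x y * H l r x y) = w l r x y * H l r y x"
        if "new_labels_differ x y (map new_column l @ map new_column r)"
        using arg_cong[OF IH2[OF that], of "\<lambda>z. w l r x y * z"] by (simp add: distrib_left if_distrib cong: if_cong)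
      \<comment> \<open>If \<open>y \<le> p\<close>, then \<open>G\<close> admits both placements of \<open>x\<close> and \<open>y\<close>, while \<open>H\<close> needs \<open>y\<close> on the tall column.\<close>
      show "tG p q l r x y + tG p q l r y x = tH p q l r x y + tH p q l r y x"
      proof (cases "y \<le> p")
        case True
        have "fits ks kt p q x y l r \<longleftrightarrow> fits ks kt p q y x l r \<and> \<not> ?b"
          using fits_exchange_new[OF okl(1,4) ks, of kt x y] Suc.prems \<open>x < y\<close> True by auto
        then show ?thesis
          using True \<open>x < y\<close> Suc.prems(4) differ[of p q] IH1 IH3
          by (auto simp: tG_def tH_def pair w_sym[of l r y x] add.commute split: if_splits)
      next
        case False
        then show ?thesis
          using \<open>x < y\<close> Suc.prems(4) differ[of p q] IH1
          by (auto simp: tG_def tH_def pair)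
      qed
      show "(tG q p l r x y + (if blocked ks kt p q L R then 0 else tH p q l r x y)) +
        (tG q p l r y x + (if blocked ks kt p q L R then 0 else tH p q l r y x)) = tH q p l r x y + tH q p l r y x"
      proof (cases "y \<le> p")
        case True
        have "fits ks kt q p y x l r \<longleftrightarrow> fits ks kt p q y x l r \<and> \<not> blocked ks kt p q L R"
          using fits_exchange_old[OF okl(1,4), of ks kt x y] Suc.prems \<open>x < y\<close> True okl(2,3) by auto
        then show ?thesis
          using True \<open>x < y\<close> Suc.prems(4)
          by (auto simp: tG_def tH_def pair w_sym[of l r y x])
      next
        case False
        have "fits ks kt q p y x l r \<and> \<not> ?b \<longleftrightarrow> fits ks kt p q x y l r \<and> \<not> blocked ks kt p q L R"
          if "x \<le> p" "y \<le> q"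
          using fits_exchange_both[OF okl(1,4) ks, of kt x y] Suc.prems that False okl(2,3) by auto
        then show ?thesis
          using False \<open>x < y\<close> Suc.prems(4) differ[of q p] IH1 IH3
          by (auto simp: tG_def tH_def pair w_sym[of l r y x] add.commute split: if_splits)
      qed
    qed
    have "(\<Sum>x\<in>{1..q}. \<Sum>y\<in>{1..q}. tG p q l r x y) = (\<Sum>x\<in>{1..q}. \<Sum>y\<in>{1..q}. tH p q l r x y)"
      if "l \<in> row_steps L" "r \<in> row_steps R" for l r
      using pairs1[OF that] by (intro sum_square_eq_if_pairs_eq) (auto simp: diag)
    note square1 = this
    have eq1: "(\<Sum>l\<in>row_steps L. \<Sum>r\<in>row_steps R. \<Sum>x\<in>{1..q}. \<Sum>y\<in>{1..q}. tG p q l r x y) =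
        (\<Sum>l\<in>row_steps L. \<Sum>r\<in>row_steps R. \<Sum>x\<in>{1..q}. \<Sum>y\<in>{1..q}. tH p q l r x y)"
      by (rule sum.cong[OF refl], rule sum.cong[OF refl], rule square1)
    have "(\<Sum>x\<in>{1..q}. \<Sum>y\<in>{1..q}. tG q p l r x y + (if blocked ks kt p q L R then 0 else tH p q l r x y)) =
        (\<Sum>x\<in>{1..q}. \<Sum>y\<in>{1..q}. tH q p l r x y)"
      if "l \<in> row_steps L" "r \<in> row_steps R" for l r
      using pairs2[OF that] by (intro sum_square_eq_if_pairs_eq) (auto simp: diag)
    note square2 = this
    have eq2: "(\<Sum>l\<in>row_steps L. \<Sum>r\<in>row_steps R. \<Sum>x\<in>{1..q}. \<Sum>y\<in>{1..q}.
          tG q p l r x y + (if blocked ks kt p q L R then 0 else tH p q l r x y)) =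
        (\<Sum>l\<in>row_steps L. \<Sum>r\<in>row_steps R. \<Sum>x\<in>{1..q}. \<Sum>y\<in>{1..q}. tH q p l r x y)"
      by (rule sum.cong[OF refl], rule sum.cong[OF refl], rule square2)
    show ?thesis
      using Suc.prems(4) eq1 eq2
      by (cases "blocked ks kt p q L R")
        (simp_all only: TL TR less_imp_le le_refl sum.distrib if_True if_False sum.neutral_const add_0_right simp_thms)
  qed
qed

section \<open>Exchanging two labels of the basement\<close>

text \<open>
  For weakly increasing heights only one branch of \<open>pair_ok\<close> remains, and the condition on two
  consecutive rows \<open>u\<close> and \<open>v\<close> does not mention the heights any more.
\<close>
definition row_follows :: "nat \<Rightarrow> (nat \<Rightarrow> nat) \<Rightarrow> (nat \<Rightarrow> nat) \<Rightarrow> bool" where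
  "row_follows n u v \<longleftrightarrow> (\<forall>c<n. 1 \<le> v c \<and> v c \<le> u c) \<and> (\<forall>d<n. \<forall>c<d. u d < v c \<or> v c < v d)"

text \<open>
  The label \<open>i\<close> stands to the left of \<open>i + 1\<close>, where a missing label counts as standing to the left
  of all columns, as if it belonged to a column of height zero.
\<close>
definition in_order :: "nat \<Rightarrow> nat \<Rightarrow> (nat \<Rightarrow> nat) \<Rightarrow> bool" where
  "in_order i n u \<longleftrightarrow> (\<forall>c<n. u c = i \<longrightarrow> (\<exists>d. c < d \<and> d < n \<and> u d = Suc i))"

lemma adj_eq: "adj i x = (if x = i then Suc i else if x = Suc i then i else x)"
  by (auto simp: transpose_def)

lemma row_followsD:
  assumes "row_follows n u v"
  shows "c < n \<Longrightarrow> 1 \<le> v c" "c < n \<Longrightarrow> v c \<le> u c" "c < d \<Longrightarrow> d < n \<Longrightarrow> u d < v c \<or> v c < v d"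
  using assms by (auto simp: row_follows_def)

text \<open>
  The labels \<open>i\<close> and \<open>i + 1\<close> of the old row differ only as bounds for a new label \<open>i + 1\<close>.
\<close>
lemma row_follows_adj_iff:
  assumes "\<forall>c<n. v c \<noteq> Suc i"
  shows "row_follows n (adj i \<circ> u) v \<longleftrightarrow> row_follows n u v"
proof -
  have less: "adj i (u d) < v c \<longleftrightarrow> u d < v c" if "c < n" for c d
    using assms that by (auto simp: adj_eq)
  have le: "v c \<le> adj i (u c) \<longleftrightarrow> v c \<le> u c" if "c < n" for c
    using less[OF that, of c] by linarith
  show ?thesis
    unfolding row_follows_def comp_apply
    by (intro arg_cong2[of _ _ _ _ "(\<and>)"] all_cong1 imp_cong[OF refl]) (simp_all add: less le)
qed

text \<open>
  Raising the label \<open>i\<close> of the new row to \<open>i + 1\<close> matters only if it stands in the column of an old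
  label \<open>i\<close>, or to the left of that column. The old label \<open>i + 1\<close> further to the right excludes this,
  both before and after raising.
\<close>
lemma row_follows_raise_iff:
  assumes "1 \<le> i" "in_order i n u" "\<forall>c<n. v c \<noteq> Suc i"
  shows "row_follows n u (adj i \<circ> v) \<longleftrightarrow> row_follows n u v"
proof
  assume R: "row_follows n u v"
  have "u c \<noteq> i" if "c < n" "v c = i" for c
  proof
    assume "u c = i"
    then obtain d where d: "c < d" "d < n" "u d = Suc i" using assms(2) \<open>c < n\<close> by (auto simp: in_order_def)
    then have "v c < v d" using row_followsD(3)[OF R d(1,2)] that by auto
    then show False using row_followsD(2)[OF R d(2)] d that assms(3) by (metis le_antisym Suc_leI)
  qed
  then have "1 \<le> adj i (v c) \<and> adj i (v c) \<le> u c" if "c < n" for c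
    using row_followsD(1,2)[OF R that] that assms(1,3) by (auto simp: adj_eq) (metis le_antisym not_less_eq_eq)
  moreover have "u d < adj i (v c) \<or> adj i (v c) < adj i (v d)" if "d < n" "c < d" for c d
    using row_followsD(3)[OF R that(2,1)] that assms(3) by (auto simp: adj_eq)
  ultimately show "row_follows n u (adj i \<circ> v)" by (simp add: row_follows_def)
next
  assume R: "row_follows n u (adj i \<circ> v)"
  have le: "v c \<le> u c" if "c < n" for c
    using row_followsD(2)[OF R that] assms(3) that by (auto simp: adj_eq split: if_splits)
  moreover have "1 \<le> v c" if "c < n" for c
    using row_followsD(1)[OF R that] assms(1,3) that by (auto simp: adj_eq split: if_splits)
  moreover have "u d < v c \<or> v c < v d" if "d < n" "c < d" for c d
  proof (rule ccontr)
    assume neg: "\<not> (u d < v c \<or> v c < v d)"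
    have "u d < adj i (v c) \<or> adj i (v c) < adj i (v d)" using row_followsD(3)[OF R that(2,1)] by simp
    then have "v c = i" "u d = i" using neg assms(3) that by (auto simp: adj_eq split: if_splits)
    then obtain e where e: "d < e" "e < n" "u e = Suc i" using assms(2) \<open>d < n\<close> by (auto simp: in_order_def)
    have "u e < adj i (v c) \<or> adj i (v c) < adj i (v e)"
      using row_followsD(3)[OF R order.strict_trans[OF that(2) e(1)] e(2)] by simp
    moreover have "adj i (v e) \<le> Suc i" using row_followsD(2)[OF R e(2)] e by simp
    ultimately show False using e \<open>v c = i\<close> by (simp add: adj_eq)
  qed
  ultimately show "row_follows n u v" by (simp add: row_follows_def)
qed

lemma not_row_follows_lowered:
  assumes "in_order i n u" "p < q" "q < n" "v p = i" "v q = Suc i"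
  shows "\<not> row_follows n u (adj i \<circ> v)"
proof
  assume R: "row_follows n u (adj i \<circ> v)"
  have "u q < Suc i" "i \<le> u q"
    using row_followsD(3)[OF R assms(2,3)] row_followsD(2)[OF R assms(3)] assms by auto
  then have "u q = i" by simp
  then obtain d where d: "q < d" "d < n" "u d = Suc i" using assms by (auto simp: in_order_def)
  have "u d < Suc i \<or> Suc i < adj i (v d)"
    using row_followsD(3)[OF R order.strict_trans[OF assms(2) d(1)] d(2)] assms by simp
  moreover have "adj i (v d) \<le> Suc i" using row_followsD(2)[OF R d(2)] d by simp
  ultimately show False using d by simp
qed

lemma pair_lower:
  assumes "adj i b < adj i x \<or> adj i x < adj i y" "x \<noteq> y" "x = Suc i \<longrightarrow> y \<noteq> i"
    "b = Suc i \<longleftrightarrow> y = Suc i"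
  shows "b < x \<or> x < y"
  using assms unfolding adj_eq by presburger

lemma pair_raise:
  assumes "b < x \<or> x < y" "x \<noteq> y" "x = Suc i \<longrightarrow> y \<noteq> i \<and> b \<noteq> i"
    "b = Suc i \<longleftrightarrow> y = Suc i"
  shows "adj i b < adj i x \<or> adj i x < adj i y"
  using assms unfolding adj_eq by presburger

text \<open>
  If \<open>v\<close> follows \<open>u\<close> and has \<open>i\<close> to the left of an \<open>i + 1\<close> in column \<open>q\<close>, then the label that
  \<open>u\<close> has in column \<open>q\<close> decides which of \<open>v\<close> and its exchange follows the exchange of \<open>u\<close>: it is the
  latter if and only if this label is \<open>i + 1\<close>.
\<close>
lemma row_follows_both_iff:
  assumes "1 \<le> i" "in_order i n u" "inj_on u {..<n}" "inj_on v {..<n}" "p < q" "q < n" "v p = i" "v q = Suc i"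
  shows "row_follows n u v \<longleftrightarrow> row_follows n (adj i \<circ> u) v \<or> row_follows n (adj i \<circ> u) (adj i \<circ> v)"
    and "\<not> (row_follows n (adj i \<circ> u) v \<and> row_follows n (adj i \<circ> u) (adj i \<circ> v))"
proof -
  have vp: "c = p" if "v c = i" "c < n" for c
    using assms that inj_onD[OF assms(4), of c p] by simp
  have vq: "c = q" if "v c = Suc i" "c < n" for c
    using assms that inj_onD[OF assms(4), of c q] by simp
  have uinj: "c = d" if "u c = u d" "c < n" "d < n" for c d
    using that inj_onD[OF assms(3), of c d] by simp
  have pn: "p < n" using assms by simp
  show "\<not> (row_follows n (adj i \<circ> u) v \<and> row_follows n (adj i \<circ> u) (adj i \<circ> v))"
  proof
    assume R: "row_follows n (adj i \<circ> u) v \<and> row_follows n (adj i \<circ> u) (adj i \<circ> v)"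
    have "adj i (u q) < Suc i" "Suc i \<le> adj i (u q)"
      using row_followsD(3)[OF conjunct2[OF R] assms(5,6)] row_followsD(2)[OF conjunct1[OF R] assms(6)] assms by auto
    then show False by simp
  qed
  show "row_follows n u v \<longleftrightarrow> row_follows n (adj i \<circ> u) v \<or> row_follows n (adj i \<circ> u) (adj i \<circ> v)"
  proof (intro iffI; (elim disjE)?)
    assume R: "row_follows n (adj i \<circ> u) v"
    have top: False if "q < d" "d < n" "u d = Suc i" for d
      using row_followsD(3)[OF R order.strict_trans[OF assms(5) that(1)] that(2)] row_followsD(2)[OF R that(2)] that assms
      by (auto simp: adj_eq)
    have "v c \<le> u c" if c: "c < n" for c
    proof (rule ccontr)
      assume "\<not> v c \<le> u c"
      then have "u c = i" "v c = Suc i" using row_followsD(2)[OF R c] by (auto simp: adj_eq split: if_splits)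
      then show False using top vq[of c] c assms(2) by (auto simp: in_order_def)
    qed
    moreover have "u d < v c \<or> v c < v d" if "d < n" "c < d" for c d
    proof (rule ccontr)
      assume neg: "\<not> (u d < v c \<or> v c < v d)"
      then have "v c = Suc i" "u d = Suc i" using row_followsD(3)[OF R that(2,1)] by (auto simp: adj_eq split: if_splits)
      then show False using top vq[of c] that by auto
    qed
    ultimately show "row_follows n u v" using row_followsD(1)[OF R] by (simp add: row_follows_def)
  next
    assume R: "row_follows n (adj i \<circ> u) (adj i \<circ> v)"
    have "adj i (u q) < Suc i" "i \<le> adj i (u q)"
      using row_followsD(3)[OF R assms(5,6)] row_followsD(2)[OF R assms(6)] assms by auto
    then have uq: "u q = Suc i" by (auto simp: adj_eq split: if_splits)
    have u_eq: "c = q" if "u c = Suc i" "c < n" for c using uinj[of c q] uq that assms by simp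
    have "1 \<le> v c \<and> v c \<le> u c" if c: "c < n" for c
      using row_followsD(1,2)[OF R c] vp[OF _ c] vq[OF _ c] uq assms(1,5-8) c
      by (cases "v c = i"; cases "v c = Suc i") (auto simp: adj_eq split: if_splits)
    moreover have "u d < v c \<or> v c < v d" if d: "d < n" "c < d" for c d
    proof (rule pair_lower)
      show "adj i (u d) < adj i (v c) \<or> adj i (v c) < adj i (v d)" using row_followsD(3)[OF R d(2,1)] by simp
      show "v c \<noteq> v d" using inj_onD[OF assms(4), of c d] d by auto
      show "v c = Suc i \<longrightarrow> v d \<noteq> i" using vq[of c] vp[of d] d assms(5) by auto
      show "u d = Suc i \<longleftrightarrow> v d = Suc i" using u_eq[of d] vq[of d] d uq assms(8) by auto
    qed
    ultimately show "row_follows n u v" by (simp add: row_follows_def)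
  next
    assume R: "row_follows n u v"
    show "row_follows n (adj i \<circ> u) v \<or> row_follows n (adj i \<circ> u) (adj i \<circ> v)"
    proof (cases "u q = Suc i")
      case False
      have top: False if "q < d" "d < n" "u d = Suc i" for d
        using row_followsD(3)[OF R that(1,2)] row_followsD(2)[OF R that(2)] that assms by auto
      have "v c \<le> adj i (u c)" if c: "c < n" for c
        using row_followsD(2)[OF R c] vq[OF _ c] False by (cases "v c = Suc i") (auto simp: adj_eq)
      moreover have "adj i (u d) < v c \<or> v c < v d" if "d < n" "c < d" for c d
      proof (rule ccontr)
        assume neg: "\<not> (adj i (u d) < v c \<or> v c < v d)"
        then have "v c = Suc i" "u d = i" using row_followsD(3)[OF R that(2,1)] by (auto simp: adj_eq split: if_splits)
        then show False using top vq[of c] that assms(2) unfolding in_order_def by (metis order.strict_trans)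
      qed
      ultimately show ?thesis using row_followsD(1)[OF R] by (simp add: row_follows_def)
    next
      case uq: True
      have u_eq: "c = q" if "u c = Suc i" "c < n" for c using uinj[of c q] uq that assms by simp
      have nui: "c < q" if "u c = i" "c < n" for c
        using assms(2) that u_eq unfolding in_order_def by blast
      have "1 \<le> adj i (v c) \<and> adj i (v c) \<le> adj i (u c)" if c: "c < n" for c
        using row_followsD(1,2)[OF R c] vp[OF _ c] vq[OF _ c] uq u_eq[OF _ c] assms(1,5-8) c
        by (cases "v c = i"; cases "v c = Suc i") (auto simp: adj_eq split: if_splits)
      moreover have "adj i (u d) < adj i (v c) \<or> adj i (v c) < adj i (v d)" if d: "d < n" "c < d" for c d
      proof (rule pair_raise)
        show "u d < v c \<or> v c < v d" using row_followsD(3)[OF R d(2,1)] by simp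
        show "v c \<noteq> v d" using inj_onD[OF assms(4), of c d] d by auto
        show "v c = Suc i \<longrightarrow> v d \<noteq> i \<and> u d \<noteq> i" using vq[of c] vp[of d] nui[of d] d assms(5) by auto
        show "u d = Suc i \<longleftrightarrow> v d = Suc i" using u_eq[of d] vq[of d] d uq assms(8) by auto
      qed
      ultimately show ?thesis by (simp add: row_follows_def)
    qed
  qed
qed

definition next_rows :: "nat list \<Rightarrow> nat list set" where
  "next_rows us = {vs. length vs = length us \<and> row_follows (length us) ((!) us) ((!) vs)}"

lemma row_follows_cong:
  assumes "\<And>c. c < n \<Longrightarrow> u c = u' c" "\<And>c. c < n \<Longrightarrow> v c = v' c"
  shows "row_follows n u v \<longleftrightarrow> row_follows n u' v'"
  using assms by (auto simp: row_follows_def)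

lemma row_steps_zip:
  assumes "length us = length ks" "\<forall>k\<in>set ks. 2 \<le> k" "sorted ks" "length vs = length ks"
  shows "zip ks (zip us vs) \<in> row_steps (zip ks us) \<and> sorted_wrt pair_ok (zip ks (zip us vs)) \<longleftrightarrow> vs \<in> next_rows us"
proof -
  have "map old_column (zip ks (zip us vs)) = zip ks us"
    using assms by (auto intro!: nth_equalityI)
  moreover have "(\<forall>t\<in>set (zip ks (zip us vs)). step_ok t) \<longleftrightarrow> (\<forall>c<length us. 1 \<le> vs ! c \<and> vs ! c \<le> us ! c)"
    using assms by (auto simp: all_set_conv_all_nth step_ok_def)
  moreover have "sorted_wrt pair_ok (zip ks (zip us vs)) \<longleftrightarrow>
      (\<forall>d<length us. \<forall>c<d. us ! d < vs ! c \<or> vs ! c < vs ! d)"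
  proof -
    have "pair_ok (ks ! c, us ! c, vs ! c) (ks ! d, us ! d, vs ! d) \<longleftrightarrow> us ! d < vs ! c \<or> vs ! c < vs ! d"
      if "c < d" "d < length ks" for c d
      using assms(2) that sorted_nth_mono[OF assms(3), of c d] by (auto simp: pair_ok_def) (metis One_nat_def Suc_leD nth_mem numeral_2_eq_2 order.strict_trans)+
    then show ?thesis using assms(1,4) by (auto simp: sorted_wrt_iff_nth_less)
  qed
  ultimately show ?thesis
    using assms by (auto simp: row_steps_def next_rows_def row_follows_def)
qed

lemma zip_row_steps:
  assumes "length us = length ks" "ts \<in> row_steps (zip ks us)"
  shows "zip ks (zip us (map (snd \<circ> snd) ts)) = ts" "length ts = length ks"
proof -
  have eq: "map old_column ts = zip ks us" using assms by (simp add: row_steps_def)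
  from arg_cong[OF eq, of length] assms show len: "length ts = length ks" by simp
  have "old_column (ts ! c) = (ks ! c, us ! c)" if "c < length ks" for c
    using arg_cong[OF eq, of "\<lambda>xs. xs ! c"] that assms len by simp
  then have "(ks ! c, us ! c, snd (snd (ts ! c))) = ts ! c" if "c < length ks" for c
    using that by (cases "ts ! c") fastforce
  then show "zip ks (zip us (map (snd \<circ> snd) ts)) = ts"
    using assms len by (intro nth_equalityI) auto
qed

lemma finite_next_rows: "finite (next_rows us)"
proof -
  have "set vs \<subseteq> {..Max (set us)}" if "vs \<in> next_rows us" for vs
  proof
    fix v assume "v \<in> set vs"
    then obtain c where "c < length vs" "v = vs ! c" by (auto simp: in_set_conv_nth)
    then have "v \<le> us ! c" "us ! c \<in> set us" using that by (auto simp: next_rows_def row_follows_def)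
    then show "v \<in> {..Max (set us)}" by (meson List.finite_set Max_ge atMost_iff order.trans)
  qed
  then have "next_rows us \<subseteq> {vs. set vs \<subseteq> {..Max (set us)} \<and> length vs = length us}"
    by (auto simp: next_rows_def)
  then show ?thesis by (rule finite_subset) (rule finite_lists_length_eq, simp)
qed

definition var_prod :: "nat list \<Rightarrow> pol" where
  "var_prod vs = prod_list (map Var vs)"

lemma filling_sum_increasing:
  assumes "length us = length ks" "\<forall>k\<in>set ks. 2 \<le> k" "sorted ks"
  shows "filling_sum (Suc n) (zip ks us) =
    (\<Sum>vs\<in>next_rows us. var_prod vs * filling_sum n (zip (map (\<lambda>k. k - 1) ks) vs))"
proof -
  have w: "weight (zip ks (zip us vs)) = var_prod vs" if "length vs = length us" for vs
  proof -
    have "length ks = length us" "length us = length vs" "\<forall>k\<in>set ks. 2 \<le> k" using assms that by auto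
    then show ?thesis by (induction ks us vs rule: list_induct3) (auto simp: var_prod_def)
  qed
  have nc: "map new_column (zip ks (zip us vs)) = zip (map (\<lambda>k. k - 1) ks) vs" if "length vs = length us" for vs
    using assms that by (auto intro!: nth_equalityI)
  have "filling_sum (Suc n) (zip ks us) =
      (\<Sum>ts\<in>{ts \<in> row_steps (zip ks us). sorted_wrt pair_ok ts}. weight ts * filling_sum n (map new_column ts))"
    by (simp add: sum.inter_filter)
  also have "\<dots> = (\<Sum>vs\<in>next_rows us. var_prod vs * filling_sum n (zip (map (\<lambda>k. k - 1) ks) vs))"
  proof (rule sum.reindex_bij_witness[where i = "\<lambda>vs. zip ks (zip us vs)" and j = "map (snd \<circ> snd)"])
    fix ts assume "ts \<in> {ts \<in> row_steps (zip ks us). sorted_wrt pair_ok ts}"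
    then have ts: "ts \<in> row_steps (zip ks us)" "sorted_wrt pair_ok ts" by auto
    note z = zip_row_steps[OF assms(1) ts(1)]
    then show "zip ks (zip us (map (snd \<circ> snd) ts)) = ts" by simp
    have len: "length (map (snd \<circ> snd) ts) = length us" using z assms by simp
    show "map (snd \<circ> snd) ts \<in> next_rows us"
      using row_steps_zip[OF assms, of "map (snd \<circ> snd) ts"] z ts by simp
    show "var_prod (map (snd \<circ> snd) ts) * filling_sum n (zip (map (\<lambda>k. k - 1) ks) (map (snd \<circ> snd) ts)) =
        weight ts * filling_sum n (map new_column ts)"
      using w[OF len] nc[OF len] unfolding z by simp
  next
    fix vs assume vs: "vs \<in> next_rows us"
    then have len: "length vs = length us" by (simp add: next_rows_def)
    show "map (snd \<circ> snd) (zip ks (zip us vs)) = vs"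
      using assms len by (auto intro!: nth_equalityI)
    show "zip ks (zip us vs) \<in> {ts \<in> row_steps (zip ks us). sorted_wrt pair_ok ts}"
      using row_steps_zip[OF assms, of vs] vs len assms by simp
  qed
  finally show ?thesis .
qed

lemma row_follows_inj: "row_follows n u v \<Longrightarrow> inj_on v {..<n}"
proof (rule inj_onI, rule ccontr)
  fix c d assume R: "row_follows n u v" and "c \<in> {..<n}" "d \<in> {..<n}" "v c = v d" "c \<noteq> d"
  then show False
    using row_followsD(2)[OF R] row_followsD(3)[OF R, of c d] row_followsD(3)[OF R, of d c]
    by (cases c d rule: linorder_cases) fastforce+
qed

lemma next_rows_distinct: "vs \<in> next_rows us \<Longrightarrow> distinct vs"
  using row_follows_inj by (fastforce simp: next_rows_def distinct_conv_nth inj_on_def)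

definition ordered_at :: "nat \<Rightarrow> nat list \<Rightarrow> bool" where
  "ordered_at i us \<longleftrightarrow> in_order i (length us) ((!) us)"

lemma next_rows_map_iff:
  assumes "length vs = length us"
  shows "vs \<in> next_rows (map (adj i) us) \<longleftrightarrow> row_follows (length us) (adj i \<circ> (!) us) ((!) vs)"
    and "map (adj i) vs \<in> next_rows us \<longleftrightarrow> row_follows (length us) ((!) us) (adj i \<circ> (!) vs)"
    and "map (adj i) vs \<in> next_rows (map (adj i) us) \<longleftrightarrow> row_follows (length us) (adj i \<circ> (!) us) (adj i \<circ> (!) vs)"
    and "vs \<in> next_rows us \<longleftrightarrow> row_follows (length us) ((!) us) ((!) vs)"
proof -
  have *: "row_follows (length us) ((!) (map f us)) ((!) (map g vs)) \<longleftrightarrow>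
      row_follows (length us) (f \<circ> (!) us) (g \<circ> (!) vs)" for f g
    using assms by (intro row_follows_cong) auto
  show "vs \<in> next_rows (map (adj i) us) \<longleftrightarrow> row_follows (length us) (adj i \<circ> (!) us) ((!) vs)"
    using *[of "adj i" id] assms by (simp add: next_rows_def)
  show "map (adj i) vs \<in> next_rows us \<longleftrightarrow> row_follows (length us) ((!) us) (adj i \<circ> (!) vs)"
    using *[of id "adj i"] assms by (simp add: next_rows_def)
  show "map (adj i) vs \<in> next_rows (map (adj i) us) \<longleftrightarrow> row_follows (length us) (adj i \<circ> (!) us) (adj i \<circ> (!) vs)"
    using *[of "adj i" "adj i"] assms by (simp add: next_rows_def)
  show "vs \<in> next_rows us \<longleftrightarrow> row_follows (length us) ((!) us) ((!) vs)"
    using assms by (simp add: next_rows_def)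
qed

lemma next_rows_without_Suc:
  assumes "Suc i \<notin> set vs"
  shows "vs \<in> next_rows (map (adj i) us) \<longleftrightarrow> vs \<in> next_rows us"
proof (cases "length vs = length us")
  case True
  have "\<forall>c<length us. vs ! c \<noteq> Suc i" using assms True by (metis nth_mem)
  then show ?thesis
    using row_follows_adj_iff[of "length us" "(!) vs" i "(!) us"] True
    by (simp only: next_rows_map_iff)
qed (simp add: next_rows_def)

lemma next_rows_raise:
  assumes "Suc i \<notin> set vs" "1 \<le> i" "ordered_at i us"
  shows "map (adj i) vs \<in> next_rows us \<longleftrightarrow> vs \<in> next_rows us"
proof (cases "length vs = length us")
  case True
  have "\<forall>c<length us. vs ! c \<noteq> Suc i" using assms True by (metis nth_mem)
  then show ?thesis
    using row_follows_raise_iff[of i "length us" "(!) us" "(!) vs"] True assms(2,3)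
    by (simp only: next_rows_map_iff ordered_at_def)
qed (simp add: next_rows_def)

lemma ordered_at_positions:
  assumes "ordered_at i vs" "i \<in> set vs"
  obtains p q where "p < q" "q < length vs" "vs ! p = i" "vs ! q = Suc i"
  using assms by (auto simp: ordered_at_def in_order_def in_set_conv_nth)

lemma next_rows_both:
  assumes "ordered_at i vs" "i \<in> set vs" "distinct vs" "distinct us" "1 \<le> i" "ordered_at i us"
  shows "map (adj i) vs \<notin> next_rows us"
    "vs \<in> next_rows us \<longleftrightarrow> vs \<in> next_rows (map (adj i) us) \<or> map (adj i) vs \<in> next_rows (map (adj i) us)"
    "\<not> (vs \<in> next_rows (map (adj i) us) \<and> map (adj i) vs \<in> next_rows (map (adj i) us))"
proof -
  obtain p q where pq: "p < q" "q < length vs" "vs ! p = i" "vs ! q = Suc i"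
    using ordered_at_positions[OF assms(1,2)] .
  have inj: "inj_on ((!) us) {..<length us}" "inj_on ((!) vs) {..<length vs}"
    using assms by (auto simp: inj_on_def nth_eq_iff_index_eq)
  show "map (adj i) vs \<notin> next_rows us"
  proof (cases "length vs = length us")
    case True
    then show ?thesis
      using not_row_follows_lowered[of i "length us" "(!) us" p q "(!) vs"] assms pq
      by (simp only: next_rows_map_iff ordered_at_def simp_thms)
  qed (simp add: next_rows_def)
  show "vs \<in> next_rows us \<longleftrightarrow> vs \<in> next_rows (map (adj i) us) \<or> map (adj i) vs \<in> next_rows (map (adj i) us)"
  proof (cases "length vs = length us")
    case True
    then show ?thesis
      using row_follows_both_iff(1)[of i "length us" "(!) us" "(!) vs" p q] assms pq inj
      by (simp only: next_rows_map_iff ordered_at_def simp_thms)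
  qed (simp add: next_rows_def)
  show "\<not> (vs \<in> next_rows (map (adj i) us) \<and> map (adj i) vs \<in> next_rows (map (adj i) us))"
  proof (cases "length vs = length us")
    case True
    then show ?thesis
      using row_follows_both_iff(2)[of i "length us" "(!) us" "(!) vs" p q] assms pq inj
      by (simp only: next_rows_map_iff ordered_at_def simp_thms)
  qed (simp add: next_rows_def)
qed

lemma map_adj_map_adj [simp]: "map (adj i) (map (adj i) vs) = vs"
  by (simp add: comp_def)

lemma ordered_at_map_adj:
  assumes "\<not> ordered_at i vs" "distinct vs"
  shows "ordered_at i (map (adj i) vs)"
proof -
  obtain p where p: "p < length vs" "vs ! p = i" "\<And>d. p < d \<Longrightarrow> d < length vs \<Longrightarrow> vs ! d \<noteq> Suc i"
    using assms by (auto simp: ordered_at_def in_order_def)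
  have "p < length vs \<and> c < p \<and> adj i (vs ! p) = Suc i" if "c < length vs" "adj i (vs ! c) = i" for c
  proof -
    have "vs ! c = Suc i" using that by (simp add: adj_eq split: if_splits)
    then have "c \<noteq> p" "\<not> p < c" using p that by auto
    then show ?thesis using p by simp
  qed
  then show ?thesis unfolding ordered_at_def in_order_def
    by (intro allI impI exI[of _ p]) (auto simp: p(1))
qed

lemma ordered_at_absent: "i \<notin> set vs \<Longrightarrow> ordered_at i vs"
  by (auto simp: ordered_at_def in_order_def)

lemma permute_var_prod: "permute_vars (adj i) (var_prod vs) = var_prod (map (adj i) vs)"
  by (induction vs) (auto simp: var_prod_def permute_vars_1 permute_vars_mult permute_vars_Var)

lemma var_prod_eq_prod: "distinct vs \<Longrightarrow> var_prod vs = (\<Prod>v\<in>set vs. Var v)"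
  by (simp add: var_prod_def prod.distinct_set_conv_list)

lemma permute_var_prod_symmetric:
  assumes "distinct vs" "i \<in> set vs \<longleftrightarrow> Suc i \<in> set vs"
  shows "permute_vars (adj i) (var_prod vs) = var_prod vs" "var_prod (map (adj i) vs) = var_prod vs"
proof -
  have "adj i ` set vs = set vs"
  proof (intro set_eqI)
    fix x
    have "x \<in> adj i ` set vs \<longleftrightarrow> adj i x \<in> set vs" by (metis image_iff transpose_involutory)
    then show "x \<in> adj i ` set vs \<longleftrightarrow> x \<in> set vs" using assms(2) by (simp add: adj_eq)
  qed
  moreover have "distinct (map (adj i) vs)" using assms by (simp add: distinct_map)
  ultimately show "var_prod (map (adj i) vs) = var_prod vs" using assms by (simp add: var_prod_eq_prod)
  then show "permute_vars (adj i) (var_prod vs) = var_prod vs" by (simp add: permute_var_prod)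
qed

lemma var_prod_remove1: "x \<in> set vs \<Longrightarrow> var_prod vs = Var x * var_prod (remove1 x vs)"
  by (induction vs) (auto simp: var_prod_def)


text \<open>
  The next rows are sorted by which of \<open>i\<close> and \<open>i + 1\<close> they contain, and in which order. Rows with
  neither occur on both sides with symmetric summands, which \<open>xi i\<close> fixes. A row with \<open>i\<close> alone occurs
  on both sides, and on the left also with \<open>i\<close> raised to \<open>i + 1\<close>: together these two are
  \<open>\<xi>\<^sub>i(x\<^sub>i g) = x\<^sub>i g + x\<^bsub>i+1\<^esub> \<xi>\<^sub>i g\<close>. Whatever rows with \<open>i + 1\<close> alone occur on the right, they are annihilated
  by \<open>xi i\<close>. A row with \<open>i\<close> before \<open>i + 1\<close> on the left corresponds to exactly one of itself and its
  exchange on the right.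
\<close>
lemma xi_sum_next_rows:
  fixes \<Phi> :: "nat list \<Rightarrow> pol"
  assumes \<Phi>: "\<And>vs. length vs = length us \<Longrightarrow> distinct vs \<Longrightarrow> ordered_at i vs \<Longrightarrow> \<Phi> vs = xi i (\<Phi> (map (adj i) vs))"
    and us: "distinct us" "ordered_at i us" and i: "1 \<le> i"
  shows "(\<Sum>vs\<in>next_rows us. var_prod vs * \<Phi> vs) =
    xi i (\<Sum>vs\<in>next_rows (map (adj i) us). var_prod vs * \<Phi> vs)"
proof -
  let ?s = "map (adj i)"
  define f where "f vs = var_prod vs * \<Phi> vs" for vs
  define none where "none = {vs. i \<notin> set vs \<and> Suc i \<notin> set vs}"
  define low where "low = {vs. i \<in> set vs \<and> Suc i \<notin> set vs}"
  define high where "high = {vs. i \<notin> set vs \<and> Suc i \<in> set vs}"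
  define asc where "asc = {vs. i \<in> set vs \<and> Suc i \<in> set vs \<and> ordered_at i vs}"
  define desc where "desc = {vs. i \<in> set vs \<and> Suc i \<in> set vs \<and> \<not> ordered_at i vs}"
  note defs = none_def low_def high_def asc_def desc_def
  have split: "(\<Sum>vs\<in>N. g vs) = (\<Sum>vs\<in>N \<inter> none. g vs) + ((\<Sum>vs\<in>N \<inter> low. g vs) + ((\<Sum>vs\<in>N \<inter> high. g vs) +
      ((\<Sum>vs\<in>N \<inter> asc. g vs) + (\<Sum>vs\<in>N \<inter> desc. g vs))))" if "finite N" for N and g :: "nat list \<Rightarrow> pol"
  proof -
    have "g vs = (if vs \<in> none then g vs else 0) + ((if vs \<in> low then g vs else 0) +
        ((if vs \<in> high then g vs else 0) + ((if vs \<in> asc then g vs else 0) + (if vs \<in> desc then g vs else 0))))" for vs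
      by (auto simp: defs)
    then show ?thesis
      unfolding sum.inter_restrict[OF that] sum.distrib[symmetric] by (rule sum.cong[OF refl])
  qed
  let ?N = "next_rows us" and ?M = "next_rows (?s us)"
  have in_s: "i \<in> set (?s vs) \<longleftrightarrow> Suc i \<in> set vs" "Suc i \<in> set (?s vs) \<longleftrightarrow> i \<in> set vs" for vs
    by (auto simp: adj_eq image_iff split: if_splits)
  have dist: "distinct vs" "length vs = length us" if "vs \<in> ?N \<union> ?M" for vs
  proof -
    show "distinct vs" using that next_rows_distinct by blast
    show "length vs = length us" using that by (auto simp: next_rows_def)
  qed
  have none_eq: "?N \<inter> none = ?M \<inter> none" and low_eq: "?N \<inter> low = ?M \<inter> low"
    using next_rows_without_Suc[of i] by (auto simp: defs)
  have high_eq: "?N \<inter> high = ?s ` (?N \<inter> low)"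
  proof (intro set_eqI iffI)
    fix vs assume "vs \<in> ?N \<inter> high"
    then have "?s vs \<in> ?N \<inter> low"
      using next_rows_raise[of i "?s vs" us] us i by (auto simp: defs in_s simp del: set_map)
    then show "vs \<in> ?s ` (?N \<inter> low)" by (metis image_eqI map_adj_map_adj)
  next
    fix vs assume "vs \<in> ?s ` (?N \<inter> low)"
    then show "vs \<in> ?N \<inter> high"
      using next_rows_raise[of i _ us] us i by (auto simp: defs in_s simp del: set_map)
  qed
  have desc_asc: "?s vs \<in> asc" if "vs \<in> desc" "distinct vs" for vs
    using that ordered_at_map_adj by (auto simp: defs in_s simp del: set_map)
  have desc_N: "?N \<inter> desc = {}"
  proof -
    have False if "vs \<in> ?N" "vs \<in> desc" for vs
      using next_rows_both(1)[of i "?s vs" us] desc_asc[OF that(2)] dist that us i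
      by (auto simp: asc_def distinct_map simp del: set_map)
    then show ?thesis by blast
  qed
  have asc_eq: "?N \<inter> asc = (?M \<inter> asc) \<union> ?s ` (?M \<inter> desc)"
  proof (intro set_eqI iffI)
    fix vs assume vs: "vs \<in> ?N \<inter> asc"
    then have "vs \<in> ?M \<or> ?s vs \<in> ?M"
      using next_rows_both(2)[of i vs us] dist us i by (auto simp: asc_def)
    moreover have "?s vs \<in> desc" if "?s vs \<in> ?M" "vs \<notin> ?M"
    proof -
      obtain p q where pq: "p < q" "q < length vs" "vs ! p = i" "vs ! q = Suc i"
        using vs ordered_at_positions[of i vs] unfolding asc_def by blast
      have dvs: "distinct vs" using dist vs by blast
      have "\<not> ordered_at i (?s vs)"
      proof
        assume "ordered_at i (?s vs)"
        then obtain d where d: "q < d" "d < length vs" "?s vs ! d = Suc i"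
          using pq unfolding ordered_at_def in_order_def by fastforce
        then have "vs ! d = vs ! p" using pq by (simp add: adj_eq split: if_splits)
        then show False using d pq nth_eq_iff_index_eq[OF dvs, of d p] by simp
      qed
      then show ?thesis using vs by (auto simp: defs in_s simp del: set_map)
    qed
    ultimately show "vs \<in> (?M \<inter> asc) \<union> ?s ` (?M \<inter> desc)"
      using vs by (metis IntD2 IntI UnI1 UnI2 image_eqI map_adj_map_adj)
  next
    fix vs assume vs: "vs \<in> (?M \<inter> asc) \<union> ?s ` (?M \<inter> desc)"
    then have "vs \<in> asc \<and> distinct vs \<and> (vs \<in> ?M \<or> ?s vs \<in> ?M)"
      using desc_asc dist by (auto simp: distinct_map)
    then show "vs \<in> ?N \<inter> asc"
      using next_rows_both(2)[of i vs us] us i by (auto simp: asc_def)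
  qed
  have asc_disj: "(?M \<inter> asc) \<inter> ?s ` (?M \<inter> desc) = {}"
  proof -
    have False if "vs \<in> ?M" "vs \<in> asc" "?s vs \<in> ?M" for vs
      using next_rows_both(3)[of i vs us] that dist us i by (auto simp: asc_def)
    then show ?thesis by fastforce
  qed
  have inj: "inj_on ?s A" for A by (rule inj_onI) (metis map_adj_map_adj)
  have xi_id: "xi i (f vs) = f vs" if "vs \<in> ?M \<inter> (none \<union> asc)" for vs
  proof -
    have "ordered_at i vs" "i \<in> set vs \<longleftrightarrow> Suc i \<in> set vs"
      using that ordered_at_absent by (auto simp: defs)
    then have "permute_vars (adj i) (f vs) = f vs"
      using \<Phi>[of vs] dist[of vs] that permute_vars_xi
      by (simp add: f_def permute_vars_mult permute_var_prod_symmetric)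
    then show ?thesis by (rule xi_symmetric)
  qed
  have xi_high: "xi i (f vs) = 0" if "vs \<in> ?M \<inter> high" for vs
  proof -
    have "ordered_at i vs" "Suc i \<in> set vs" "i \<notin> set vs" using that ordered_at_absent by (auto simp: defs)
    moreover have "permute_vars (adj i) (var_prod (remove1 (Suc i) vs)) = var_prod (remove1 (Suc i) vs)"
      using dist[of vs] that calculation by (intro permute_var_prod_symmetric) auto
    ultimately have "permute_vars (adj i) (var_prod (remove1 (Suc i) vs) * \<Phi> vs) = var_prod (remove1 (Suc i) vs) * \<Phi> vs"
      using \<Phi>[of vs] dist[of vs] that permute_vars_xi by (simp add: permute_vars_mult)
    from xi_Var_Suc_symmetric[OF this] show ?thesis
      using var_prod_remove1[OF \<open>Suc i \<in> set vs\<close>] by (simp add: f_def mult.assoc)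
  qed
  have xi_low: "xi i (f vs) = f vs + f (?s vs)" if "vs \<in> ?M \<inter> low" for vs
  proof -
    let ?r = "var_prod (remove1 i vs)"
    have low: "i \<in> set vs" "Suc i \<notin> set vs" and d: "distinct vs" "length vs = length us" using that dist[of vs] by (auto simp: defs)
    have sym: "permute_vars (adj i) ?r = ?r"
      using d low by (intro permute_var_prod_symmetric) auto
    have v: "var_prod vs = Var i * ?r" using var_prod_remove1[OF low(1)] .
    have "var_prod (?s vs) = permute_vars (adj i) (var_prod vs)" by (simp only: permute_var_prod)
    also have "\<dots> = Var (Suc i) * ?r"
      unfolding v by (simp only: permute_vars_mult bij_transpose permute_vars_Var sym transpose_apply_first)
    finally have sv: "var_prod (?s vs) = Var (Suc i) * ?r" .
    have "ordered_at i (?s vs)" by (rule ordered_at_absent) (use low in_s in blast)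
    then have "\<Phi> (?s vs) = xi i (\<Phi> vs)"
      using \<Phi>[of "?s vs"] d by (simp add: distinct_map)
    then have fs: "f (?s vs) = ?r * (Var (Suc i) * xi i (\<Phi> vs))"
      unfolding f_def sv by (simp only: ac_simps)
    have fv: "f vs = ?r * (Var i * \<Phi> vs)"
      unfolding f_def v by (simp only: ac_simps)
    show ?thesis unfolding fs unfolding fv xi_symmetric_mult[OF sym] xi_Var_mult by (simp only: distrib_left)
  qed
  have xi_desc: "xi i (f vs) = f (?s vs)" if "vs \<in> ?M \<inter> desc" for vs
  proof -
    have d: "distinct vs" "length vs = length us" "i \<in> set vs \<longleftrightarrow> Suc i \<in> set vs" using that dist[of vs] by (auto simp: defs)
    have "ordered_at i (?s vs)" using desc_asc[of vs] that d by (auto simp: asc_def)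
    then have "\<Phi> (?s vs) = xi i (\<Phi> vs)" using \<Phi>[of "?s vs"] d by (simp add: distinct_map)
    then show ?thesis
      unfolding f_def permute_var_prod_symmetric(2)[OF d(1,3)]
      by (simp only: xi_symmetric_mult[OF permute_var_prod_symmetric(1)[OF d(1,3)]])
  qed
  have fin: "finite ?N" "finite ?M" by (rule finite_next_rows)+
  have "xi i (sum f ?M) = (\<Sum>vs\<in>?M \<inter> none. f vs) + ((\<Sum>vs\<in>?M \<inter> low. f vs + f (?s vs)) + (0 +
      ((\<Sum>vs\<in>?M \<inter> asc. f vs) + (\<Sum>vs\<in>?M \<inter> desc. f (?s vs)))))"
    unfolding split[OF fin(2)] xi_add xi_sum
    by (intro arg_cong2[of _ _ _ _ "(+)"] sum.cong sum.neutral refl ballI) (auto simp: xi_id xi_low xi_high xi_desc)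
  also have "\<dots> = (\<Sum>vs\<in>?N \<inter> none. f vs) + ((\<Sum>vs\<in>?N \<inter> low. f vs) + ((\<Sum>vs\<in>?N \<inter> high. f vs) +
      ((\<Sum>vs\<in>?N \<inter> asc. f vs) + (\<Sum>vs\<in>?N \<inter> desc. f vs))))"
    unfolding desc_N high_eq asc_eq
    using fin asc_disj
    by (simp add: sum.distrib none_eq low_eq sum.reindex[OF inj] sum.union_disjoint add_ac)
  also have "\<dots> = sum f ?N" by (rule split[OF fin(1), symmetric])
  finally show ?thesis unfolding f_def by (rule sym)
qed

lemma ordered_at_tl:
  assumes "ordered_at i (u # us)"
  shows "ordered_at i us"
  unfolding ordered_at_def in_order_def
proof (intro allI impI)
  fix c assume "c < length us" "us ! c = i"
  then obtain d where "Suc c < d" "d < Suc (length us)" "(u # us) ! d = Suc i"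
    using assms unfolding ordered_at_def in_order_def by (metis Suc_less_eq length_Cons nth_Cons_Suc)
  then show "\<exists>d>c. d < length us \<and> us ! d = Suc i"
    by (intro exI[of _ "d - 1"]) (auto simp: nth_Cons split: nat.splits)
qed

text \<open>
  Induction over the rows. The columns without further boxes are the leftmost ones; they are dropped
  first, so that \<open>xi_sum_next_rows\<close> applies to the others.
\<close>
theorem filling_sum_xi:
  assumes "sorted ks" "length us = length ks" "distinct us" "ordered_at i us" "1 \<le> i"
  shows "filling_sum n (zip ks us) = xi i (filling_sum n (zip ks (map (adj i) us)))"
  using assms
proof (induction n arbitrary: ks us)
  case 0
  then show ?case by (simp add: xi_symmetric permute_vars_1)
next
  case (Suc n)
  have empty: "filling_sum m [] = 1" for m
    by (induction m) simp_all
  from Suc.prems show ?case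
  proof (induction ks arbitrary: us)
    case Nil
    then show ?case by (simp add: empty xi_symmetric permute_vars_1 del: filling_sum.simps)
  next
    case (Cons k ks)
    obtain u us' where us: "us = u # us'" using Cons.prems(2) by (cases us) auto
    show ?case
    proof (cases "2 \<le> k")
      case False
      then have "k = 0 \<or> k = 1" by arith
      then have drop: "filling_sum (Suc n) ((k, b) # R) = filling_sum (Suc n) R" for b R
        using filling_sum_drop_column[of k "[]" b "Suc n" R] by (simp del: filling_sum.simps)
      have "ordered_at i us'"
        using Cons.prems(4) unfolding us by (rule ordered_at_tl)
      then show ?thesis
        using Cons.IH[of us'] Cons.prems us by (simp add: drop del: filling_sum.simps)
    next
      case True
      then have two: "\<forall>k'\<in>set (k # ks). 2 \<le> k'" using Cons.prems(1) by auto
      have s: "length (map (adj i) us) = length (k # ks)" using Cons.prems(2) by simp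
      have "sorted (map (\<lambda>k. k - 1) (k # ks))"
        using Cons.prems(1) unfolding sorted_map by (rule sorted_wrt_mono_rel[rotated]) auto
      from Suc.IH[OF this] have "filling_sum n (zip (map (\<lambda>k. k - 1) (k # ks)) vs) =
          xi i (filling_sum n (zip (map (\<lambda>k. k - 1) (k # ks)) (map (adj i) vs)))"
        if "length vs = length us" "distinct vs" "ordered_at i vs" for vs
        using that Cons.prems by simp
      from xi_sum_next_rows[of us i "\<lambda>vs. filling_sum n (zip (map (\<lambda>k. k - 1) (k # ks)) vs)",
          OF this Cons.prems(3-5)] show ?thesis
        unfolding filling_sum_increasing[OF Cons.prems(2) two Cons.prems(1)]
          filling_sum_increasing[OF s two Cons.prems(1)] by simp
    qed
  qed
qed

section \<open>Key polynomials\<close>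

text \<open>
  Insertion moves \<open>x\<close> only past lower columns, which by assumption carry larger labels, as
  \<open>exchange_columns\<close> requires.
\<close>
lemma filling_sum_insort:
  assumes "distinct (map snd (L @ x # ys))" "\<forall>c\<in>set (L @ x # ys). 1 \<le> fst c \<and> fst c \<le> Suc n"
    "\<forall>y\<in>set ys. fst y < fst x \<longrightarrow> snd x < snd y"
  shows "filling_sum n (L @ x # ys) = filling_sum n (L @ insort_key fst x ys)"
  using assms
proof (induction ys arbitrary: L)
  case (Cons y ys)
  show ?case
  proof (cases "fst x \<le> fst y")
    case False
    obtain kt p where x: "x = (kt, p)" by (cases x)
    obtain ks q where y: "y = (ks, q)" by (cases y)
    have "new_labels_differ p q (L @ ys)"
      using Cons.prems(1) by (auto simp: new_labels_differ_def x y)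
    then have "filling_sum n (L @ [(kt, p), (ks, q)] @ ys) = filling_sum n (L @ [(ks, q), (kt, p)] @ ys)"
      using exchange_columns[of ks kt n p q L ys] Cons.prems(2,3) False by (auto simp: x y)
    also have "\<dots> = filling_sum n ((L @ [y]) @ x # ys)" by (simp add: x y)
    also have "\<dots> = filling_sum n ((L @ [y]) @ insort_key fst x ys)"
      using Cons.prems by (intro Cons.IH) auto
    finally show ?thesis using False by (simp add: x y)
  qed simp
qed simp

lemma filling_sum_sort:
  assumes "distinct (map snd (L @ cols))" "\<forall>c\<in>set (L @ cols). 1 \<le> fst c \<and> fst c \<le> Suc n"
    "sorted_wrt (\<lambda>c d. fst d < fst c \<longrightarrow> snd c < snd d) cols"
  shows "filling_sum n (L @ cols) = filling_sum n (L @ sort_key fst cols)"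
  using assms
proof (induction cols arbitrary: L)
  case (Cons c cols)
  have "filling_sum n (L @ c # cols) = filling_sum n ((L @ [c]) @ sort_key fst cols)"
    using Cons.IH[of "L @ [c]"] Cons.prems by simp
  also have "\<dots> = filling_sum n (L @ insort_key fst c (sort_key fst cols))"
    using Cons.prems filling_sum_insort[of L c "sort_key fst cols" n]
    by (auto simp: distinct_map)
  finally show ?case by simp
qed simp

definition relabel :: "nat \<Rightarrow> column \<Rightarrow> column" where
  "relabel i = (\<lambda>(k, u). (k, adj i u))"

lemma fst_relabel [simp]: "fst (relabel i c) = fst c"
  by (simp add: relabel_def split: prod.split)

lemma insort_relabel: "insort_key fst (relabel i c) (map (relabel i) cols) = map (relabel i) (insort_key fst c cols)"
  by (induction cols) auto

lemma sort_relabel: "sort_key fst (map (relabel i) cols) = map (relabel i) (sort_key fst cols)"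
  by (induction cols) (auto simp: insort_relabel)

lemma insort_stable:
  assumes "sorted_wrt (\<lambda>c d. fst c < fst d \<or> fst c = fst d \<and> snd c < snd d) cols"
    "\<forall>d\<in>set cols. snd c < snd d"
  shows "sorted_wrt (\<lambda>c d. fst c < fst d \<or> fst c = fst d \<and> snd c < snd d) (insort_key fst c cols)"
  using assms by (induction cols) (auto simp: set_insort_key)

text \<open>
  The sort is stable: columns of equal height keep their order, so their labels increase.
\<close>
lemma sort_stable:
  assumes "sorted_wrt (<) (map snd cols)"
  shows "sorted_wrt (\<lambda>c d. fst c < fst d \<or> fst c = fst d \<and> snd c < snd d) (sort_key fst cols)"
  using assms by (induction cols) (auto intro!: insort_stable)

definition shape_columns :: "nat \<Rightarrow> nat list \<Rightarrow> column list" where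
  "shape_columns a \<alpha> = zip (map Suc \<alpha>) [a..<a + length \<alpha>]"

text \<open>
  The number of rows may be any upper bound for the heights; the sum of the entries is one that
  does not change under permutations and padding by zeros.
\<close>
definition key_sum :: "nat list \<Rightarrow> pol" where
  "key_sum \<alpha> = filling_sum (sum_list \<alpha>) (shape_columns 1 \<alpha>)"

lemma shape_columns_append: "shape_columns a (\<alpha> @ \<beta>) = shape_columns a \<alpha> @ shape_columns (a + length \<alpha>) \<beta>"
  using upt_add_eq_append[of a "a + length \<alpha>" "length \<beta>"]
  by (simp add: shape_columns_def add.assoc)

lemma shape_columns_Cons: "shape_columns a (x # \<alpha>) = (Suc x, a) # shape_columns (Suc a) \<alpha>"
  by (simp add: shape_columns_def upt_conv_Cons del: upt_Suc)

lemma snd_shape_columns: "map snd (shape_columns a \<alpha>) = [a..<a + length \<alpha>]"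
  by (simp add: shape_columns_def)

lemma fst_shape_columns: "map fst (shape_columns a \<alpha>) = map Suc \<alpha>"
  by (simp add: shape_columns_def)

lemma filling_sum_shape_sort:
  assumes "sum_list \<alpha> \<le> n"
  shows "filling_sum n (shape_columns a \<alpha>) = filling_sum n (sort_key fst (shape_columns a \<alpha>))"
proof -
  have "sorted_wrt (<) (map snd (shape_columns a \<alpha>))" by (simp add: snd_shape_columns)
  then have "sorted_wrt (\<lambda>c d. snd c < snd d) (shape_columns a \<alpha>)" by (simp add: sorted_wrt_map)
  then have s: "sorted_wrt (\<lambda>c d. fst d < fst c \<longrightarrow> snd c < snd d) (shape_columns a \<alpha>)"
    by (rule sorted_wrt_mono_rel[rotated]) auto
  have "1 \<le> fst c \<and> fst c \<le> Suc n" if "c \<in> set (shape_columns a \<alpha>)" for c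
  proof -
    have "fst c \<in> set (map Suc \<alpha>)" using that by (metis fst_shape_columns image_eqI list.set_map)
    then show ?thesis using assms member_le_sum_list[of _ \<alpha>] by fastforce
  qed
  then show ?thesis
    using filling_sum_sort[of "[]" "shape_columns a \<alpha>" n] s by (simp add: snd_shape_columns)
qed

text \<open>
  Sorted by height, the columns of both shapes are the same up to the exchange of the labels \<open>i\<close> and
  \<open>i + 1\<close>, and in the sorted columns of the left-hand shape \<open>i\<close> precedes \<open>i + 1\<close>. For equal entries
  \<open>x = y\<close> the statement says that the polynomial is symmetric in \<open>x\<^sub>i\<close> and \<open>x\<^bsub>i+1\<^esub>\<close>.
\<close>
theorem key_sum_swap:
  assumes "y \<le> x" "Suc (length A) = i"
  shows "key_sum (A @ y # x # B) = xi i (key_sum (A @ x # y # B))"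
proof -
  let ?n = "sum_list (A @ x # y # B)"
  let ?CA = "shape_columns 1 A" and ?CB = "shape_columns (Suc (Suc i)) B"
  have n: "sum_list (A @ y # x # B) = ?n" by simp
  have Cyx: "shape_columns 1 (A @ y # x # B) = ?CA @ (Suc y, i) # (Suc x, Suc i) # ?CB"
    and Cxy: "shape_columns 1 (A @ x # y # B) = ?CA @ (Suc x, i) # (Suc y, Suc i) # ?CB"
    using assms(2) by (simp_all add: shape_columns_append shape_columns_Cons)
  define S where "S = sort_key fst (?CA @ (Suc y, i) # (Suc x, Suc i) # ?CB)"
  have stable: "sorted_wrt (\<lambda>c d. fst c < fst d \<or> fst c = fst d \<and> snd c < snd d) S"
    unfolding S_def Cyx[symmetric] by (rule sort_stable) (simp only: snd_shape_columns sorted_wrt_upt)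
  have setS: "set S = set (shape_columns 1 (A @ y # x # B))" unfolding S_def Cyx by simp
  have distS: "distinct (map snd S)"
  proof -
    have "distinct (map snd (shape_columns 1 (A @ y # x # B)))"
      by (simp only: snd_shape_columns distinct_upt)
    moreover have "mset S = mset (shape_columns 1 (A @ y # x # B))" unfolding S_def Cyx by simp
    ultimately show ?thesis by (metis mset_eq_imp_distinct_iff mset_map)
  qed
  have zipS: "S = zip (map fst S) (map snd S)" by (simp add: zip_map_fst_snd)
  have ord: "ordered_at i (map snd S)"
    unfolding ordered_at_def in_order_def
  proof (intro allI impI)
    fix c assume c: "c < length (map snd S)" "map snd S ! c = i"
    have "(Suc x, Suc i) \<in> set S" "(Suc y, i) \<in> set S" unfolding setS Cyx by simp_all
    then obtain d e where d: "d < length S" "S ! d = (Suc x, Suc i)" and e: "e < length S" "S ! e = (Suc y, i)"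
      by (auto simp: in_set_conv_nth)
    have "c = e" using nth_eq_iff_index_eq[OF distS, of c e] c e by simp
    moreover have "e < d"
    proof (rule ccontr)
      assume "\<not> e < d"
      moreover have "d \<noteq> e" using d e by auto
      ultimately have "d < e" by simp
      then show False
        using sorted_wrt_nth_less[OF stable, of d e] d e assms(1) by simp
    qed
    ultimately show "\<exists>d>c. d < length (map snd S) \<and> map snd S ! d = Suc i" using d by auto
  qed
  have "key_sum (A @ y # x # B) = filling_sum ?n S"
    unfolding key_sum_def n S_def Cyx[symmetric] by (rule filling_sum_shape_sort) simp
  also have "\<dots> = xi i (filling_sum ?n (zip (map fst S) (map (adj i) (map snd S))))"
    by (subst zipS, rule filling_sum_xi) (use distS ord assms(2) in \<open>simp_all add: S_def\<close>)
  finally have key_yx: "key_sum (A @ y # x # B) = xi i (filling_sum ?n (zip (map fst S) (map (adj i) (map snd S))))" .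
  have zip_relabel: "zip (map fst S) (map (adj i) (map snd S)) = map (relabel i) S"
    by (induction S) (auto simp: relabel_def split: prod.split)
  have relabelS: "map (relabel i) S = sort_key fst (?CA @ (Suc y, Suc i) # (Suc x, i) # ?CB)"
  proof -
    have "map (relabel i) ?CA = ?CA"
    proof (rule map_idI)
      fix c assume "c \<in> set ?CA"
      then have "snd c \<in> set [1..<1 + length A]" by (metis image_eqI list.set_map snd_shape_columns)
      then show "relabel i c = c" using assms(2) by (cases c) (auto simp: relabel_def adj_eq)
    qed
    moreover have "map (relabel i) ?CB = ?CB"
    proof (rule map_idI)
      fix c assume "c \<in> set ?CB"
      then have "snd c \<in> set [Suc (Suc i)..<Suc (Suc i) + length B]" by (metis image_eqI list.set_map snd_shape_columns)
      then show "relabel i c = c" using assms(2) by (cases c) (auto simp: relabel_def adj_eq)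
    qed
    ultimately show ?thesis
      unfolding S_def sort_relabel[symmetric] by (simp add: relabel_def)
  qed
  show ?thesis
  proof (cases "x = y")
    case True
    have "permute_vars (adj i) (key_sum (A @ y # x # B)) = key_sum (A @ y # x # B)"
      unfolding key_yx by (rule permute_vars_xi)
    then show ?thesis using True by (simp add: xi_symmetric)
  next
    case False
    have "insort_key fst (Suc y, Suc i) (insort_key fst (Suc x, i) zs) =
        insort_key fst (Suc x, i) (insort_key fst (Suc y, Suc i) zs)" for zs
      using False by (intro insort_key_left_comm) auto
    then have "sort_key fst (?CA @ (Suc y, Suc i) # (Suc x, i) # ?CB) = sort_key fst (shape_columns 1 (A @ x # y # B))"
      unfolding Cxy by (induction ?CA) (auto simp: sort_key_def)
    then have "filling_sum ?n (map (relabel i) S) = key_sum (A @ x # y # B)"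
        unfolding relabelS key_sum_def by (simp only: filling_sum_shape_sort order_refl)
    then show ?thesis unfolding key_yx zip_relabel by simp
  qed
qed

text \<open>
  The label in column \<open>c\<close> (counted from 1) is at most \<open>c\<close>, and the labels of a row that is filled from
  the left are distinct; so each of them is forced to be \<open>c\<close>.
\<close>
lemma filling_sum_decreasing:
  assumes "\<And>c d. c < d \<Longrightarrow> d < length cols \<Longrightarrow> fst (cols ! d) \<le> fst (cols ! c)"
    and "\<And>c. c < length cols \<Longrightarrow> 1 \<le> fst (cols ! c) \<Longrightarrow> snd (cols ! c) = Suc c"
  shows "filling_sum n cols = (\<Prod>c<length cols. Var (Suc c) ^ min n (fst (cols ! c) - 1))"
  using assms
proof (induction n arbitrary: cols)
  case (Suc n)
  define t where "t = (\<lambda>c. (fst (cols ! c), snd (cols ! c), if 2 \<le> fst (cols ! c) then Suc c else 0))"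
  define ts where "ts = map t [0..<length cols]"
  have label: "snd (cols ! c) = Suc c" if "c < length cols" "2 \<le> fst (cols ! c)" for c
    using Suc.prems(2)[of c] that by simp
  have "us = ts" if us: "us \<in> row_steps cols" "sorted_wrt pair_ok us" for us
  proof (rule nth_equalityI)
    have cols: "cols = map old_column us" and ok: "\<And>c. c < length us \<Longrightarrow> step_ok (us ! c)"
      using us(1) by (auto simp: row_steps_def)
    show len: "length us = length ts" by (simp add: ts_def cols)
    fix c assume "c < length us"
    then show "us ! c = ts ! c"
    proof (induction c rule: less_induct)
      case (less c)
      obtain k u v where uc: "us ! c = (k, u, v)" by (cases "us ! c")
      have cc: "cols ! c = (k, u)" "c < length cols" using less.prems by (simp_all add: cols uc)
      have "v = (if 2 \<le> k then Suc c else 0)"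
      proof (cases "2 \<le> k")
        case True
        have v: "1 \<le> v" "v \<le> Suc c" using ok[OF less.prems] True label[OF cc(2)] cc by (auto simp: uc step_ok_def)
        have "v \<noteq> Suc d" if d: "d < c" for d
        proof -
          have kd: "k \<le> fst (cols ! d)" using Suc.prems(1)[OF d cc(2)] cc by simp
          then have "us ! d = (fst (cols ! d), snd (cols ! d), Suc d)"
            using less.IH[OF d] d less.prems True len by (simp add: ts_def t_def)
          moreover have "snd (cols ! d) = Suc d" "u = Suc c" using label[of d] label[of c] d cc True kd by auto
          moreover have "pair_ok (us ! d) (us ! c)" using sorted_wrt_nth_less[OF us(2) d less.prems] .
          ultimately show ?thesis using kd True d by (auto simp: uc pair_ok_def split: if_splits)
        qed
        then have "v = Suc c" using v by (metis Suc_le_D One_nat_def le_Suc_eq less_Suc_eq_le not_less_eq_eq)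
        then show ?thesis using True by simp
      next
        case False
        then show ?thesis using ok[OF less.prems] by (simp add: uc step_ok_def)
      qed
      then show ?case using cc less.prems len by (simp add: ts_def t_def uc)
    qed
  qed
  moreover have "ts \<in> row_steps cols"
    using label by (auto simp: row_steps_def ts_def t_def step_ok_def old_column_def intro: nth_equalityI)
  moreover have "sorted_wrt pair_ok ts"
    unfolding sorted_wrt_iff_nth_less
  proof (intro allI impI)
    fix c d assume cd: "c < d" "d < length ts"
    then show "pair_ok (ts ! c) (ts ! d)"
      using Suc.prems(1)[of c d] Suc.prems(2)[of c] Suc.prems(2)[of d] by (auto simp: ts_def t_def pair_ok_def)
  qed
  ultimately have "{us \<in> row_steps cols. sorted_wrt pair_ok us} = {ts}" by blast
  then have "filling_sum (Suc n) cols = weight ts * filling_sum n (map new_column ts)"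
    by (simp add: sum.inter_filter[symmetric])
  also have "weight ts = (\<Prod>c<length cols. if 2 \<le> fst (cols ! c) then Var (Suc c) else 1)"
    by (simp add: weight_def ts_def t_def comp_def prod.list_conv_set_nth atLeast0LessThan[symmetric] cong: if_cong)
  also have "filling_sum n (map new_column ts) =
      (\<Prod>c<length (map new_column ts). Var (Suc c) ^ min n (fst (map new_column ts ! c) - 1))"
    using Suc.prems(1) label by (intro Suc.IH) (auto simp: ts_def t_def intro!: diff_le_mono)
  also have "\<dots> = (\<Prod>c<length cols. Var (Suc c) ^ min n (fst (cols ! c) - 1 - 1))"
    by (intro prod.cong) (auto simp: ts_def t_def)
  also have "(\<Prod>c<length cols. if 2 \<le> fst (cols ! c) then Var (Suc c) else 1) * \<dots> =
      (\<Prod>c<length cols. Var (Suc c) ^ min (Suc n) (fst (cols ! c) - 1))"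
    unfolding prod.distrib[symmetric]
  proof (intro prod.cong refl)
    fix c
    show "(if 2 \<le> fst (cols ! c) then Var (Suc c) else 1) * Var (Suc c) ^ min n (fst (cols ! c) - 1 - 1) =
        Var (Suc c) ^ min (Suc n) (fst (cols ! c) - 1)"
    proof (cases "2 \<le> fst (cols ! c)")
      case True
      then have "min (Suc n) (fst (cols ! c) - 1) = Suc (min n (fst (cols ! c) - 1 - 1))" by simp
      then show ?thesis using True by simp
    qed simp
  qed
  finally show ?case .
qed simp

lemma key_sum_decreasing:
  assumes "sorted_wrt (\<ge>) \<alpha>"
  shows "key_sum \<alpha> = (\<Prod>i = 1..length \<alpha>. Var i ^ (\<alpha> ! (i - 1)))"
proof -
  have nth: "shape_columns 1 \<alpha> ! c = (Suc (\<alpha> ! c), Suc c)" if "c < length \<alpha>" for c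
    using that by (simp add: shape_columns_def del: upt_Suc)
  have len: "length (shape_columns 1 \<alpha>) = length \<alpha>" by (simp add: shape_columns_def del: upt_Suc)
  have "key_sum \<alpha> = (\<Prod>c<length (shape_columns 1 \<alpha>).
      Var (Suc c) ^ min (sum_list \<alpha>) (fst (shape_columns 1 \<alpha> ! c) - 1))"
    unfolding key_sum_def
  proof (rule filling_sum_decreasing, unfold len)
    show "fst (shape_columns 1 \<alpha> ! d) \<le> fst (shape_columns 1 \<alpha> ! c)" if "c < d" "d < length \<alpha>" for c d
      using sorted_wrt_nth_less[OF assms that] nth[of c] nth[of d] that by simp
    show "snd (shape_columns 1 \<alpha> ! c) = Suc c" if "c < length \<alpha>" for c
      using nth[OF that] by simp
  qed
  also have "\<dots> = (\<Prod>c<length \<alpha>. Var (Suc c) ^ min (sum_list \<alpha>) (\<alpha> ! c))"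
    unfolding len by (intro prod.cong refl) (simp only: lessThan_iff nth fst_conv diff_Suc_1)
  also have "\<dots> = (\<Prod>c<length \<alpha>. Var (Suc c) ^ (\<alpha> ! c))"
    by (intro prod.cong refl) (simp add: min_absorb2 member_le_sum_list)
  also have "\<dots> = (\<Prod>i = 1..length \<alpha>. Var i ^ (\<alpha> ! (i - 1)))"
    by (rule prod.reindex_bij_witness[of _ "\<lambda>i. i - 1" Suc]) auto
  finally show ?thesis .
qed

lemma swap_entries_append:
  assumes "Suc (length A) = i"
  shows "swap_entries i (A @ x # y # B) = A @ y # x # B" "(A @ x # y # B) ! (i - 1) = x" "(A @ x # y # B) ! i = y"
proof -
  have i: "i = Suc (length A)" using assms by simp
  show "swap_entries i (A @ x # y # B) = A @ y # x # B"
    unfolding swap_entries_def i by (simp add: list_update_append nth_append)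
  show "(A @ x # y # B) ! (i - 1) = x" "(A @ x # y # B) ! i = y"
    unfolding i by (simp_all add: nth_append)
qed

lemma split_at_two:
  assumes "1 \<le> i" "i < length \<alpha>"
  obtains A x y B where "\<alpha> = A @ x # y # B" "Suc (length A) = i"
proof
  show "\<alpha> = take (i - 1) \<alpha> @ \<alpha> ! (i - 1) # \<alpha> ! i # drop (Suc i) \<alpha>"
    using assms by (metis Cons_nth_drop_Suc Suc_pred' append_take_drop_id diff_less less_imp_diff_less less_one order.strict_trans2 less_eq_Suc_le One_nat_def)
  show "Suc (length (take (i - 1) \<alpha>)) = i" using assms by simp
qed

text \<open>
  The sum of the entries, each weighted by the number of entries before it. It drops when a larger
  entry moves to the left, and so measures the distance to the weakly decreasing rearrangement.
\<close>
fun lag :: "nat list \<Rightarrow> nat" where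
  "lag [] = 0"
| "lag (x # xs) = lag xs + sum_list xs"

lemma lag_append: "lag (A @ B) = lag A + lag B + length A * sum_list B"
  by (induction A) (auto simp: algebra_simps)

lemma ascent_exists: "\<not> sorted_wrt (\<ge>) (\<alpha> :: nat list) \<Longrightarrow> \<exists>A x y B. \<alpha> = A @ x # y # B \<and> x < y"
proof (induction \<alpha> rule: induct_list012)
  case (3 x y zs)
  show ?case
  proof (cases "x < y")
    case True
    then show ?thesis by (intro exI[of _ "[]"]) auto
  next
    case False
    have "\<not> sorted_wrt (\<ge>) (y # zs)"
      using False 3(3) by (auto intro: order.trans)
    from 3(2)[OF this] obtain A a b B where "y # zs = A @ a # b # B" "a < b" by blast
    then have "x # y # zs = (x # A) @ a # b # B" by simp
    then show ?thesis using \<open>a < b\<close> by blast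
  qed
qed auto

theorem key_poly_eq_key_sum: "key_poly = key_sum"
  unfolding key_poly_def
proof (rule the_equality)
  show "(\<forall>\<alpha>. sorted_wrt (\<ge>) \<alpha> \<longrightarrow> key_sum \<alpha> = (\<Prod>i = 1..length \<alpha>. Var i ^ (\<alpha> ! (i - 1)))) \<and>
     (\<forall>\<alpha> i. 1 \<le> i \<and> i < length \<alpha> \<and> \<alpha> ! (i - 1) > \<alpha> ! i \<longrightarrow>
        key_sum (swap_entries i \<alpha>) = xi i (key_sum \<alpha>))"
  proof (intro conjI allI impI)
    fix \<alpha> :: "nat list" and i
    assume i: "1 \<le> i \<and> i < length \<alpha> \<and> \<alpha> ! (i - 1) > \<alpha> ! i"
    then obtain A x y B where \<alpha>: "\<alpha> = A @ x # y # B" "Suc (length A) = i"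
      using split_at_two by blast
    then show "key_sum (swap_entries i \<alpha>) = xi i (key_sum \<alpha>)"
      using i key_sum_swap[of y x A i B] swap_entries_append[OF \<alpha>(2), of x y B] by simp
  qed (rule key_sum_decreasing)
next
  fix K :: "nat list \<Rightarrow> pol"
  assume K: "(\<forall>\<alpha>. sorted_wrt (\<ge>) \<alpha> \<longrightarrow> K \<alpha> = (\<Prod>i = 1..length \<alpha>. Var i ^ (\<alpha> ! (i - 1)))) \<and>
     (\<forall>\<alpha> i. 1 \<le> i \<and> i < length \<alpha> \<and> \<alpha> ! (i - 1) > \<alpha> ! i \<longrightarrow> K (swap_entries i \<alpha>) = xi i (K \<alpha>))"
  have "K \<alpha> = key_sum \<alpha>" for \<alpha>
  proof (induction \<alpha> rule: measure_induct_rule[where f = lag])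
    case (less \<alpha>)
    show ?case
    proof (cases "sorted_wrt (\<ge>) \<alpha>")
      case True
      then show ?thesis using K key_sum_decreasing by metis
    next
      case False
      then obtain A x y B where \<alpha>: "\<alpha> = A @ x # y # B" and "x < y" using ascent_exists by blast
      define i where "i = Suc (length A)"
      let ?\<beta> = "A @ y # x # B"
      have "lag ?\<beta> < lag \<alpha>" using \<open>x < y\<close> by (simp add: \<alpha> lag_append algebra_simps)
      from less.IH[OF this] have IH: "K ?\<beta> = key_sum ?\<beta>" .
      have "1 \<le> i \<and> i < length ?\<beta> \<and> ?\<beta> ! (i - 1) > ?\<beta> ! i"
        using swap_entries_append(2,3)[of A i y x B] \<open>x < y\<close> by (simp add: i_def)
      then have "K (swap_entries i ?\<beta>) = xi i (K ?\<beta>)" using K by blast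
      then have "K \<alpha> = xi i (key_sum ?\<beta>)"
        using swap_entries_append(1)[of A i y x B] by (simp add: i_def \<alpha> IH)
      also have "\<dots> = key_sum \<alpha>"
        unfolding \<alpha> using key_sum_swap[of x y A i B] \<open>x < y\<close> by (simp add: i_def)
      finally show ?thesis .
    qed
  qed
  then show "K = key_sum" by (rule ext)
qed

section \<open>Symmetrisation\<close>

definition ratio :: "('b \<Rightarrow> 'a::field) \<Rightarrow> 'b \<Rightarrow> 'b \<Rightarrow> 'a" where
  "ratio x a b = 1 / (1 - x b / x a)"

lemma ratio_add_ratio:
  assumes "x a \<noteq> 0" "x b \<noteq> 0" "x a \<noteq> x b"
  shows "ratio x a b + ratio x b a = 1"
proof -
  have "ratio x a b = x a / (x a - x b)" "ratio x b a = x b / (x b - x a)"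
    using assms by (simp_all add: ratio_def field_simps)
  moreover have "x b / (x b - x a) = - (x b / (x a - x b))"
    by (metis minus_diff_eq minus_divide_right)
  ultimately show ?thesis using assms by (simp add: diff_divide_distrib[symmetric])
qed

text \<open>
  In terms of \<open>y = 1 / x\<close>, the summand of \<open>b\<close> is the Lagrange basis polynomial of the node \<open>y b\<close> at \<open>0\<close>.
  The basis polynomials add up to \<open>1\<close>.
\<close>
lemma sum_prod_ratio:
  fixes x :: "'b \<Rightarrow> 'a::field"
  assumes "finite T" "T \<noteq> {}" "inj_on x T" "\<And>b. b \<in> T \<Longrightarrow> x b \<noteq> 0"
  shows "(\<Sum>b\<in>T. \<Prod>c\<in>T - {b}. ratio x b c) = 1"
proof -
  define y where "y b = inverse (x b)" for b
  have y: "y b \<noteq> 0" "b \<in> T \<Longrightarrow> c \<in> T \<Longrightarrow> y b = y c \<longleftrightarrow> b = c" if "b \<in> T" for b c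
    using assms that by (auto simp: y_def inj_on_eq_iff)
  define L where "L b = (\<Prod>c\<in>T - {b}. smult (1 / (y b - y c)) [:- y c, 1:])" for b
  define p where "p = (\<Sum>b\<in>T. L b)"
  have poly_L: "poly (L b) z = (\<Prod>c\<in>T - {b}. (z - y c) / (y b - y c))" for b z
    unfolding L_def poly_prod by (intro prod.cong) (auto simp: diff_divide_distrib)
  have "degree (L b) \<le> card T - 1" if "b \<in> T" for b
  proof -
    have "degree (L b) \<le> sum (degree \<circ> (\<lambda>c. smult (1 / (y b - y c)) [:- y c, 1:])) (T - {b})"
      unfolding L_def using assms(1) by (intro degree_prod_sum_le) auto
    also have "\<dots> \<le> (\<Sum>c\<in>T - {b}. 1)" by (intro sum_mono) (auto intro: order.trans[OF degree_smult_le])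
    also have "\<dots> = card T - 1" using that assms(1) by simp
    finally show ?thesis .
  qed
  then have "degree p \<le> card T - 1" unfolding p_def using assms(1) by (intro degree_sum_le) auto
  moreover have "card T > 0" using assms by (simp add: card_gt_0_iff)
  ultimately have deg: "degree p < card (y ` T)"
    using y by (subst card_image) (auto simp: inj_on_def)
  have "poly (L b) (y d) = (if b = d then 1 else 0)" if "b \<in> T" "d \<in> T" for b d
  proof (cases "b = d")
    case True
    then show ?thesis unfolding poly_L using y that by (auto intro!: prod.neutral split: if_splits)
  next
    case False
    then show ?thesis unfolding poly_L using that assms(1) by (auto intro!: prod_zero)
  qed
  then have "poly p (y d) = 1" if "d \<in> T" for d
    unfolding p_def poly_sum using that assms(1) by (simp add: sum.delta)
  then have "p = 1"
    using deg by (intro poly_eqI_degree[of "y ` T"]) auto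
  then have "1 = poly p 0" by simp
  also have "\<dots> = (\<Sum>b\<in>T. \<Prod>c\<in>T - {b}. ratio x b c)"
    unfolding p_def poly_sum poly_L
  proof (intro sum.cong prod.cong refl)
    fix b c assume bc: "b \<in> T" "c \<in> T - {b}"
    then have "x b \<noteq> 0" "x c \<noteq> 0" "x b \<noteq> x c" using assms by (auto simp: inj_on_eq_iff)
    then show "(0 - y c) / (y b - y c) = ratio x b c"
      by (simp add: y_def ratio_def field_simps)
  qed
  finally show ?thesis by simp
qed

definition pairs :: "nat set \<Rightarrow> (nat \<times> nat) set" where
  "pairs S = {(i, j). i \<in> S \<and> j \<in> S \<and> i < j}"

lemma finite_pairs: "finite S \<Longrightarrow> finite (pairs S)"
  by (rule finite_subset[of _ "S \<times> S"]) (auto simp: pairs_def)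

text \<open>
  The product of the factors with the smallest index depends only on its image \<open>b\<close>. The other factors
  are summed by the induction hypothesis, and the sum over \<open>b\<close> is the previous lemma.
\<close>
lemma sum_permutations_ratio:
  fixes x :: "nat \<Rightarrow> 'a::field"
  assumes "finite S" "inj_on x S" "\<And>b. b \<in> S \<Longrightarrow> x b \<noteq> 0"
  shows "(\<Sum>\<sigma>\<in>{\<sigma>. \<sigma> permutes S}. \<Prod>(i, j)\<in>pairs S. ratio x (\<sigma> i) (\<sigma> j)) = 1"
  using assms
proof (induction S arbitrary: x rule: finite_linorder_min_induct)
  case empty
  then show ?case by (simp add: pairs_def)
next
  case (insert a S)
  have a: "a \<notin> S" using insert.hyps(2) by auto
  have pairs_insert: "pairs (insert a S) = (Pair a) ` S \<union> pairs S" "(Pair a) ` S \<inter> pairs S = {}"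
    using insert.hyps(2) a by (auto simp: pairs_def)
  have inner: "(\<Sum>q\<in>{q. q permutes S}. \<Prod>(i, j)\<in>pairs (insert a S). ratio x ((transpose a b \<circ> q) i) ((transpose a b \<circ> q) j)) =
      (\<Prod>c\<in>insert a S - {b}. ratio x b c)" if b: "b \<in> insert a S" for b
  proof -
    let ?t = "transpose a b"
    have t_in: "?t c \<in> insert a S" if "c \<in> S" for c using that b by (auto simp: transpose_def)
    have first: "(\<Prod>j\<in>S. ratio x (?t (q a)) (?t (q j))) = (\<Prod>c\<in>insert a S - {b}. ratio x b c)"
      if q: "q permutes S" for q
    proof -
      have "q a = a" using q a by (rule permutes_not_in)
      have "(\<Prod>j\<in>S. ratio x b (?t (q j))) = (\<Prod>j\<in>S. ratio x b (?t j))"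
        using prod.permute[OF q, of "\<lambda>j. ratio x b (?t j)"] by (simp add: comp_def)
      also have "\<dots> = (\<Prod>c\<in>?t ` S. ratio x b c)"
        by (subst prod.reindex) (auto intro: inj_on_subset[OF inj_transpose])
      also have "?t ` S = insert a S - {b}"
        using b a by (auto simp: transpose_def image_iff split: if_splits)
      finally show ?thesis using \<open>q a = a\<close> by simp
    qed
    have inj: "inj_on (x \<circ> ?t) S"
      using insert.prems(1) t_in by (auto simp: inj_on_def) (metis transpose_involutory)
    have "(\<Sum>q\<in>{q. q permutes S}. \<Prod>(i, j)\<in>pairs (insert a S). ratio x ((?t \<circ> q) i) ((?t \<circ> q) j)) =
        (\<Sum>q\<in>{q. q permutes S}. (\<Prod>c\<in>insert a S - {b}. ratio x b c) * (\<Prod>(i, j)\<in>pairs S. ratio (x \<circ> ?t) (q i) (q j)))"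
    proof (intro sum.cong refl)
      fix q assume "q \<in> {q. q permutes S}"
      then show "(\<Prod>(i, j)\<in>pairs (insert a S). ratio x ((?t \<circ> q) i) ((?t \<circ> q) j)) =
          (\<Prod>c\<in>insert a S - {b}. ratio x b c) * (\<Prod>(i, j)\<in>pairs S. ratio (x \<circ> ?t) (q i) (q j))"
        unfolding pairs_insert(1)
        using first[of q] insert.hyps(1) finite_pairs[OF insert.hyps(1)] pairs_insert(2)
        by (subst prod.union_disjoint) (auto simp: prod.reindex inj_on_def ratio_def comp_def intro: prod.cong)
    qed
    also have "\<dots> = (\<Prod>c\<in>insert a S - {b}. ratio x b c)"
      unfolding sum_distrib_left[symmetric]
      using insert.IH[OF inj] insert.prems(2) t_in by (simp add: comp_def)
    finally show ?thesis .
  qed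
  have "(\<Sum>\<sigma>\<in>{\<sigma>. \<sigma> permutes insert a S}. \<Prod>(i, j)\<in>pairs (insert a S). ratio x (\<sigma> i) (\<sigma> j)) =
      (\<Sum>b\<in>insert a S. \<Prod>c\<in>insert a S - {b}. ratio x b c)"
    unfolding sum_over_permutations_insert[OF insert.hyps(1) a] by (intro sum.cong refl inner)
  also have "\<dots> = 1"
    using insert.hyps(1) insert.prems by (intro sum_prod_ratio) auto
  finally show ?case .
qed

definition symmetrize_frac :: "nat \<Rightarrow> nat \<Rightarrow> pol \<Rightarrow> pol fract" where
  "symmetrize_frac k n f = (\<Sum>\<sigma>\<in>{\<sigma>. \<sigma> permutes {k+1..n}}.
     to_frac (permute_vars \<sigma> f) * (\<Prod>(i, j)\<in>pairs {k+1..n}. ratio (\<lambda>i. to_frac (Var i)) (\<sigma> i) (\<sigma> j)))"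

lemma W_fin_eq: "W_fin k n f = poly_of_frac (symmetrize_frac k n f)"
proof -
  have "{(i, j). k + 1 \<le> i \<and> i < j \<and> j \<le> n} = pairs {k+1..n}" by (auto simp: pairs_def)
  then show ?thesis by (simp add: W_fin_def symmetrize_frac_def ratio_def)
qed

lemma to_frac_Var: "to_frac (Var i) \<noteq> 0" "to_frac (Var i) = to_frac (Var j) \<longleftrightarrow> i = j"
  by (simp_all only: to_frac_eq_0_iff Var_nonzero to_frac_eq_iff Var_eq_iff not_False_eq_True)

lemma to_frac_permute_xi:
  assumes "bij \<sigma>"
  shows "to_frac (permute_vars \<sigma> (xi i f)) =
    ratio (\<lambda>i. to_frac (Var i)) (\<sigma> i) (\<sigma> (Suc i)) * to_frac (permute_vars \<sigma> f) +
    ratio (\<lambda>i. to_frac (Var i)) (\<sigma> (Suc i)) (\<sigma> i) * to_frac (permute_vars (\<sigma> \<circ> adj i) f)"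
proof -
  define X where "X = to_frac (Var (\<sigma> i))"
  define Y where "Y = to_frac (Var (\<sigma> (Suc i)))"
  define F where "F = to_frac (permute_vars \<sigma> f)"
  define G where "G = to_frac (permute_vars (\<sigma> \<circ> adj i) f)"
  define H where "H = to_frac (permute_vars \<sigma> (xi i f))"
  have XY: "X \<noteq> 0" "Y \<noteq> 0" "X \<noteq> Y"
    using bij_is_inj[OF assms] by (simp_all add: X_def Y_def to_frac_Var inj_eq)
  have "to_frac (permute_vars \<sigma> ((Var i - Var (Suc i)) * xi i f)) =
      to_frac (permute_vars \<sigma> (Var i * f - Var (Suc i) * permute_vars (adj i) f))"
    by (simp only: xi_char)
  then have eq: "(X - Y) * H = X * F - Y * G"
    unfolding X_def Y_def H_def F_def G_def
    by (simp only: permute_vars_mult[OF assms] permute_vars_diff[OF assms] permute_vars_Var[OF assms]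
        permute_vars_compose[OF assms bij_transpose] to_frac_mult to_frac_diff)
  have "H = (X * F - Y * G) / (X - Y)" using XY by (simp add: eq[symmetric])
  also have "\<dots> = (1 / (1 - Y / X)) * F + (1 / (1 - X / Y)) * G"
    using XY by (simp add: divide_simps) (simp add: algebra_simps)
  finally show ?thesis by (simp only: ratio_def X_def Y_def F_def G_def H_def)
qed

text \<open>
  With \<open>\<theta> = x\<^sub>i f / (x\<^sub>i - x\<^bsub>i+1\<^esub>)\<close> one has \<open>\<xi>\<^sub>i f = \<theta> + s\<^sub>i \<theta>\<close>. Reindexing the second part by
  \<open>\<sigma> \<mapsto> \<sigma> s\<^sub>i\<close> replaces the factor of the pair \<open>(i, i + 1)\<close> in the product by the sum of this factor
  and its mirror image, which is \<open>1\<close> by \<open>ratio_add_ratio\<close>.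
\<close>
lemma symmetrize_xi:
  assumes "k < i" "i < n"
  shows "symmetrize_frac k n (xi i f) = symmetrize_frac k n f"
proof -
  define r where "r = ratio (\<lambda>i. to_frac (Var i))"
  define D where "D \<sigma> = (\<Prod>(a, b)\<in>pairs {k+1..n}. r (\<sigma> a) (\<sigma> b))" for \<sigma>
  define E where "E = pairs {k+1..n} - {(i, Suc i)}"
  let ?S = "{\<sigma>. \<sigma> permutes {k+1..n}}"
  have s: "adj i permutes {k+1..n}" using assms by (intro permutes_swap_id) auto
  have bij: "bij \<sigma>" if "\<sigma> \<in> ?S" for \<sigma> using that by (auto intro: permutes_bij)
  have pair: "(i, Suc i) \<in> pairs {k+1..n}" using assms by (auto simp: pairs_def)
  have E: "(\<lambda>(a, b). (adj i a, adj i b)) ` E = E"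
  proof -
    have sub: "(\<lambda>(a, b). (adj i a, adj i b)) ` E \<subseteq> E"
      using assms by (auto simp: E_def pairs_def adj_eq split: if_splits)
    have "c \<in> (\<lambda>(a, b). (adj i a, adj i b)) ` E" if "c \<in> E" for c
    proof -
      have "(\<lambda>(a, b). (adj i a, adj i b)) c \<in> E" using sub that by blast
      then show ?thesis by (intro image_eqI[of _ _ "(\<lambda>(a, b). (adj i a, adj i b)) c"]) (auto split: prod.splits)
    qed
    then show ?thesis using sub by blast
  qed
  have D: "D \<sigma> = r (\<sigma> i) (\<sigma> (Suc i)) * (\<Prod>(a, b)\<in>E. r (\<sigma> a) (\<sigma> b))" for \<sigma>
    unfolding D_def E_def by (subst prod.remove[OF finite_pairs pair]) auto
  have D_swap: "D (\<sigma> \<circ> adj i) = r (\<sigma> (Suc i)) (\<sigma> i) * (\<Prod>(a, b)\<in>E. r (\<sigma> a) (\<sigma> b))" for \<sigma>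
  proof -
    have "inj_on (\<lambda>(a, b). (adj i a, adj i b)) E"
      by (auto simp: inj_on_def inj_eq[OF bij_is_inj[OF bij_transpose]])
    then have "(\<Prod>(a, b)\<in>(\<lambda>(a, b). (adj i a, adj i b)) ` E. r (\<sigma> a) (\<sigma> b)) = (\<Prod>(a, b)\<in>E. r (\<sigma> (adj i a)) (\<sigma> (adj i b)))"
      by (simp add: prod.reindex split_def)
    then have "(\<Prod>(a, b)\<in>E. r (\<sigma> a) (\<sigma> b)) = (\<Prod>(a, b)\<in>E. r (\<sigma> (adj i a)) (\<sigma> (adj i b)))"
      by (simp only: E)
    then show ?thesis
      unfolding D by (simp only: comp_apply transpose_apply_first transpose_apply_second)
  qed
  have D_sum: "r (\<sigma> i) (\<sigma> (Suc i)) * D \<sigma> + r (\<sigma> i) (\<sigma> (Suc i)) * D (\<sigma> \<circ> adj i) = D \<sigma>" if "\<sigma> \<in> ?S" for \<sigma>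
  proof -
    have "\<sigma> i \<noteq> \<sigma> (Suc i)" using bij_is_inj[OF bij[OF that]] by (simp add: inj_eq)
    then have "r (\<sigma> i) (\<sigma> (Suc i)) + r (\<sigma> (Suc i)) (\<sigma> i) = 1"
      unfolding r_def by (intro ratio_add_ratio) (simp_all add: to_frac_Var)
    moreover have "r (\<sigma> i) (\<sigma> (Suc i)) * D \<sigma> + r (\<sigma> i) (\<sigma> (Suc i)) * D (\<sigma> \<circ> adj i) =
        (r (\<sigma> i) (\<sigma> (Suc i)) + r (\<sigma> (Suc i)) (\<sigma> i)) * D \<sigma>"
      unfolding D_swap D[of \<sigma>] by (simp add: algebra_simps)
    ultimately show ?thesis by simp
  qed
  have "symmetrize_frac k n (xi i f) = (\<Sum>\<sigma>\<in>?S. (r (\<sigma> i) (\<sigma> (Suc i)) * to_frac (permute_vars \<sigma> f) +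
      r (\<sigma> (Suc i)) (\<sigma> i) * to_frac (permute_vars (\<sigma> \<circ> adj i) f)) * D \<sigma>)"
    unfolding symmetrize_frac_def D_def r_def by (intro sum.cong refl) (simp only: to_frac_permute_xi[OF bij])
  also have "\<dots> = (\<Sum>\<sigma>\<in>?S. r (\<sigma> i) (\<sigma> (Suc i)) * to_frac (permute_vars \<sigma> f) * D \<sigma>) +
      (\<Sum>\<sigma>\<in>?S. r (\<sigma> (Suc i)) (\<sigma> i) * to_frac (permute_vars (\<sigma> \<circ> adj i) f) * D \<sigma>)"
    by (simp only: distrib_right sum.distrib)
  also have "(\<Sum>\<sigma>\<in>?S. r (\<sigma> (Suc i)) (\<sigma> i) * to_frac (permute_vars (\<sigma> \<circ> adj i) f) * D \<sigma>) =
      (\<Sum>\<sigma>\<in>?S. r (\<sigma> i) (\<sigma> (Suc i)) * to_frac (permute_vars \<sigma> f) * D (\<sigma> \<circ> adj i))"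
    by (subst sum_permutations_compose_right[OF s]) (simp add: comp_assoc)
  also have "(\<Sum>\<sigma>\<in>?S. r (\<sigma> i) (\<sigma> (Suc i)) * to_frac (permute_vars \<sigma> f) * D \<sigma>) + \<dots> =
      (\<Sum>\<sigma>\<in>?S. to_frac (permute_vars \<sigma> f) *
        (r (\<sigma> i) (\<sigma> (Suc i)) * D \<sigma> + r (\<sigma> i) (\<sigma> (Suc i)) * D (\<sigma> \<circ> adj i)))"
    unfolding sum.distrib[symmetric] by (intro sum.cong refl) (simp add: algebra_simps)
  also have "\<dots> = (\<Sum>\<sigma>\<in>?S. to_frac (permute_vars \<sigma> f) * D \<sigma>)"
    by (intro sum.cong refl) (simp only: D_sum)
  finally show ?thesis by (simp only: symmetrize_frac_def D_def r_def)
qed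

lemma permute_vars_id: "permute_vars id p = p"
  by (simp add: permute_vars_def id_def map_key_id[abs_def])

text \<open>Adjacent transpositions generate the symmetric group of an interval.\<close>
lemma permutes_adjacent_induct [consumes 1, case_names id adj]:
  assumes "\<sigma> permutes {k+1..n}" "P id"
    and step: "\<And>i p. k < i \<Longrightarrow> i < n \<Longrightarrow> bij p \<Longrightarrow> P p \<Longrightarrow> P (adj i \<circ> p)"
  shows "P \<sigma>"
proof -
  have adjacent: "P (transpose a b \<circ> p)" if "k < a" "a < b" "b \<le> n" "bij p" "P p" for a b p
    using that
  proof (induction "b - a" arbitrary: b p)
    case (Suc m)
    show ?case
    proof (cases "b = Suc a")
      case False
      define c where "c = b - 1"
      have c: "b = Suc c" "a < c" using Suc.prems(2) False by (auto simp: c_def)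
      have "transpose a b = adj c \<circ> transpose a c \<circ> adj c"
        using c by (auto simp: fun_eq_iff transpose_def)
      moreover have "P (adj c \<circ> p)" using Suc.prems c by (intro step) auto
      then have "P (transpose a c \<circ> (adj c \<circ> p))"
        using Suc.prems c Suc.hyps(2) by (intro Suc.hyps(1)) (auto intro: bij_comp)
      then have "P (adj c \<circ> (transpose a c \<circ> (adj c \<circ> p)))"
        using Suc.prems c by (intro step) (auto intro!: bij_comp)
      ultimately show ?thesis by (simp add: comp_assoc)
    qed (use Suc.prems step in auto)
  qed auto
  show ?thesis
    using assms(1) finite_atLeastAtMost
  proof (induction \<sigma> rule: permutes_induct)
    case (swap a b p)
    then have "bij p" by (auto intro: permutes_bij)
    show ?case
    proof (cases "a < b")
      case True
      then show ?thesis using swap \<open>bij p\<close> by (intro adjacent) auto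
    next
      case False
      then have "P (transpose b a \<circ> p)" using swap \<open>bij p\<close> by (intro adjacent) auto
      then show ?thesis by (simp only: transpose_commute)
    qed
  qed (rule assms(2))
qed

lemma symmetrize_symmetric:
  assumes "\<And>i. k < i \<Longrightarrow> i < n \<Longrightarrow> permute_vars (adj i) h = h"
  shows "symmetrize_frac k n h = to_frac h"
proof -
  have "permute_vars \<sigma> h = h" if "\<sigma> permutes {k+1..n}" for \<sigma>
    using that
  proof (induction rule: permutes_adjacent_induct)
    case (adj i p)
    have "permute_vars (adj i \<circ> p) h = permute_vars (adj i) (permute_vars p h)"
      using adj by (intro permute_vars_compose[symmetric]) auto
    also have "\<dots> = h" using adj assms by (simp only:)
    finally show ?case .
  qed (rule permute_vars_id)
  then have "symmetrize_frac k n h = (\<Sum>\<sigma>\<in>{\<sigma>. \<sigma> permutes {k+1..n}}. to_frac h *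
      (\<Prod>(i, j)\<in>pairs {k+1..n}. ratio (\<lambda>i. to_frac (Var i)) (\<sigma> i) (\<sigma> j)))"
    unfolding symmetrize_frac_def by (intro sum.cong refl) simp
  also have "\<dots> = to_frac h"
    unfolding sum_distrib_left[symmetric]
    by (subst sum_permutations_ratio) (simp_all add: to_frac_Var inj_on_def)
  finally show ?thesis .
qed

primrec xi_chain :: "nat \<Rightarrow> nat \<Rightarrow> pol \<Rightarrow> pol" where
  "xi_chain k 0 f = f"
| "xi_chain k (Suc m) f = xi (k + Suc m) (xi_chain k m f)"

text \<open>
  Symmetrisation absorbs the operators \<open>\<xi>\<^sub>i\<close> and fixes symmetric polynomials, so it agrees with any
  chain of these operators that produces a symmetric polynomial.
\<close>
lemma W_fin_xi_chain:
  assumes "k + m < n \<or> m = 0" "\<And>i. k < i \<Longrightarrow> i < n \<Longrightarrow> permute_vars (adj i) (xi_chain k m f) = xi_chain k m f"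
  shows "W_fin k n f = xi_chain k m f"
proof -
  have "symmetrize_frac k n (xi_chain k m f) = symmetrize_frac k n f"
    using assms(1) by (induction m) (auto simp: symmetrize_xi)
  then have "symmetrize_frac k n f = to_frac (xi_chain k m f)"
    using symmetrize_symmetric[of k n "xi_chain k m f", OF assms(2)] by (rule trans[OF sym])
  then show ?thesis by (simp only: W_fin_eq poly_of_frac_to_frac)
qed

section \<open>Labellings\<close>

text \<open>
  The counterpart of \<open>pair_ok\<close> for the rows \<open>j - 1\<close> and \<open>j\<close> of a labelling of boxes. The labels may come
  from any linear order, since the basement of the theorem contains infinite ordinals.
\<close>
definition pair_cond :: "nat list \<Rightarrow> (box \<Rightarrow> 'a::linorder) \<Rightarrow> nat \<Rightarrow> nat \<Rightarrow> nat \<Rightarrow> bool" where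
  "pair_cond \<alpha> \<tau> j a b \<longleftrightarrow> (if \<alpha> ! (a - 1) \<le> \<alpha> ! (b - 1) then \<tau> (b, j - 1) < \<tau> (a, j) \<or> \<tau> (a, j) < \<tau> (b, j)
     else \<not> (\<tau> (a, j) \<le> \<tau> (b, j - 1) \<and> \<tau> (b, j - 1) < \<tau> (a, j - 1)) \<and>
       (j \<le> \<alpha> ! (b - 1) \<longrightarrow> \<tau> (a, j) \<noteq> \<tau> (b, j)))"

definition row_cond :: "nat list \<Rightarrow> (box \<Rightarrow> 'a::linorder) \<Rightarrow> nat \<Rightarrow> bool" where
  "row_cond \<alpha> \<tau> j \<longleftrightarrow>
     (\<forall>a. 1 \<le> a \<and> a \<le> length \<alpha> \<and> j \<le> \<alpha> ! (a - 1) \<longrightarrow> \<tau> (a, j) \<le> \<tau> (a, j - 1)) \<and>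
     (\<forall>a b. 1 \<le> a \<and> a < b \<and> b \<le> length \<alpha> \<and> j \<le> \<alpha> ! (a - 1) \<and> j - 1 \<le> \<alpha> ! (b - 1) \<longrightarrow> pair_cond \<alpha> \<tau> j a b)"

definition distinct_basement :: "nat list \<Rightarrow> (box \<Rightarrow> 'a) \<Rightarrow> bool" where
  "distinct_basement \<alpha> \<tau> \<longleftrightarrow> (\<forall>a b. 1 \<le> a \<and> a < b \<and> b \<le> length \<alpha> \<longrightarrow> \<tau> (a, 0) \<noteq> \<tau> (b, 0))"

lemma mem_dg_hat: "(i, j) \<in> dg_hat \<alpha> \<longleftrightarrow> 1 \<le> i \<and> i \<le> length \<alpha> \<and> j \<le> \<alpha> ! (i - 1)"
  by (auto simp: dg_hat_def dg_def)

lemma mem_dg: "(i, j) \<in> dg \<alpha> \<longleftrightarrow> 1 \<le> i \<and> i \<le> length \<alpha> \<and> 1 \<le> j \<and> j \<le> \<alpha> ! (i - 1)"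
  by (auto simp: dg_def)

lemma finite_dg_hat: "finite (dg_hat \<alpha>)"
proof -
  have "dg_hat \<alpha> \<subseteq> {..length \<alpha>} \<times> {..sum_list \<alpha>}"
  proof clarify
    fix i j assume "(i, j) \<in> dg_hat \<alpha>"
    then have "i \<le> length \<alpha>" "j \<le> \<alpha> ! (i - 1)" "\<alpha> ! (i - 1) \<in> set \<alpha>" by (auto simp: mem_dg_hat)
    then show "i \<in> {..length \<alpha>} \<and> j \<in> {..sum_list \<alpha>}"
      using member_le_sum_list[of "\<alpha> ! (i - 1)" \<alpha>] by simp
  qed
  then show ?thesis by (rule finite_subset) simp
qed

lemma finite_dg: "finite (dg \<alpha>)"
  by (rule finite_subset[OF _ finite_dg_hat]) (auto simp: dg_hat_def)

lemma coinv_eq_0_iff: "coinv \<alpha> \<tau> = 0 \<longleftrightarrow> coinv_triples \<alpha> \<tau> = {}"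
proof -
  have "finite (coinv_triples \<alpha> \<tau>)"
    by (rule finite_subset[of _ "dg_hat \<alpha> \<times> dg_hat \<alpha> \<times> dg_hat \<alpha>"]) (auto simp: coinv_triples_def finite_dg_hat)
  then show ?thesis by (simp add: coinv_def)
qed

lemma row_cond_if_no_coinv:
  assumes na: "non_attacking \<alpha> \<tau>" and co: "coinv_triples \<alpha> \<tau> = {}" and des: "Des \<alpha> \<tau> = {}"
  shows "distinct_basement \<alpha> \<tau> \<and> (\<forall>j\<ge>1. row_cond \<alpha> \<tau> j)"
proof -
  have attack: "\<tau> u \<noteq> \<tau> v" if "u \<in> dg_hat \<alpha>" "v \<in> dg_hat \<alpha>" "attacking u v" for u v
    using na that by (auto simp: non_attacking_def)
  have triple: "\<not> (\<tau> u < \<tau> v \<and> \<tau> v < \<tau> w)"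
    if "u \<in> dg_hat \<alpha>" "v \<in> dg_hat \<alpha>" "w \<in> dg_hat \<alpha>" "type1_triple \<alpha> u v w \<or> type2_triple \<alpha> u v w" for u v w
    using co that unfolding coinv_triples_def by blast
  have base: "distinct_basement \<alpha> \<tau>"
    unfolding distinct_basement_def using attack by (auto simp: mem_dg_hat attacking_def)
  have desc: "\<tau> (a, j) \<le> \<tau> (a, j - 1)" if "1 \<le> j" "1 \<le> a" "a \<le> length \<alpha>" "j \<le> \<alpha> ! (a - 1)" for a j
  proof -
    have "(a, j) \<in> dg \<alpha>" using that by (simp add: mem_dg)
    then show ?thesis using des unfolding Des_def by force
  qed
  have "pair_cond \<alpha> \<tau> j a b"
    if h: "1 \<le> j" "1 \<le> a" "a < b" "b \<le> length \<alpha>" "j \<le> \<alpha> ! (a - 1)" "j - 1 \<le> \<alpha> ! (b - 1)" for j a b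
  proof -
    have mem: "(a, j) \<in> dg_hat \<alpha>" "(b, j - 1) \<in> dg_hat \<alpha>" "(a, j - 1) \<in> dg_hat \<alpha>" "j \<le> \<alpha> ! (b - 1) \<Longrightarrow> (b, j) \<in> dg_hat \<alpha>"
      using h by (auto simp: mem_dg_hat)
    have cross: "\<tau> (a, j) \<noteq> \<tau> (b, j - 1)"
      using h by (intro attack mem) (auto simp: attacking_def)
    have same: "j \<le> \<alpha> ! (b - 1) \<Longrightarrow> \<tau> (a, j) \<noteq> \<tau> (b, j)"
      using h by (intro attack mem) (auto simp: attacking_def)
    show ?thesis
    proof (cases "\<alpha> ! (a - 1) \<le> \<alpha> ! (b - 1)")
      case True
      then have jb: "j \<le> \<alpha> ! (b - 1)" using h by simp
      have "type2_triple \<alpha> (b, j) (a, j) (b, j - 1)"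
        using h True by (auto simp: type2_triple_def)
      then have "\<not> (\<tau> (b, j) < \<tau> (a, j) \<and> \<tau> (a, j) < \<tau> (b, j - 1))"
        using triple mem jb by blast
      then show ?thesis using True cross same[OF jb] by (auto simp: pair_cond_def)
    next
      case False
      have "type1_triple \<alpha> (a, j) (b, j - 1) (a, j - 1)"
        using h False by (auto simp: type1_triple_def)
      then have "\<not> (\<tau> (a, j) < \<tau> (b, j - 1) \<and> \<tau> (b, j - 1) < \<tau> (a, j - 1))"
        using triple mem by blast
      then show ?thesis using False cross same by (auto simp: pair_cond_def)
    qed
  qed
  then show ?thesis using base desc by (auto simp: row_cond_def)
qed

text \<open>
  Conversely, \<open>pair_cond\<close> and the absence of descents exclude all attacks. The only case that needs
  two rows is an equality \<open>\<tau> (a, j) = \<tau> (b, j - 1)\<close> with a taller column \<open>a\<close>: it forces the two labels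
  in row \<open>j - 1\<close> to be equal.
\<close>
lemma no_coinv_if_row_cond:
  assumes base: "distinct_basement \<alpha> \<tau>" and row: "\<And>j. 1 \<le> j \<Longrightarrow> row_cond \<alpha> \<tau> j"
  shows "non_attacking \<alpha> \<tau>" "coinv_triples \<alpha> \<tau> = {}" "Des \<alpha> \<tau> = {}"
proof -
  have desc: "\<tau> (a, j) \<le> \<tau> (a, j - 1)" if "1 \<le> j" "1 \<le> a" "a \<le> length \<alpha>" "j \<le> \<alpha> ! (a - 1)" for a j
    using row[OF that(1)] that by (auto simp: row_cond_def)
  have pair: "pair_cond \<alpha> \<tau> j a b"
    if "1 \<le> j" "1 \<le> a" "a < b" "b \<le> length \<alpha>" "j \<le> \<alpha> ! (a - 1)" "j - 1 \<le> \<alpha> ! (b - 1)" for j a b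
    using row[OF that(1)] that by (auto simp: row_cond_def)
  show "Des \<alpha> \<tau> = {}"
    using desc by (fastforce simp: Des_def mem_dg)
  have same: "\<tau> (a, j) \<noteq> \<tau> (b, j)"
    if h: "1 \<le> a" "a < b" "b \<le> length \<alpha>" "j \<le> \<alpha> ! (a - 1)" "j \<le> \<alpha> ! (b - 1)" for a b j
  proof (cases "j = 0")
    case True
    then show ?thesis using base h by (auto simp: distinct_basement_def)
  next
    case False
    then have "pair_cond \<alpha> \<tau> j a b" using h by (intro pair) auto
    moreover have "\<tau> (b, j) \<le> \<tau> (b, j - 1)" using h False by (intro desc) auto
    ultimately show ?thesis using h by (auto simp: pair_cond_def split: if_splits)
  qed
  have cross: "\<tau> (a, j) \<noteq> \<tau> (b, j - 1)"
    if h: "1 \<le> j" "1 \<le> a" "a < b" "b \<le> length \<alpha>" "j \<le> \<alpha> ! (a - 1)" "j - 1 \<le> \<alpha> ! (b - 1)" for a b j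
  proof -
    have p: "pair_cond \<alpha> \<tau> j a b" using h by (rule pair)
    show ?thesis
    proof (cases "\<alpha> ! (a - 1) \<le> \<alpha> ! (b - 1)")
      case True
      moreover have "\<tau> (b, j) \<le> \<tau> (b, j - 1)" using h True by (intro desc) auto
      ultimately show ?thesis using p by (auto simp: pair_cond_def)
    next
      case False
      have "\<tau> (a, j) \<le> \<tau> (a, j - 1)" using h by (intro desc) auto
      moreover have "\<tau> (a, j - 1) \<noteq> \<tau> (b, j - 1)" using h by (intro same) auto
      ultimately show ?thesis using p False by (auto simp: pair_cond_def)
    qed
  qed
  show "non_attacking \<alpha> \<tau>"
    unfolding non_attacking_def
  proof (intro ballI impI)
    fix u v assume uv: "u \<in> dg_hat \<alpha>" "v \<in> dg_hat \<alpha>" "attacking u v"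
    obtain a j b j' where u: "u = (a, j)" and v: "v = (b, j')" by (cases u, cases v)
    have mem: "1 \<le> a" "a \<le> length \<alpha>" "j \<le> \<alpha> ! (a - 1)" "1 \<le> b" "b \<le> length \<alpha>" "j' \<le> \<alpha> ! (b - 1)"
      using uv by (auto simp: u v mem_dg_hat)
    consider "j = j'" "a < b" | "j = j'" "b < a" | "j = j' + 1" "a < b" | "j' = j + 1" "b < a"
      using uv(3) by (auto simp: attacking_def u v neq_iff)
    then show "\<tau> u \<noteq> \<tau> v"
    proof cases
      case 1 then show ?thesis using same[of a b j] mem by (simp add: u v)
    next
      case 2 then show ?thesis using same[of b a j] mem by (simp add: u v)
    next
      case 3 then show ?thesis using cross[of j a b] mem by (simp add: u v)
    next
      case 4 then show ?thesis using cross[of j' b a] mem by (simp add: u v)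
    qed
  qed
  show "coinv_triples \<alpha> \<tau> = {}"
  proof (rule ccontr)
    assume "coinv_triples \<alpha> \<tau> \<noteq> {}"
    then obtain u v w where mem: "u \<in> dg_hat \<alpha>" "v \<in> dg_hat \<alpha>" "w \<in> dg_hat \<alpha>"
      and type: "type1_triple \<alpha> u v w \<or> type2_triple \<alpha> u v w"
      and cyc: "\<tau> u < \<tau> v \<and> \<tau> v < \<tau> w \<or> \<tau> v < \<tau> w \<and> \<tau> w < \<tau> u \<or> \<tau> w < \<tau> u \<and> \<tau> u < \<tau> v"
      by (auto simp: coinv_triples_def)
    obtain a j where uw: "u = (a, j)" "w = (a, j - 1)" "1 \<le> j"
      using type by (auto simp: type1_triple_def type2_triple_def)
    have "\<tau> u \<le> \<tau> w" using mem uw desc[of j a] by (simp add: mem_dg_hat)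
    then have inc: "\<tau> u < \<tau> v" "\<tau> v < \<tau> w" using cyc by auto
    from type show False
    proof
      assume "type1_triple \<alpha> u v w"
      then obtain b where v: "v = (b, j - 1)" "a < b" "\<alpha> ! (b - 1) < \<alpha> ! (a - 1)"
        using uw by (auto simp: type1_triple_def)
      then have "pair_cond \<alpha> \<tau> j a b" using mem uw by (intro pair) (auto simp: mem_dg_hat)
      then show False using inc v uw by (auto simp: pair_cond_def)
    next
      assume "type2_triple \<alpha> u v w"
      then obtain b where v: "v = (b, j)" "b < a" "\<alpha> ! (b - 1) \<le> \<alpha> ! (a - 1)"
        using uw by (auto simp: type2_triple_def)
      then have "pair_cond \<alpha> \<tau> j b a" using mem uw by (intro pair) (auto simp: mem_dg_hat)
      then show False using inc v uw by (auto simp: pair_cond_def)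
    qed
  qed
qed

lemma labellings_iff:
  "\<sigma> \<in> labellings \<mu> la \<longleftrightarrow> \<sigma> \<in> dg (\<mu> @ rev la) \<rightarrow>\<^sub>E {1..} \<and>
     distinct_basement (\<mu> @ rev la) (star \<mu> \<sigma>) \<and> (\<forall>j\<ge>1. row_cond (\<mu> @ rev la) (star \<mu> \<sigma>) j)"
  unfolding labellings_def coinv_eq_0_iff
  using row_cond_if_no_coinv[of "\<mu> @ rev la" "star \<mu> \<sigma>"] no_coinv_if_row_cond[of "\<mu> @ rev la" "star \<mu> \<sigma>"] by blast

text \<open>
  The conditions only compare labels, so an order isomorphism between the labels in use does not
  affect them.
\<close>
lemma row_cond_embedding:
  fixes \<tau> :: "box \<Rightarrow> 'a::linorder" and \<tau>' :: "box \<Rightarrow> 'b::linorder"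
  assumes "\<And>u v. u \<in> dg_hat \<alpha> \<Longrightarrow> v \<in> dg_hat \<alpha> \<Longrightarrow> \<tau> u < \<tau> v \<longleftrightarrow> \<tau>' u < \<tau>' v"
  shows "row_cond \<alpha> \<tau> j \<longleftrightarrow> row_cond \<alpha> \<tau>' j"
proof -
  have le: "\<tau> u \<le> \<tau> v \<longleftrightarrow> \<tau>' u \<le> \<tau>' v" if "u \<in> dg_hat \<alpha>" "v \<in> dg_hat \<alpha>" for u v
    using assms[of v u] that by (metis not_le)
  have eq: "\<tau> u = \<tau> v \<longleftrightarrow> \<tau>' u = \<tau>' v" if "u \<in> dg_hat \<alpha>" "v \<in> dg_hat \<alpha>" for u v
    using le[of v u] le[of u v] that by (metis order.antisym order.refl)
  have pair: "pair_cond \<alpha> \<tau> j a b \<longleftrightarrow> pair_cond \<alpha> \<tau>' j a b"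
    if "1 \<le> a \<and> a < b \<and> b \<le> length \<alpha> \<and> j \<le> \<alpha> ! (a - 1) \<and> j - 1 \<le> \<alpha> ! (b - 1)" for a b
  proof -
    have "(a, j) \<in> dg_hat \<alpha>" "(b, j - 1) \<in> dg_hat \<alpha>" "(a, j - 1) \<in> dg_hat \<alpha>" "j \<le> \<alpha> ! (b - 1) \<Longrightarrow> (b, j) \<in> dg_hat \<alpha>"
      using that by (auto simp: mem_dg_hat)
    then show ?thesis using that by (auto simp: pair_cond_def assms le eq)
  qed
  show ?thesis
    unfolding row_cond_def
    by (intro arg_cong2[of _ _ _ _ "(\<and>)"] all_cong1 imp_cong refl) (auto simp: pair le mem_dg_hat)
qed

definition with_basement :: "nat list \<Rightarrow> nat \<Rightarrow> (box \<Rightarrow> nat) \<Rightarrow> box \<Rightarrow> nat" where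
  "with_basement us r \<sigma> = (\<lambda>(i, j). if j = r then us ! (i - 1) else \<sigma> (i, j))"

text \<open>
  The step from row \<open>j - 1\<close> to row \<open>j\<close> in the format of \<open>filling_sum\<close>. The truncated subtraction gives
  \<open>0\<close> for the columns that end below row \<open>j - 1\<close>.
\<close>
definition row_list :: "nat list \<Rightarrow> (box \<Rightarrow> nat) \<Rightarrow> nat \<Rightarrow> step list" where
  "row_list \<alpha> \<tau> j = map (\<lambda>c. (\<alpha> ! c + 2 - j, if j \<le> Suc (\<alpha> ! c) then \<tau> (Suc c, j - 1) else 0,
     if j \<le> \<alpha> ! c then \<tau> (Suc c, j) else 0)) [0..<length \<alpha>]"

definition row_ok :: "nat list \<Rightarrow> (box \<Rightarrow> nat) \<Rightarrow> nat \<Rightarrow> bool" where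
  "row_ok \<alpha> \<tau> j \<longleftrightarrow> (\<forall>t\<in>set (row_list \<alpha> \<tau> j). step_ok t) \<and> sorted_wrt pair_ok (row_list \<alpha> \<tau> j)"

lemma row_cond_iff_row_ok:
  assumes "1 \<le> j" "\<And>i. (i, j) \<in> dg \<alpha> \<Longrightarrow> 1 \<le> \<tau> (i, j)"
  shows "row_cond \<alpha> \<tau> j \<longleftrightarrow> row_ok \<alpha> \<tau> j"
proof -
  have steps: "(\<forall>t\<in>set (row_list \<alpha> \<tau> j). step_ok t) \<longleftrightarrow>
      (\<forall>c<length \<alpha>. j \<le> \<alpha> ! c \<longrightarrow> \<tau> (Suc c, j) \<le> \<tau> (Suc c, j - 1))"
    using assms(1,2) by (auto simp: row_list_def step_ok_def mem_dg Suc_le_eq)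
  have pairs: "sorted_wrt pair_ok (row_list \<alpha> \<tau> j) \<longleftrightarrow>
      (\<forall>c d. c < d \<and> d < length \<alpha> \<and> j \<le> \<alpha> ! c \<and> j - 1 \<le> \<alpha> ! d \<longrightarrow> pair_cond \<alpha> \<tau> j (Suc c) (Suc d))"
  proof -
    have "pair_ok (row_list \<alpha> \<tau> j ! c) (row_list \<alpha> \<tau> j ! d) \<longleftrightarrow>
        (j \<le> \<alpha> ! c \<and> j - 1 \<le> \<alpha> ! d \<longrightarrow> pair_cond \<alpha> \<tau> j (Suc c) (Suc d))" if "c < d" "d < length \<alpha>" for c d
      using that assms(1) by (auto simp: row_list_def pair_ok_def pair_cond_def)
    then show ?thesis unfolding sorted_wrt_iff_nth_less by (auto simp: row_list_def)
  qed
  have shift1: "(\<forall>c<length \<alpha>. j \<le> \<alpha> ! c \<longrightarrow> \<tau> (Suc c, j) \<le> \<tau> (Suc c, j - 1)) \<longleftrightarrow>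
      (\<forall>a. 1 \<le> a \<and> a \<le> length \<alpha> \<and> j \<le> \<alpha> ! (a - 1) \<longrightarrow> \<tau> (a, j) \<le> \<tau> (a, j - 1))"
    by (metis Suc_diff_1 Suc_le_eq Suc_pred' diff_Suc_1 less_eq_Suc_le One_nat_def zero_less_Suc)
  have shift2: "(\<forall>c d. c < d \<and> d < length \<alpha> \<and> j \<le> \<alpha> ! c \<and> j - 1 \<le> \<alpha> ! d \<longrightarrow> pair_cond \<alpha> \<tau> j (Suc c) (Suc d)) \<longleftrightarrow>
      (\<forall>a b. 1 \<le> a \<and> a < b \<and> b \<le> length \<alpha> \<and> j \<le> \<alpha> ! (a - 1) \<and> j - 1 \<le> \<alpha> ! (b - 1) \<longrightarrow> pair_cond \<alpha> \<tau> j a b)"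
    (is "?l \<longleftrightarrow> ?r")
  proof
    assume l: ?l
    show ?r
    proof (intro allI impI)
      fix a b assume h: "1 \<le> a \<and> a < b \<and> b \<le> length \<alpha> \<and> j \<le> \<alpha> ! (a - 1) \<and> j - 1 \<le> \<alpha> ! (b - 1)"
      then have "a - 1 < b - 1" "b - 1 < length \<alpha>" "Suc (a - 1) = a" "Suc (b - 1) = b" by auto
      then show "pair_cond \<alpha> \<tau> j a b" using l h by metis
    qed
  next
    assume r: ?r
    then show ?l by (metis One_nat_def Suc_le_eq diff_Suc_1 le_add1 not_less_eq plus_1_eq_Suc)
  qed
  show ?thesis unfolding row_cond_def row_ok_def steps pairs shift1 shift2 ..
qed

definition upper_boxes :: "nat list \<Rightarrow> nat \<Rightarrow> box set" where
  "upper_boxes \<alpha> r = {b \<in> dg \<alpha>. r < snd b}"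

definition upper_labellings :: "nat list \<Rightarrow> nat \<Rightarrow> nat list \<Rightarrow> (box \<Rightarrow> nat) set" where
  "upper_labellings \<alpha> r us = {\<sigma> \<in> upper_boxes \<alpha> r \<rightarrow>\<^sub>E {1..}. \<forall>j>r. row_ok \<alpha> (with_basement us r \<sigma>) j}"

definition labelling_monomial :: "nat list \<Rightarrow> nat \<Rightarrow> (box \<Rightarrow> nat) \<Rightarrow> pol" where
  "labelling_monomial \<alpha> r \<sigma> = (\<Prod>b\<in>upper_boxes \<alpha> r. Var (\<sigma> b))"

lemma finite_upper_boxes: "finite (upper_boxes \<alpha> r)"
  by (simp add: upper_boxes_def finite_dg)

lemma mem_upper_boxes:
  "(i, j) \<in> upper_boxes \<alpha> r \<longleftrightarrow> 1 \<le> i \<and> i \<le> length \<alpha> \<and> r < j \<and> j \<le> \<alpha> ! (i - 1)"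
  by (auto simp: upper_boxes_def mem_dg)

definition columns_at :: "nat list \<Rightarrow> nat \<Rightarrow> nat list \<Rightarrow> column list" where
  "columns_at \<alpha> r us = zip (map (\<lambda>a. Suc a - r) \<alpha>) us"

lemma row_list_first:
  assumes "length us = length \<alpha>" "\<And>c. c < length \<alpha> \<Longrightarrow> \<alpha> ! c < r \<Longrightarrow> us ! c = 0"
  shows "map old_column (row_list \<alpha> (with_basement us r \<sigma>) (Suc r)) = columns_at \<alpha> r us"
  using assms by (intro nth_equalityI) (auto simp: row_list_def columns_at_def with_basement_def not_le)

lemma row_list_cong:
  assumes "\<And>c. c < length \<alpha> \<Longrightarrow> j - 1 \<le> \<alpha> ! c \<Longrightarrow> \<tau> (Suc c, j - 1) = \<tau>' (Suc c, j - 1)"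
    "\<And>c. c < length \<alpha> \<Longrightarrow> j \<le> \<alpha> ! c \<Longrightarrow> \<tau> (Suc c, j) = \<tau>' (Suc c, j)"
  shows "row_list \<alpha> \<tau> j = row_list \<alpha> \<tau>' j"
  using assms by (auto simp: row_list_def)

text \<open>
  Splitting a labelling into its lowest row and the rows above it is a bijection, and this is the
  recursion that defines \<open>filling_sum\<close>. The second assumption fits the default label \<open>0\<close> of a missing
  box.
\<close>
lemma upper_labellings_sum:
  assumes "length us = length \<alpha>" "\<And>c. c < length \<alpha> \<Longrightarrow> \<alpha> ! c < r \<Longrightarrow> us ! c = 0" "\<forall>a\<in>set \<alpha>. a \<le> r + n"
  shows "finite (upper_labellings \<alpha> r us) \<and>
    (\<Sum>\<sigma>\<in>upper_labellings \<alpha> r us. labelling_monomial \<alpha> r \<sigma>) = filling_sum n (columns_at \<alpha> r us)"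
  using assms
proof (induction n arbitrary: r us)
  case 0
  have empty: "upper_boxes \<alpha> r = {}"
  proof -
    have False if "(i, j) \<in> upper_boxes \<alpha> r" for i j
    proof -
      have "r < j" "j \<le> \<alpha> ! (i - 1)" "\<alpha> ! (i - 1) \<in> set \<alpha>" using that by (auto simp: mem_upper_boxes)
      then show False using 0(3) by fastforce
    qed
    then show ?thesis by auto
  qed
  have "row_ok \<alpha> \<tau> j" if "r < j" for \<tau> j
  proof -
    have below: "\<alpha> ! c < j" if "c < length \<alpha>" for c
      using 0(3) \<open>r < j\<close> nth_mem[OF that] by fastforce
    have small: "\<not> 2 \<le> fst t \<and> snd (snd t) = 0" if "t \<in> set (row_list \<alpha> \<tau> j)" for t
      using that below by (force simp: row_list_def)
    have "step_ok t" if "t \<in> set (row_list \<alpha> \<tau> j)" for t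
      using small[OF that] by (cases t) (simp add: step_ok_def)
    moreover have "pair_ok s t" if "s \<in> set (row_list \<alpha> \<tau> j)" for s t
      using small[OF that] by (cases s) (simp add: pair_ok_def)
    ultimately show ?thesis
      unfolding row_ok_def sorted_wrt_iff_nth_less by (meson nth_mem order.strict_trans)
  qed
  then have "upper_labellings \<alpha> r us = {\<lambda>_. undefined}"
    by (auto simp: upper_labellings_def empty)
  then show ?case by (simp add: labelling_monomial_def empty)
next
  case (Suc n)
  let ?T = "{ts \<in> row_steps (columns_at \<alpha> r us). sorted_wrt pair_ok ts}"
  let ?v = "map (snd \<circ> snd) :: step list \<Rightarrow> nat list"
  let ?L = "upper_labellings \<alpha> r us"
  let ?first = "\<lambda>\<sigma>. row_list \<alpha> (with_basement us r \<sigma>) (Suc r)"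
  let ?rest = "\<lambda>\<sigma>. restrict \<sigma> (upper_boxes \<alpha> (Suc r))"
  let ?join = "\<lambda>ts \<sigma>. \<lambda>b. if b \<in> upper_boxes \<alpha> r \<and> snd b = Suc r then snd (snd (ts ! (fst b - 1))) else \<sigma> b"
  have T: "length ts = length \<alpha>" "\<And>c. c < length \<alpha> \<Longrightarrow> ts ! c = (Suc (\<alpha> ! c) - r, us ! c, snd (snd (ts ! c)))"
    "\<And>c. c < length \<alpha> \<Longrightarrow> \<alpha> ! c < Suc r \<Longrightarrow> snd (snd (ts ! c)) = 0"
    "\<And>c. c < length \<alpha> \<Longrightarrow> Suc r \<le> \<alpha> ! c \<Longrightarrow> 1 \<le> snd (snd (ts ! c))"
    if "ts \<in> row_steps (columns_at \<alpha> r us)" for ts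
  proof -
    have eq: "map old_column ts = columns_at \<alpha> r us" and ok: "\<And>t. t \<in> set ts \<Longrightarrow> step_ok t"
      using that by (auto simp: row_steps_def)
    show len: "length ts = length \<alpha>" using arg_cong[OF eq, of length] Suc.prems(1) by (simp add: columns_at_def)
    show nth: "ts ! c = (Suc (\<alpha> ! c) - r, us ! c, snd (snd (ts ! c)))" if "c < length \<alpha>" for c
      using arg_cong[OF eq, of "\<lambda>xs. xs ! c"] that len Suc.prems(1)
      by (cases "ts ! c") (simp add: columns_at_def)
    have "step_ok (Suc (\<alpha> ! c) - r, us ! c, snd (snd (ts ! c)))" if "c < length \<alpha>" for c
      using ok[of "ts ! c"] nth[OF that] that len by simp
    then show "snd (snd (ts ! c)) = 0" if "c < length \<alpha>" "\<alpha> ! c < Suc r" for c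
      using that by (fastforce simp: step_ok_def)
    show "1 \<le> snd (snd (ts ! c))" if "c < length \<alpha>" "Suc r \<le> \<alpha> ! c" for c
      using \<open>\<And>c. c < length \<alpha> \<Longrightarrow> step_ok (Suc (\<alpha> ! c) - r, us ! c, snd (snd (ts ! c)))\<close>[OF that(1)] that
      by (auto simp: step_ok_def split: if_splits)
  qed
  have IH: "finite (upper_labellings \<alpha> (Suc r) (?v ts)) \<and>
      (\<Sum>\<sigma>\<in>upper_labellings \<alpha> (Suc r) (?v ts). labelling_monomial \<alpha> (Suc r) \<sigma>) =
      filling_sum n (columns_at \<alpha> (Suc r) (?v ts))" if "ts \<in> ?T" for ts
    using that T[of ts] Suc.prems(3) by (intro Suc.IH) auto
  have firstT: "?first \<sigma> \<in> ?T" if "\<sigma> \<in> ?L" for \<sigma>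
    using that row_list_first[OF Suc.prems(1,2)] by (auto simp: upper_labellings_def row_ok_def row_steps_def)
  have restL: "?rest \<sigma> \<in> upper_labellings \<alpha> (Suc r) (?v (?first \<sigma>))" if "\<sigma> \<in> ?L" for \<sigma>
  proof -
    have rows: "row_list \<alpha> (with_basement (?v (?first \<sigma>)) (Suc r) (?rest \<sigma>)) j = row_list \<alpha> (with_basement us r \<sigma>) j"
      if "Suc r < j" for j
      using that by (intro row_list_cong) (auto simp: with_basement_def row_list_def mem_upper_boxes)
    have old: "row_ok \<alpha> (with_basement us r \<sigma>) j" if "r < j" for j
      using \<open>\<sigma> \<in> ?L\<close> that by (simp add: upper_labellings_def)
    have "row_ok \<alpha> (with_basement (?v (?first \<sigma>)) (Suc r) (?rest \<sigma>)) j" if "Suc r < j" for j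
      using old[OF Suc_lessD[OF that]]
      unfolding row_ok_def rows[OF that] .
    moreover have "?rest \<sigma> \<in> upper_boxes \<alpha> (Suc r) \<rightarrow>\<^sub>E {1..}"
      using \<open>\<sigma> \<in> ?L\<close> by (auto simp: upper_labellings_def upper_boxes_def PiE_iff)
    ultimately show ?thesis unfolding upper_labellings_def by blast
  qed
  have joinL: "?join ts \<sigma> \<in> ?L" and first_join: "?first (?join ts \<sigma>) = ts" and rest_join: "?rest (?join ts \<sigma>) = \<sigma>"
    if ts: "ts \<in> ?T" and \<sigma>: "\<sigma> \<in> upper_labellings \<alpha> (Suc r) (?v ts)" for ts \<sigma>
  proof -
    have ts': "ts \<in> row_steps (columns_at \<alpha> r us)" using ts by simp
    note tT = T[OF ts']
    show first: "?first (?join ts \<sigma>) = ts"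
    proof (rule nth_equalityI)
      show "length (?first (?join ts \<sigma>)) = length ts" using tT(1) by (simp add: row_list_def)
      fix c assume "c < length (?first (?join ts \<sigma>))"
      then have c: "c < length \<alpha>" by (simp add: row_list_def)
      have "?first (?join ts \<sigma>) ! c = (Suc (\<alpha> ! c) - r, us ! c, snd (snd (ts ! c)))"
        using c tT(3)[OF c] Suc.prems(2)[OF c] by (auto simp: row_list_def with_basement_def mem_upper_boxes)
      then show "?first (?join ts \<sigma>) ! c = ts ! c" using tT(2)[OF c] by simp
    qed
    show "?rest (?join ts \<sigma>) = \<sigma>"
      using \<sigma> by (auto simp: fun_eq_iff restrict_def upper_labellings_def PiE_iff extensional_def mem_upper_boxes)
    have rows: "row_list \<alpha> (with_basement us r (?join ts \<sigma>)) j = row_list \<alpha> (with_basement (?v ts) (Suc r) \<sigma>) j"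
      if "Suc r < j" for j
      using that tT(1) by (intro row_list_cong) (auto simp: with_basement_def mem_upper_boxes)
    have "row_ok \<alpha> (with_basement us r (?join ts \<sigma>)) j" if "r < j" for j
    proof (cases "j = Suc r")
      case True
      then show ?thesis using ts unfolding row_ok_def True first by (simp add: row_steps_def)
    next
      case False
      then have j: "Suc r < j" using that by simp
      have "row_ok \<alpha> (with_basement (?v ts) (Suc r) \<sigma>) j"
        using \<sigma> j unfolding upper_labellings_def by blast
      then show ?thesis unfolding row_ok_def rows[OF j] .
    qed
    moreover have "?join ts \<sigma> \<in> upper_boxes \<alpha> r \<rightarrow>\<^sub>E {1..}"
      using \<sigma> tT(4) by (auto simp: upper_labellings_def PiE_iff extensional_def mem_upper_boxes)
    ultimately show "?join ts \<sigma> \<in> ?L" by (simp add: upper_labellings_def)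
  qed
  have join_rest: "?join (?first \<sigma>) (?rest \<sigma>) = \<sigma>" if "\<sigma> \<in> ?L" for \<sigma>
  proof
    fix b :: box
    obtain i j where b: "b = (i, j)" by (cases b)
    show "?join (?first \<sigma>) (?rest \<sigma>) b = \<sigma> b"
    proof (cases "b \<in> upper_boxes \<alpha> r")
      case True
      then show ?thesis
        by (auto simp: b mem_upper_boxes row_list_def with_basement_def)
    next
      case False
      then have "\<sigma> b = undefined" using that unfolding upper_labellings_def PiE_def extensional_def by blast
      then show ?thesis using False by (auto simp: b mem_upper_boxes)
    qed
  qed
  have mono: "labelling_monomial \<alpha> r \<sigma> = weight (?first \<sigma>) * labelling_monomial \<alpha> (Suc r) (?rest \<sigma>)" for \<sigma>
  proof -
    let ?R = "(\<lambda>c. (Suc c, Suc r)) ` {c. c < length \<alpha> \<and> Suc r \<le> \<alpha> ! c}"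
    have R: "upper_boxes \<alpha> r = ?R \<union> upper_boxes \<alpha> (Suc r)"
    proof (intro set_eqI)
      fix b :: box
      obtain i j where b: "b = (i, j)" by (cases b)
      have "(i, j) \<in> ?R \<longleftrightarrow> 1 \<le> i \<and> i \<le> length \<alpha> \<and> j = Suc r \<and> Suc r \<le> \<alpha> ! (i - 1)"
        by (cases i) (auto simp: image_iff)
      then show "b \<in> upper_boxes \<alpha> r \<longleftrightarrow> b \<in> ?R \<union> upper_boxes \<alpha> (Suc r)"
        unfolding b by (auto simp: mem_upper_boxes)
    qed
    have "labelling_monomial \<alpha> r \<sigma> = (\<Prod>b\<in>?R. Var (\<sigma> b)) * (\<Prod>b\<in>upper_boxes \<alpha> (Suc r). Var (\<sigma> b))"
      unfolding labelling_monomial_def R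
      by (intro prod.union_disjoint) (auto simp: finite_upper_boxes mem_upper_boxes)
    moreover have "(\<Prod>b\<in>?R. Var (\<sigma> b)) = weight (?first \<sigma>)"
    proof -
      have "weight (?first \<sigma>) = (\<Prod>c<length \<alpha>. if Suc r \<le> \<alpha> ! c then Var (\<sigma> (Suc c, Suc r)) else 1)"
        unfolding weight_def row_list_def
        by (simp add: comp_def prod.list_conv_set_nth atLeast0LessThan with_basement_def Suc_diff_le cong: if_cong)
          (intro prod.cong refl, auto)
      also have "\<dots> = (\<Prod>c\<in>{c \<in> {..<length \<alpha>}. Suc r \<le> \<alpha> ! c}. Var (\<sigma> (Suc c, Suc r)))"
        by (rule prod.inter_filter[symmetric]) simp
      also have "\<dots> = (\<Prod>b\<in>?R. Var (\<sigma> b))"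
        by (subst prod.reindex) (auto simp: inj_on_def)
      finally show ?thesis by simp
    qed
    ultimately show ?thesis by (simp add: labelling_monomial_def)
  qed
  let ?S = "SIGMA ts:?T. upper_labellings \<alpha> (Suc r) (?v ts)"
  have bij: "bij_betw (\<lambda>\<sigma>. (?first \<sigma>, ?rest \<sigma>)) ?L ?S"
  proof (rule bij_betw_byWitness[where f' = "\<lambda>(ts, \<sigma>). ?join ts \<sigma>"])
    show "\<forall>\<sigma>\<in>?L. (case (?first \<sigma>, ?rest \<sigma>) of (ts, \<sigma>) \<Rightarrow> ?join ts \<sigma>) = \<sigma>"
      unfolding prod.case using join_rest by blast
    show "\<forall>p\<in>?S. (?first (case p of (ts, \<sigma>) \<Rightarrow> ?join ts \<sigma>), ?rest (case p of (ts, \<sigma>) \<Rightarrow> ?join ts \<sigma>)) = p"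
    proof
      fix p assume "p \<in> ?S"
      then obtain ts \<sigma> where p: "p = (ts, \<sigma>)" and ts: "ts \<in> ?T" "\<sigma> \<in> upper_labellings \<alpha> (Suc r) (?v ts)"
        by blast
      show "(?first (case p of (ts, \<sigma>) \<Rightarrow> ?join ts \<sigma>), ?rest (case p of (ts, \<sigma>) \<Rightarrow> ?join ts \<sigma>)) = p"
        unfolding p prod.case first_join[OF ts] rest_join[OF ts] ..
    qed
    show "(\<lambda>\<sigma>. (?first \<sigma>, ?rest \<sigma>)) ` ?L \<subseteq> ?S" using firstT restL by blast
    show "(\<lambda>(ts, \<sigma>). ?join ts \<sigma>) ` ?S \<subseteq> ?L"
    proof (rule image_subsetI)
      fix p assume "p \<in> ?S"
      then obtain ts \<sigma> where p: "p = (ts, \<sigma>)" and ts: "ts \<in> ?T" "\<sigma> \<in> upper_labellings \<alpha> (Suc r) (?v ts)"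
        by blast
      show "(case p of (ts, \<sigma>) \<Rightarrow> ?join ts \<sigma>) \<in> ?L"
        unfolding p prod.case using ts by (rule joinL)
    qed
  qed
  have finT: "finite ?T" by simp
  have finS: "finite ?S"
    by (rule finite_SigmaI[OF finT]) (use IH in blast)
  have fin: "finite ?L" using bij_betw_finite[OF bij] finS by blast
  have "(\<Sum>\<sigma>\<in>?L. labelling_monomial \<alpha> r \<sigma>) = (\<Sum>(ts, \<sigma>)\<in>?S. weight ts * labelling_monomial \<alpha> (Suc r) \<sigma>)"
    using sum.reindex_bij_betw[OF bij, of "\<lambda>(ts, \<sigma>). weight ts * labelling_monomial \<alpha> (Suc r) \<sigma>"]
    by (simp only: prod.case mono)
  also have "\<dots> = (\<Sum>ts\<in>?T. \<Sum>\<sigma>\<in>upper_labellings \<alpha> (Suc r) (?v ts). weight ts * labelling_monomial \<alpha> (Suc r) \<sigma>)"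
    using finT IH by (intro sum.Sigma[symmetric]) blast+
  also have "\<dots> = (\<Sum>ts\<in>?T. weight ts * filling_sum n (map new_column ts))"
  proof (intro sum.cong refl)
    fix ts assume ts: "ts \<in> ?T"
    have "map new_column ts = columns_at \<alpha> (Suc r) (?v ts)"
    proof (rule nth_equalityI)
      fix c assume "c < length (map new_column ts)"
      then have c: "c < length \<alpha>" "c < length ts" using T(1)[of ts] ts by simp_all
      then show "map new_column ts ! c = columns_at \<alpha> (Suc r) (?v ts) ! c"
        using T(2)[of ts c] ts by (cases "ts ! c") (auto simp: columns_at_def)
    qed (use T(1)[of ts] ts in \<open>simp add: columns_at_def\<close>)
    then show "(\<Sum>\<sigma>\<in>upper_labellings \<alpha> (Suc r) (?v ts). weight ts * labelling_monomial \<alpha> (Suc r) \<sigma>) =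
        weight ts * filling_sum n (map new_column ts)"
      using IH[OF ts] by (simp add: sum_distrib_left[symmetric])
  qed
  also have "\<dots> = filling_sum (Suc n) (columns_at \<alpha> r us)"
    by (simp add: sum.inter_filter)
  finally show ?case using fin by simp
qed

lemma lookup_label_content: "lookup (label_content \<alpha> \<sigma>) i = card {u \<in> dg \<alpha>. \<sigma> u = i}"
proof -
  have "{i. card {u \<in> dg \<alpha>. \<sigma> u = i} \<noteq> 0} \<subseteq> \<sigma> ` dg \<alpha>"
  proof
    fix i assume "i \<in> {i. card {u \<in> dg \<alpha>. \<sigma> u = i} \<noteq> 0}"
    then have "{u \<in> dg \<alpha>. \<sigma> u = i} \<noteq> {}" by force
    then show "i \<in> \<sigma> ` dg \<alpha>" by blast
  qed
  then have "finite {i. card {u \<in> dg \<alpha>. \<sigma> u = i} \<noteq> 0}"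
    using finite_dg finite_surj by blast
  then show ?thesis unfolding label_content_def by (rule lookup_Abs_poly_mapping[THEN fun_cong])
qed

lemma label_in_keys:
  assumes "u \<in> dg \<alpha>"
  shows "\<sigma> u \<in> keys (label_content \<alpha> \<sigma>)"
proof -
  have "finite {v \<in> dg \<alpha>. \<sigma> v = \<sigma> u}" using finite_dg by simp
  moreover have "u \<in> {v \<in> dg \<alpha>. \<sigma> v = \<sigma> u}" using assms by simp
  ultimately have "card {v \<in> dg \<alpha>. \<sigma> v = \<sigma> u} \<noteq> 0" by (metis card_0_eq empty_iff)
  then show ?thesis by (simp only: in_keys_iff lookup_label_content not_False_eq_True)
qed

lemma key_is_label:
  assumes "i \<in> keys (label_content \<alpha> \<sigma>)"
  obtains u where "u \<in> dg \<alpha>" "\<sigma> u = i"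
proof -
  have "card {u \<in> dg \<alpha>. \<sigma> u = i} \<noteq> 0" using assms by (simp add: in_keys_iff lookup_label_content)
  then have "{u \<in> dg \<alpha>. \<sigma> u = i} \<noteq> {}" by force
  then show ?thesis using that by blast
qed

lemma upper_boxes_0: "upper_boxes \<alpha> 0 = dg \<alpha>"
  by (auto simp: upper_boxes_def dg_def)

lemma labelling_monomial_eq_single: "labelling_monomial \<alpha> 0 \<sigma> = single (label_content \<alpha> \<sigma>) 1"
proof -
  have "(\<Prod>b\<in>A. Var (\<sigma> b)) = single (\<Sum>b\<in>A. single (\<sigma> b) 1) 1" if "finite A" for A
    using that by (induction A) (auto simp: Var_def mult_single)
  moreover have "(\<Sum>b\<in>dg \<alpha>. single (\<sigma> b) 1) = label_content \<alpha> \<sigma>"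
  proof (rule poly_mapping_eqI)
    fix i
    have "lookup (\<Sum>b\<in>dg \<alpha>. single (\<sigma> b) (1::nat)) i = (\<Sum>b\<in>dg \<alpha>. if \<sigma> b = i then 1 else 0)"
      unfolding lookup_sum by (intro sum.cong refl) (simp add: lookup_single when_def)
    also have "\<dots> = card {b \<in> dg \<alpha>. \<sigma> b = i}"
      using finite_dg by (simp flip: sum.inter_filter)
    finally show "lookup (\<Sum>b\<in>dg \<alpha>. single (\<sigma> b) 1) i = lookup (label_content \<alpha> \<sigma>) i"
      by (simp only: lookup_label_content)
  qed
  ultimately show ?thesis by (simp add: labelling_monomial_def upper_boxes_0 finite_dg)
qed

lemma lookup_filling_sum:
  assumes "length us = length \<alpha>" "\<forall>a\<in>set \<alpha>. a \<le> n"
  shows "lookup (filling_sum n (zip (map Suc \<alpha>) us)) m =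
    of_nat (card {\<sigma> \<in> upper_labellings \<alpha> 0 us. label_content \<alpha> \<sigma> = m})"
proof -
  note sum = upper_labellings_sum[of us \<alpha> 0 n]
  have "finite (upper_labellings \<alpha> 0 us)" using sum assms by simp
  have "filling_sum n (zip (map Suc \<alpha>) us) = (\<Sum>\<sigma>\<in>upper_labellings \<alpha> 0 us. single (label_content \<alpha> \<sigma>) 1)"
    using sum assms by (simp add: columns_at_def labelling_monomial_eq_single)
  then have "lookup (filling_sum n (zip (map Suc \<alpha>) us)) m =
      (\<Sum>\<sigma>\<in>upper_labellings \<alpha> 0 us. if label_content \<alpha> \<sigma> = m then 1 else 0)"
    by (simp add: lookup_sum lookup_single when_def)
  also have "\<dots> = (\<Sum>\<sigma>\<in>{\<sigma> \<in> upper_labellings \<alpha> 0 us. label_content \<alpha> \<sigma> = m}. 1)"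
    by (rule sum.inter_filter[symmetric]) fact
  finally show ?thesis by simp
qed

definition schur_series :: "nat list \<Rightarrow> nat list \<Rightarrow> series" where
  "schur_series \<mu> la m = of_nat (card {\<sigma> \<in> labellings \<mu> la. label_content (\<mu> @ rev la) \<sigma> = m})"

text \<open>
  The basement with \<open>N + 1, N + 2, \<dots>\<close> in place of \<open>\<omega>, \<omega> + 1, \<dots>\<close>.
\<close>
definition large_basement :: "nat \<Rightarrow> nat \<Rightarrow> nat \<Rightarrow> nat list" where
  "large_basement k N l = [1..<Suc k] @ [Suc N..<Suc N + l]"

lemma labellings_eq_upper_labellings:
  assumes N: "length \<mu> \<le> N" "keys m \<subseteq> {..N}"
  shows "{\<sigma> \<in> labellings \<mu> la. label_content (\<mu> @ rev la) \<sigma> = m} =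
    {\<sigma> \<in> upper_labellings (\<mu> @ rev la) 0 (large_basement (length \<mu>) N (length la)).
      label_content (\<mu> @ rev la) \<sigma> = m}"
proof -
  let ?\<alpha> = "\<mu> @ rev la" and ?us = "large_basement (length \<mu>) N (length la)"
  have "\<sigma> \<in> labellings \<mu> la \<longleftrightarrow> \<sigma> \<in> upper_labellings ?\<alpha> 0 ?us" if content: "label_content ?\<alpha> \<sigma> = m" for \<sigma>
  proof (cases "\<sigma> \<in> dg ?\<alpha> \<rightarrow>\<^sub>E {1..}")
    case True
    \<comment> \<open>The map \<open>\<omega> + b \<mapsto> N + 1 + b\<close> preserves the order as long as the finite labels are at most \<open>N\<close>.\<close>
    define \<psi> where "\<psi> x = (case x of Fin a \<Rightarrow> a | Omega b \<Rightarrow> Suc N + b)" for x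
    have small: "\<sigma> u \<le> N" if "u \<in> dg ?\<alpha>" for u
      using label_in_keys[OF that, of \<sigma>] content N by auto
    have \<psi>: "with_basement ?us 0 \<sigma> u = \<psi> (star \<mu> \<sigma> u)" "\<And>a. star \<mu> \<sigma> u = Fin a \<Longrightarrow> a \<le> N" if "u \<in> dg_hat ?\<alpha>" for u
    proof -
      obtain i j where u: "u = (i, j)" by (cases u)
      have i: "1 \<le> i" "i \<le> length \<mu> + length la" using that by (auto simp: u mem_dg_hat)
      have base: "?us ! (i - 1) = (if i \<le> length \<mu> then i else Suc N + (i - length \<mu> - 1))"
        using i by (auto simp: large_basement_def nth_append simp del: upt_Suc)
      show "with_basement ?us 0 \<sigma> u = \<psi> (star \<mu> \<sigma> u)"
        using base by (simp add: u with_basement_def star_def \<psi>_def)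
      show "a \<le> N" if "star \<mu> \<sigma> u = Fin a" for a
      proof (cases "j = 0")
        case True
        then show ?thesis using that N by (auto simp: u star_def split: if_splits)
      next
        case False
        then have "u \<in> dg ?\<alpha>" using \<open>u \<in> dg_hat ?\<alpha>\<close> by (auto simp: u mem_dg_hat mem_dg)
        then show ?thesis using small[of u] that False by (simp add: u star_def)
      qed
    qed
    have mono: "star \<mu> \<sigma> u < star \<mu> \<sigma> v \<longleftrightarrow> with_basement ?us 0 \<sigma> u < with_basement ?us 0 \<sigma> v"
      if "u \<in> dg_hat ?\<alpha>" "v \<in> dg_hat ?\<alpha>" for u v
      using \<psi>[OF that(1)] \<psi>[OF that(2)]
      by (cases "star \<mu> \<sigma> u"; cases "star \<mu> \<sigma> v") (auto simp: \<psi>_def less_label_def)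
    have "row_cond ?\<alpha> (star \<mu> \<sigma>) j \<longleftrightarrow> row_ok ?\<alpha> (with_basement ?us 0 \<sigma>) j" if "1 \<le> j" for j
    proof -
      have "row_cond ?\<alpha> (star \<mu> \<sigma>) j \<longleftrightarrow> row_cond ?\<alpha> (with_basement ?us 0 \<sigma>) j"
        using mono by (rule row_cond_embedding)
      also have "\<dots> \<longleftrightarrow> row_ok ?\<alpha> (with_basement ?us 0 \<sigma>) j"
      proof (rule row_cond_iff_row_ok[OF that])
        fix i assume "(i, j) \<in> dg ?\<alpha>"
        then show "1 \<le> with_basement ?us 0 \<sigma> (i, j)"
          using True that by (auto simp: with_basement_def)
      qed
      finally show ?thesis .
    qed
    moreover have "distinct_basement ?\<alpha> (star \<mu> \<sigma>)"
      by (auto simp: distinct_basement_def star_def)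
    ultimately show ?thesis
      using True unfolding labellings_iff upper_labellings_def upper_boxes_0
      by (simp add: Suc_le_eq)
  next
    case False
    then show ?thesis unfolding labellings_iff upper_labellings_def upper_boxes_0 by blast
  qed
  then show ?thesis by blast
qed

lemma filling_sum_drop_zeros:
  assumes "\<forall>c\<in>set L. snd c < b"
  shows "filling_sum n (L @ shape_columns b (replicate z 0) @ R) = filling_sum n (L @ R)"
  using assms
proof (induction z arbitrary: b)
  case (Suc z)
  have "filling_sum n (L @ shape_columns b (replicate (Suc z) 0) @ R) =
      filling_sum n (L @ shape_columns (Suc b) (replicate z 0) @ R)"
    using filling_sum_drop_column[of 1 L b n "shape_columns (Suc b) (replicate z 0) @ R"] Suc.prems
    by (simp add: shape_columns_Cons)
  also have "\<dots> = filling_sum n (L @ R)" using Suc.prems by (intro Suc.IH) auto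
  finally show ?case .
qed (simp add: shape_columns_def)

lemma key_sum_zeros:
  assumes "length \<mu> \<le> N"
  shows "key_sum (\<mu> @ replicate (N - length \<mu>) 0 @ rev la) =
    filling_sum (sum_list (\<mu> @ rev la)) (zip (map Suc (\<mu> @ rev la)) (large_basement (length \<mu>) N (length la)))"
proof -
  have "\<forall>c\<in>set (shape_columns 1 \<mu>). snd c < Suc (length \<mu>)"
  proof
    fix c assume "c \<in> set (shape_columns 1 \<mu>)"
    then have "snd c \<in> set [1..<1 + length \<mu>]" by (metis image_eqI list.set_map snd_shape_columns)
    then show "snd c < Suc (length \<mu>)" by (simp del: upt_Suc)
  qed
  moreover have "shape_columns 1 (\<mu> @ replicate (N - length \<mu>) 0 @ rev la) =
      shape_columns 1 \<mu> @ shape_columns (Suc (length \<mu>)) (replicate (N - length \<mu>) 0) @ shape_columns (Suc N) (rev la)"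
    using assms by (simp add: shape_columns_append)
  moreover have "zip (map Suc (\<mu> @ rev la)) (large_basement (length \<mu>) N (length la)) =
      shape_columns 1 \<mu> @ shape_columns (Suc N) (rev la)"
    by (simp add: large_basement_def shape_columns_def del: upt_Suc)
  moreover have "sum_list (\<mu> @ replicate (N - length \<mu>) 0 @ rev la) = sum_list (\<mu> @ rev la)"
    by (simp add: sum_list_replicate)
  ultimately show ?thesis unfolding key_sum_def by (simp only: filling_sum_drop_zeros)
qed

theorem schur_series_coeff:
  assumes "length \<mu> \<le> N" "keys m \<subseteq> {..N}"
  shows "schur_series \<mu> la m = lookup (key_sum (\<mu> @ replicate (N - length \<mu>) 0 @ rev la)) m"
proof -
  have "length (large_basement (length \<mu>) N (length la)) = length (\<mu> @ rev la)"
    by (simp add: large_basement_def del: upt_Suc)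
  moreover have "\<forall>a\<in>set (\<mu> @ rev la). a \<le> sum_list (\<mu> @ rev la)"
    using member_le_sum_list by blast
  ultimately show ?thesis
    unfolding schur_series_def key_sum_zeros[OF assms(1)] labellings_eq_upper_labellings[OF assms]
    by (rule lookup_filling_sum[symmetric])
qed

lemma schur_series_Nil: "schur_series \<mu> [] = lookup (key_sum \<mu>)"
proof
  fix m :: mon
  define N where "N = Max (insert (length \<mu>) (keys m))"
  have N: "length \<mu> \<le> N" "keys m \<subseteq> {..N}" by (auto simp: N_def)
  have "key_sum (\<mu> @ replicate (N - length \<mu>) 0 @ rev []) = key_sum \<mu>"
    unfolding key_sum_zeros[OF N(1)] by (simp add: key_sum_def shape_columns_def large_basement_def del: upt_Suc)
  then show "schur_series \<mu> [] m = lookup (key_sum \<mu>) m"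
    using schur_series_coeff[OF N, of "[]"] by simp
qed

lemma schur_series_labelling:
  assumes "schur_series \<mu> la m \<noteq> 0"
  obtains \<sigma> where "\<sigma> \<in> labellings \<mu> la" "label_content (\<mu> @ rev la) \<sigma> = m"
proof -
  have "{\<sigma> \<in> labellings \<mu> la. label_content (\<mu> @ rev la) \<sigma> = m} \<noteq> {}"
    using assms unfolding schur_series_def by (metis card.empty of_nat_0)
  then show ?thesis using that by blast
qed

lemma schur_series_positive_keys:
  assumes "schur_series \<mu> la m \<noteq> 0"
  shows "0 \<notin> keys m"
proof
  assume "0 \<in> keys m"
  obtain \<sigma> where \<sigma>: "\<sigma> \<in> labellings \<mu> la" "label_content (\<mu> @ rev la) \<sigma> = m"
    using schur_series_labelling[OF assms] .
  then obtain u where "u \<in> dg (\<mu> @ rev la)" "\<sigma> u = 0"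
    using key_is_label \<open>0 \<in> keys m\<close> by blast
  then show False using \<sigma>(1) by (auto simp: labellings_def PiE_iff)
qed

lemma schur_series_degree:
  assumes "schur_series \<mu> la m \<noteq> 0"
  shows "mon_degree m \<le> card (dg (\<mu> @ rev la))"
proof -
  obtain \<sigma> where \<sigma>: "label_content (\<mu> @ rev la) \<sigma> = m"
    using schur_series_labelling[OF assms] .
  have "mon_degree m = (\<Sum>i\<in>keys m. card {u \<in> dg (\<mu> @ rev la). \<sigma> u = i})"
    unfolding mon_degree_def \<sigma>[symmetric] lookup_label_content ..
  also have "\<dots> = card (\<Union>i\<in>keys m. {u \<in> dg (\<mu> @ rev la). \<sigma> u = i})"
    using finite_dg by (intro card_UN_disjoint[symmetric]) auto
  also have "\<dots> \<le> card (dg (\<mu> @ rev la))"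
    using finite_dg by (intro card_mono) auto
  finally show ?thesis .
qed

lemma finite_labellings_with_content: "finite {\<sigma> \<in> labellings \<mu> la. label_content (\<mu> @ rev la) \<sigma> = m}"
proof (rule finite_subset)
  show "{\<sigma> \<in> labellings \<mu> la. label_content (\<mu> @ rev la) \<sigma> = m} \<subseteq> dg (\<mu> @ rev la) \<rightarrow>\<^sub>E keys m"
  proof
    fix \<sigma> assume "\<sigma> \<in> {\<sigma> \<in> labellings \<mu> la. label_content (\<mu> @ rev la) \<sigma> = m}"
    then have \<sigma>: "\<sigma> \<in> dg (\<mu> @ rev la) \<rightarrow>\<^sub>E {1..}" "label_content (\<mu> @ rev la) \<sigma> = m"
      by (auto simp: labellings_def)
    show "\<sigma> \<in> dg (\<mu> @ rev la) \<rightarrow>\<^sub>E keys m"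
      using \<sigma>(1) label_in_keys[of _ "\<mu> @ rev la" \<sigma>] unfolding \<sigma>(2) PiE_iff by blast
  qed
  show "finite (dg (\<mu> @ rev la) \<rightarrow>\<^sub>E keys m)"
    by (intro finite_PiE finite_dg) simp
qed

lemma has_formal_sum_schur_series:
  "has_formal_sum (x_pow (\<mu> @ rev la)) (labellings \<mu> la) (schur_series \<mu> la)"
  unfolding has_formal_sum_def
proof
  fix m
  let ?A = "{\<sigma> \<in> labellings \<mu> la. label_content (\<mu> @ rev la) \<sigma> = m}"
  have eq: "{\<sigma> \<in> labellings \<mu> la. x_pow (\<mu> @ rev la) \<sigma> m \<noteq> 0} = ?A"
    by (auto simp: x_pow_def lookup_single when_def)
  have "(\<Sum>\<sigma>\<in>?A. x_pow (\<mu> @ rev la) \<sigma> m) = (\<Sum>\<sigma>\<in>?A. 1)"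
    by (intro sum.cong refl) (simp add: x_pow_def)
  then show "finite {\<sigma> \<in> labellings \<mu> la. x_pow (\<mu> @ rev la) \<sigma> m \<noteq> 0} \<and>
      schur_series \<mu> la m = (\<Sum>\<sigma>\<in>{\<sigma> \<in> labellings \<mu> la. x_pow (\<mu> @ rev la) \<sigma> m \<noteq> 0}. x_pow (\<mu> @ rev la) \<sigma> m)"
    unfolding eq schur_series_def using finite_labellings_with_content by simp
qed

section \<open>Almost symmetric functions\<close>

lemma mon_degree_eq_sum: "finite A \<Longrightarrow> keys m \<subseteq> A \<Longrightarrow> mon_degree m = (\<Sum>i\<in>A. lookup m i)"
  unfolding mon_degree_def by (rule sum.mono_neutral_left) (auto simp: in_keys_iff)

lemma mon_degree_add: "mon_degree (a + b) = mon_degree a + mon_degree b"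
proof -
  let ?A = "keys a \<union> keys b"
  have "mon_degree (a + b) = (\<Sum>i\<in>?A. lookup (a + b) i)"
    by (rule mon_degree_eq_sum) (auto simp: keys_add_mon)
  then show ?thesis
    using mon_degree_eq_sum[of ?A a] mon_degree_eq_sum[of ?A b] by (simp add: lookup_add sum.distrib)
qed

lemma finite_bounded_monomials:
  assumes "finite A"
  shows "finite {m. keys m \<subseteq> A \<and> mon_degree m \<le> d}"
proof (rule finite_imageD[where f = lookup])
  have "lookup ` {m. keys m \<subseteq> A \<and> mon_degree m \<le> d} \<subseteq>
      {f. \<forall>x. (x \<in> A \<longrightarrow> f x \<in> {..d}) \<and> (x \<notin> A \<longrightarrow> f x = 0)}"
  proof clarify
    fix m :: mon and x assume m: "keys m \<subseteq> A" "mon_degree m \<le> d"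
    have "lookup m x \<le> mon_degree m"
      unfolding mon_degree_def
      by (cases "x \<in> keys m") (auto simp: in_keys_iff intro: member_le_sum)
    then show "(x \<in> A \<longrightarrow> lookup m x \<in> {..d}) \<and> (x \<notin> A \<longrightarrow> lookup m x = 0)"
      using m by (auto simp: in_keys_iff)
  qed
  then show "finite (lookup ` {m. keys m \<subseteq> A \<and> mon_degree m \<le> d})"
    using finite_set_of_finite_funs[OF assms finite_atMost[of d], of 0] by (rule finite_subset)
  show "inj_on lookup {m. keys m \<subseteq> A \<and> mon_degree m \<le> d}"
    unfolding inj_on_def poly_mapping_eq_iff by blast
qed

lemma finite_decompositions: "finite {(a, b). a + b = (m :: mon)}"
proof -
  let ?B = "{a. keys a \<subseteq> keys m \<and> mon_degree a \<le> mon_degree m}"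
  have "{(a, b). a + b = m} \<subseteq> ?B \<times> ?B" by (auto simp: keys_add_mon mon_degree_add)
  then show ?thesis by (rule finite_subset) (intro finite_cartesian_product finite_bounded_monomials finite_keys)
qed

lemma series_mult_nonzero:
  assumes "series_mult f g m \<noteq> 0"
  obtains a b where "a + b = m" "f a \<noteq> 0" "g b \<noteq> 0"
proof -
  have "\<exists>x\<in>{(a, b). a + b = m}. (case x of (a, b) \<Rightarrow> f a * g b) \<noteq> 0"
    using assms unfolding series_mult_def by (rule contrapos_np) (simp add: sum.neutral)
  then show ?thesis using that by auto
qed

text \<open>
  These two properties are what makes the truncations of an almost symmetric function meaningful and
  lets them determine it: a truncation of unbounded degree would not be a polynomial, and \<open>x\<^sub>0\<close> is
  invisible in all truncations.
\<close>
lemma P_as_bounded: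
  assumes "f \<in> P_as"
  shows "\<exists>d. \<forall>m. f m \<noteq> 0 \<longrightarrow> 0 \<notin> keys m \<and> mon_degree m \<le> d"
proof -
  obtain k N p g where pg: "\<forall>i<N. p i \<in> polys k \<and> g i \<in> Sym_fun k"
    and f: "f = (\<lambda>m. \<Sum>i<N::nat. series_mult (lookup (p i)) (g i) m)"
    using assms unfolding P_as_def P_plus_def by blast
  have "\<forall>i\<in>{..<N}. \<exists>d. \<forall>m. g i m \<noteq> 0 \<longrightarrow> mon_degree m \<le> d"
    using pg by (auto simp: Sym_fun_def)
  then obtain D where D: "\<And>i m. i < N \<Longrightarrow> g i m \<noteq> 0 \<Longrightarrow> mon_degree m \<le> D i"
    by (metis lessThan_iff)
  define E where "E i = Max (insert 0 (mon_degree ` keys (p i)))" for i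
  have E: "lookup (p i) a \<noteq> 0 \<Longrightarrow> mon_degree a \<le> E i" for i a
    unfolding E_def by (intro Max_ge) (auto simp: in_keys_iff)
  have "0 \<notin> keys m \<and> mon_degree m \<le> (\<Sum>i<N. E i + D i)" if "f m \<noteq> 0" for m
  proof -
    have "\<exists>i\<in>{..<N}. series_mult (lookup (p i)) (g i) m \<noteq> 0"
      using that unfolding f by (rule contrapos_np) (simp add: sum.neutral)
    then obtain i where i: "i < N" "series_mult (lookup (p i)) (g i) m \<noteq> 0" by blast
    obtain a b where ab: "a + b = m" "lookup (p i) a \<noteq> 0" "g i b \<noteq> 0"
      using series_mult_nonzero[OF i(2)] .
    have "keys a \<subseteq> {1..k}" using pg i(1) ab(2) by (auto simp: polys_def in_keys_iff)
    moreover have "keys b \<subseteq> {k<..}" using pg i(1) ab(3) by (auto simp: Sym_fun_def)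
    ultimately have "0 \<notin> keys m" unfolding ab(1)[symmetric] keys_add_mon by fastforce
    moreover have "mon_degree m \<le> E i + D i"
      using E[OF ab(2)] D[OF i(1) ab(3)] unfolding ab(1)[symmetric] mon_degree_add by simp
    moreover have "E i + D i \<le> (\<Sum>i<N. E i + D i)"
      using i(1) by (intro member_le_sum) auto
    ultimately show ?thesis by linarith
  qed
  then show ?thesis by blast
qed

lemma lookup_trunc_vars_bounded:
  assumes "\<And>m. f m \<noteq> 0 \<Longrightarrow> mon_degree m \<le> d"
  shows "lookup (trunc_vars n f) m = (if keys m \<subseteq> {1..n} then f m else 0)"
proof (rule lookup_trunc_vars, rule finite_subset)
  show "{m. keys m \<subseteq> {1..n} \<and> f m \<noteq> 0} \<subseteq> {m. keys m \<subseteq> {1..n} \<and> mon_degree m \<le> d}"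
    using assms by auto
qed (rule finite_bounded_monomials, simp)

lemma P_as_eqI:
  assumes "f \<in> P_as" "g \<in> P_as" "\<And>n. k \<le> n \<Longrightarrow> trunc_vars n f = trunc_vars n g"
  shows "f = g"
proof
  fix m
  obtain d where d: "\<And>m. f m \<noteq> 0 \<Longrightarrow> 0 \<notin> keys m \<and> mon_degree m \<le> d"
    using P_as_bounded[OF assms(1)] by blast
  obtain e where e: "\<And>m. g m \<noteq> 0 \<Longrightarrow> 0 \<notin> keys m \<and> mon_degree m \<le> e"
    using P_as_bounded[OF assms(2)] by blast
  show "f m = g m"
  proof (cases "0 \<in> keys m")
    case True
    then have "f m = 0" "g m = 0" using d[of m] e[of m] by blast+
    then show ?thesis by simp
  next
    case False
    define n where "n = Max (insert k (keys m))"
    have n: "k \<le> n" "keys m \<subseteq> {..n}" by (auto simp: n_def)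
    have "i \<noteq> 0" if "i \<in> keys m" for i using that False by metis
    then have "keys m \<subseteq> {1..n}" using n(2) by (auto simp: Suc_le_eq)
    then show ?thesis
      using arg_cong[OF assms(3)[OF n(1)], of "\<lambda>p. lookup p m"] d e
      by (simp add: lookup_trunc_vars_bounded[of f d] lookup_trunc_vars_bounded[of g e])
  qed
qed

lemma extend_injection_to_permutation:
  assumes "finite S" "A \<subseteq> S" "inj_on g A" "g ` A \<subseteq> S"
  shows "\<exists>\<pi>. \<pi> permutes S \<and> (\<forall>x\<in>A. \<pi> x = g x)"
proof -
  have fin: "finite A" using assms finite_subset by blast
  have "card (S - A) = card (S - g ` A)"
    using assms fin by (simp add: card_Diff_subset card_image)
  then obtain h where h: "bij_betw h (S - A) (S - g ` A)"
    using finite_same_card_bij[of "S - A" "S - g ` A"] assms(1) by auto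
  define \<pi> where "\<pi> x = (if x \<in> A then g x else if x \<in> S then h x else x)" for x
  have "bij_betw \<pi> A (g ` A)"
    using assms(3) by (auto simp: \<pi>_def bij_betw_def inj_on_def)
  moreover have "bij_betw \<pi> (S - A) (S - g ` A)"
    using h by (rule bij_betw_cong[THEN iffD1, rotated]) (auto simp: \<pi>_def)
  ultimately have "bij_betw \<pi> (A \<union> (S - A)) (g ` A \<union> (S - g ` A))"
    by (rule bij_betw_combine) auto
  then have "bij_betw \<pi> S S" using assms(2,4) by (simp add: Un_absorb1)
  then have "\<pi> permutes S" using assms(2) by (intro bij_imp_permutes) (auto simp: \<pi>_def)
  then show ?thesis by (intro exI[of _ \<pi>]) (simp add: \<pi>_def)
qed

text \<open>
  A single monomial involves finitely many variables. On it, even a permutation that moves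
  infinitely many of them acts like one of finite support, that is, like a product of adjacent
  transpositions.
\<close>
lemma symmetric_if_adjacent:
  fixes f :: series
  assumes adj: "\<And>i m. k < i \<Longrightarrow> f (map_key (adj i) m) = f m" and \<sigma>: "\<sigma> permutes {k<..}"
  shows "f (map_key \<sigma> m) = f m"
proof -
  have bij: "bij \<sigma>" using \<sigma> by (rule permutes_bij)
  define K where "K = keys m \<inter> {k<..}"
  define n where "n = Max (insert k (K \<union> inv \<sigma> ` K))"
  have finK: "finite K" by (simp add: K_def)
  have "K \<subseteq> {k+1..n}" using finK by (auto simp: K_def n_def Suc_le_eq)
  moreover have "inv \<sigma> ` K \<subseteq> {k+1..n}"
  proof
    fix x assume x: "x \<in> inv \<sigma> ` K"
    then have "x \<le> n" using finK by (auto simp: n_def intro: Max_ge)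
    moreover have "x \<in> {k<..}" using x permutes_in_image[OF permutes_inv[OF \<sigma>]] by (auto simp: K_def)
    ultimately show "x \<in> {k+1..n}" by auto
  qed
  moreover have "inj_on (inv \<sigma>) K" using bij by (meson bij_imp_bij_inv bij_is_inj inj_on_subset subset_UNIV)
  ultimately obtain \<rho> where \<rho>: "\<rho> permutes {k+1..n}" "\<And>x. x \<in> K \<Longrightarrow> \<rho> x = inv \<sigma> x"
    using extend_injection_to_permutation[OF finite_atLeastAtMost, of K "k+1" n "inv \<sigma>"] by blast
  define \<pi> where "\<pi> = inv \<rho>"
  have \<pi>: "\<pi> permutes {k+1..n}" unfolding \<pi>_def using \<rho>(1) by (rule permutes_inv)
  have low: "\<sigma> x = x" "\<pi> x = x" if "x \<le> k" for x
    using that \<sigma> \<pi> by (auto simp: permutes_def)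
  have "lookup m (\<sigma> x) = lookup m (\<pi> x)" for x
  proof (cases "\<sigma> x \<in> K \<or> \<pi> x \<in> K")
    case True
    then have "\<sigma> x = \<pi> x"
    proof
      assume "\<sigma> x \<in> K"
      then have "\<rho> (\<sigma> x) = x" using \<rho>(2)[of "\<sigma> x"] bij by (simp add: bij_is_inj)
      then show ?thesis unfolding \<pi>_def using permutes_inverses(2)[OF \<rho>(1)] by metis
    next
      assume "\<pi> x \<in> K"
      then have "x = inv \<sigma> (\<pi> x)" using \<rho>(2)[of "\<pi> x"] permutes_inverses(1)[OF \<rho>(1)] by (simp add: \<pi>_def)
      then show ?thesis by (metis bij bij_inv_eq_iff)
    qed
    then show ?thesis by simp
  next
    case False
    show ?thesis
    proof (cases "x \<le> k")
      case True
      then show ?thesis by (simp add: low)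
    next
      case x: False
      have "k < \<sigma> x" using permutes_in_image[OF \<sigma>, of x] x by simp
      moreover have "k < \<pi> x"
        using permutes_in_image[OF \<pi>, of x] permutes_not_in[OF \<pi>, of x] x by (cases "x \<in> {k+1..n}") auto
      ultimately show ?thesis using False by (simp add: K_def in_keys_iff)
    qed
  qed
  then have "map_key \<sigma> m = map_key \<pi> m"
    using bij permutes_bij[OF \<pi>] by (intro poly_mapping_eqI) (simp add: lookup_map_key bij_is_inj)
  moreover have "\<forall>m. f (map_key \<pi> m) = f m"
    using \<pi>
  proof (induction rule: permutes_adjacent_induct)
    case id
    show ?case by (simp add: id_def map_key_id)
  next
    case (adj i p)
    have "map_key (adj i \<circ> p) m = map_key p (map_key (adj i) m)" for m :: mon
      using adj by (intro map_key_compose[symmetric]) (auto intro: bij_is_inj)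
    then show ?case using adj assms(1)[of i] by (simp only: simp_thms)
  qed
  ultimately show ?thesis by simp
qed

lemma map_key_fix_low:
  assumes "\<sigma> permutes {k<..}" "keys a \<subseteq> {1..k}"
  shows "map_key \<sigma> a = (a :: mon)"
proof (rule poly_mapping_eqI)
  fix x
  have inj: "inj \<sigma>" using permutes_bij[OF assms(1)] by (rule bij_is_inj)
  show "lookup (map_key \<sigma> a) x = lookup a x"
  proof (cases "x \<le> k")
    case True
    then show ?thesis using permutes_not_in[OF assms(1), of x] by (simp add: lookup_map_key inj)
  next
    case False
    then have "k < \<sigma> x" using permutes_in_image[OF assms(1), of x] by simp
    then have "\<sigma> x \<notin> keys a" "x \<notin> keys a" using assms(2) False by auto
    then show ?thesis by (simp add: lookup_map_key inj in_keys_iff)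
  qed
qed

text \<open>
  Collecting terms by their monomial in \<open>x\<^sub>1, \<dots>, x\<^sub>k\<close>, of which there are finitely many of degree at
  most \<open>d\<close>, leaves coefficients that are symmetric functions in the remaining variables.
\<close>
lemma P_plus_if_symmetric:
  fixes f :: series
  assumes keys: "\<And>m. f m \<noteq> 0 \<Longrightarrow> 0 \<notin> keys m"
    and deg: "\<And>m. f m \<noteq> 0 \<Longrightarrow> mon_degree m \<le> d"
    and sym: "\<And>i m. k < i \<Longrightarrow> f (map_key (adj i) m) = f m"
  shows "f \<in> P_plus k"
proof -
  define A where "A = {a :: mon. keys a \<subseteq> {1..k} \<and> mon_degree a \<le> d}"
  have finA: "finite A" unfolding A_def by (rule finite_bounded_monomials) simp
  then obtain e where e: "bij_betw e {0..<card A} A" using ex_bij_betw_nat_finite by blast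
  define g where "g i b = (if keys b \<subseteq> {k<..} then f (e i + b) else 0)" for i b
  define p :: "nat \<Rightarrow> pol" where "p i = single (e i) 1" for i
  have eA: "e i \<in> A" if "i < card A" for i using e that by (auto simp: bij_betw_def)
  have p: "p i \<in> polys k" if "i < card A" for i
    using eA[OF that] by (auto simp: p_def polys_def A_def)
  have g: "g i \<in> Sym_fun k" if i: "i < card A" for i
    unfolding Sym_fun_def
  proof (intro CollectI conjI allI impI)
    show "keys b \<subseteq> {k<..}" if "g i b \<noteq> 0" for b
      using that by (auto simp: g_def split: if_splits)
    show "\<exists>d. \<forall>b. g i b \<noteq> 0 \<longrightarrow> mon_degree b \<le> d"
      using deg by (intro exI[of _ d]) (fastforce simp: g_def mon_degree_add split: if_splits)
    fix \<sigma> and b :: mon assume \<sigma>: "\<sigma> permutes {k<..}"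
    have bij: "bij \<sigma>" using \<sigma> by (rule permutes_bij)
    have "keys (map_key \<sigma> b) \<subseteq> {k<..} \<longleftrightarrow> keys b \<subseteq> {k<..}"
    proof -
      have "keys (map_key \<sigma> b) = \<sigma> -` keys b"
        using bij by (simp add: keys_map_key bij_is_inj)
      moreover have "\<sigma> -` keys b \<subseteq> {k<..} \<longleftrightarrow> keys b \<subseteq> {k<..}"
      proof
        assume h: "\<sigma> -` keys b \<subseteq> {k<..}"
        show "keys b \<subseteq> {k<..}"
        proof
          fix x assume "x \<in> keys b"
          moreover obtain y where "x = \<sigma> y" using bij by (metis bij_pointE)
          ultimately show "x \<in> {k<..}" using h permutes_in_image[OF \<sigma>, of y] by blast
        qed
      next
        assume h: "keys b \<subseteq> {k<..}"
        show "\<sigma> -` keys b \<subseteq> {k<..}"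
        proof
          fix y assume "y \<in> \<sigma> -` keys b"
          then show "y \<in> {k<..}" using h permutes_in_image[OF \<sigma>, of y] by blast
        qed
      qed
      ultimately show ?thesis by simp
    qed
    moreover have "f (e i + map_key \<sigma> b) = f (e i + b)"
    proof -
      have "e i + map_key \<sigma> b = map_key \<sigma> (e i + b)"
        using eA[OF i] map_key_fix_low[OF \<sigma>, of "e i"] bij by (simp add: A_def map_key_plus bij_is_inj)
      then show ?thesis using symmetric_if_adjacent[OF sym \<sigma>] by simp
    qed
    ultimately show "g i (map_key \<sigma> b) = g i b" by (simp add: g_def)
  qed
  have "f m = (\<Sum>i<card A. series_mult (lookup (p i)) (g i) m)" for m
  proof -
    let ?D = "{(a, b). a + b = m}"
    let ?G = "{(a, b). a + b = m \<and> a \<in> A \<and> keys b \<subseteq> {k<..}}"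
    have "(\<Sum>i<card A. series_mult (lookup (p i)) (g i) m) =
        (\<Sum>i<card A. \<Sum>(a, b)\<in>?D. if a = e i \<and> keys b \<subseteq> {k<..} then f m else 0)"
      unfolding series_mult_def p_def g_def
      by (intro sum.cong refl) (auto simp: lookup_single when_def)
    also have "\<dots> = (\<Sum>(a, b)\<in>?D. \<Sum>i<card A. if a = e i \<and> keys b \<subseteq> {k<..} then f m else 0)"
      by (subst sum.swap) (simp add: split_def)
    also have "\<dots> = (\<Sum>(a, b)\<in>?D. if a \<in> A \<and> keys b \<subseteq> {k<..} then f m else 0)"
    proof (intro sum.cong refl)
      fix x assume "x \<in> ?D"
      obtain a b where x: "x = (a, b)" by (cases x)
      have "(\<Sum>i<card A. if a = e i \<and> keys b \<subseteq> {k<..} then f m else 0) =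
          (\<Sum>c\<in>A. if a = c \<and> keys b \<subseteq> {k<..} then f m else 0)"
        using sum.reindex_bij_betw[OF e, of "\<lambda>c. if a = c \<and> keys b \<subseteq> {k<..} then f m else 0"]
        by (simp add: atLeast0LessThan)
      also have "\<dots> = (if a \<in> A \<and> keys b \<subseteq> {k<..} then f m else 0)"
        using finA by (cases "keys b \<subseteq> {k<..}") (simp_all add: sum.delta)
      finally show "(case x of (a, b) \<Rightarrow> \<Sum>i<card A. if a = e i \<and> keys b \<subseteq> {k<..} then f m else 0) =
          (case x of (a, b) \<Rightarrow> if a \<in> A \<and> keys b \<subseteq> {k<..} then f m else 0)"
        unfolding x prod.case .
    qed
    also have "\<dots> = f m"
    proof (cases "f m = 0")
      case False
      \<comment> \<open>The part of \<open>m\<close> in \<open>x\<^sub>1, \<dots>, x\<^sub>k\<close> and the rest form the only admissible decomposition.\<close>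
      define a where "a = Abs_poly_mapping (\<lambda>i. if i \<le> k then lookup m i else 0)"
      define b where "b = Abs_poly_mapping (\<lambda>i. if i \<le> k then 0 else lookup m i)"
      have fin: "finite {i. (if i \<le> k then lookup m i else 0) \<noteq> 0}" "finite {i. (if i \<le> k then 0 else lookup m i) \<noteq> 0}"
        by (rule finite_subset[OF _ finite_keys[of m]]; auto simp: in_keys_iff split: if_splits)+
      have la: "lookup a i = (if i \<le> k then lookup m i else 0)"
        and lb: "lookup b i = (if i \<le> k then 0 else lookup m i)" for i
        unfolding a_def b_def using fin by simp_all
      have ab: "a + b = m" by (rule poly_mapping_eqI) (simp add: lookup_add la lb)
      have m0: "lookup m 0 = 0" using keys[OF False] by (simp add: in_keys_iff)
      have "keys a \<subseteq> {1..k}"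
      proof
        fix i assume "i \<in> keys a"
        then have "i \<le> k" "lookup m i \<noteq> 0" by (auto simp: in_keys_iff la split: if_splits)
        then show "i \<in> {1..k}" using m0 by (cases i) auto
      qed
      moreover have "mon_degree a \<le> d" using deg[OF False] by (simp add: ab[symmetric] mon_degree_add)
      ultimately have aA: "a \<in> A" by (simp add: A_def)
      have bk: "keys b \<subseteq> {k<..}" by (auto simp: in_keys_iff lb split: if_splits)
      have unique: "a' = a \<and> b' = b" if "a' + b' = m" "a' \<in> A" "keys b' \<subseteq> {k<..}" for a' b'
      proof -
        have "lookup a' i = lookup a i \<and> lookup b' i = lookup b i" for i
        proof (cases "i \<le> k")
          case True
          then have "i \<notin> keys b'" using that(3) by auto
          then show ?thesis using True arg_cong[OF that(1), of "\<lambda>m. lookup m i"]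
            by (simp add: la lb lookup_add in_keys_iff)
        next
          case False
          then have "i \<notin> keys a'" using that(2) by (auto simp: A_def)
          then show ?thesis using False arg_cong[OF that(1), of "\<lambda>m. lookup m i"]
            by (simp add: la lb lookup_add in_keys_iff)
        qed
        then show ?thesis by (simp add: poly_mapping_eqI)
      qed
      have "(\<Sum>(a, b)\<in>?D. if a \<in> A \<and> keys b \<subseteq> {k<..} then f m else 0) =
          (\<Sum>x\<in>?D. if x = (a, b) then f m else 0)"
        using unique aA bk by (intro sum.cong refl) (auto split: if_splits)
      also have "\<dots> = f m" using finite_decompositions[of m] ab by (simp add: sum.delta)
      finally show ?thesis .
    qed (simp add: split_def sum.neutral)
    finally show ?thesis by simp
  qed
  then show ?thesis using p g unfolding P_plus_def by blast
qed

section \<open>The recursion for almost symmetric Schur functions\<close>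

lemma key_sum_symmetric:
  assumes "1 \<le> i" "i < length \<alpha>" "\<alpha> ! (i - 1) \<le> \<alpha> ! i"
  shows "permute_vars (adj i) (key_sum \<alpha>) = key_sum \<alpha>"
proof -
  obtain A y x B where \<alpha>: "\<alpha> = A @ y # x # B" and i: "Suc (length A) = i"
    using split_at_two[OF assms(1,2)] by metis
  have le: "y \<le> x" using assms(3) swap_entries_append(2,3)[OF i, of y x B] by (simp only: \<alpha>)
  show ?thesis unfolding \<alpha> key_sum_swap[OF le i] by (rule permute_vars_xi)
qed

text \<open>
  Each of the entries that \<open>x\<close> passes contributes one application of \<open>key_sum_swap\<close>.
\<close>
lemma key_sum_move:
  assumes "\<forall>z\<in>set Z. z \<le> x"
  shows "key_sum (\<mu> @ Z @ x # B) = xi_chain (length \<mu>) (length Z) (key_sum (\<mu> @ x # Z @ B))"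
  using assms
proof (induction Z arbitrary: B rule: rev_induct)
  case (snoc z Z)
  have "key_sum ((\<mu> @ Z) @ z # x # B) = xi (length \<mu> + Suc (length Z)) (key_sum ((\<mu> @ Z) @ x # z # B))"
    using snoc.prems by (intro key_sum_swap) auto
  then show ?case using snoc.IH[of "z # B"] snoc.prems by simp
qed simp

text \<open>
  The operators \<open>\<xi>\<^sub>i\<close> with \<open>i \<ge> n\<close> disappear by \<open>restrict_vars_xi_top\<close>, applied in \<open>i\<close> variables.
\<close>
lemma restrict_vars_xi_chain:
  assumes "k \<le> n"
  shows "restrict_vars n (xi_chain k M h) = xi_chain k (min M (n - k - 1)) (restrict_vars n h)"
proof (induction M)
  case (Suc M)
  let ?i = "k + Suc M" and ?p = "xi_chain k M h"
  show ?case
  proof (cases "?i < n")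
    case True
    then have "min (Suc M) (n - k - 1) = Suc M" "min M (n - k - 1) = M" by auto
    then show ?thesis using Suc.IH restrict_vars_xi[of ?i n ?p] True by simp
  next
    case False
    have "restrict_vars n (xi ?i ?p) = restrict_vars n (restrict_vars ?i (xi ?i ?p))"
      using False by (intro restrict_vars_restrict_vars[symmetric]) simp
    also have "\<dots> = restrict_vars n (restrict_vars ?i ?p)"
      by (subst restrict_vars_xi_top) simp_all
    also have "\<dots> = restrict_vars n ?p"
      using False by (intro restrict_vars_restrict_vars) simp
    finally have "restrict_vars n (xi ?i ?p) = restrict_vars n ?p" .
    moreover have "min (Suc M) (n - k - 1) = min M (n - k - 1)" using False assms by auto
    ultimately show ?thesis using Suc.IH by simp
  qed
qed simp

lemma trunc_vars_schur_series:
  assumes "n \<le> N" "length \<mu> \<le> N"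
  shows "trunc_vars n (schur_series \<mu> la) = restrict_vars n (key_sum (\<mu> @ replicate (N - length \<mu>) 0 @ rev la))"
proof (rule poly_mapping_eqI)
  fix m :: mon
  have "schur_series \<mu> la m = lookup (key_sum (\<mu> @ replicate (N - length \<mu>) 0 @ rev la)) m"
    if "keys m \<subseteq> {1..n}"
    using that assms by (intro schur_series_coeff) auto
  then show "lookup (trunc_vars n (schur_series \<mu> la)) m =
      lookup (restrict_vars n (key_sum (\<mu> @ replicate (N - length \<mu>) 0 @ rev la))) m"
    using lookup_trunc_vars_bounded[of "schur_series \<mu> la", OF schur_series_degree] by (simp add: lookup_restrict_vars)
qed

lemma key_sum_tail_symmetric:
  assumes "sorted_wrt (\<ge>) la" "length \<mu> < i" "i < length \<mu> + z + length la"
  shows "permute_vars (adj i) (key_sum (\<mu> @ replicate z 0 @ rev la)) = key_sum (\<mu> @ replicate z 0 @ rev la)"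
proof (rule key_sum_symmetric)
  let ?Z = "replicate z 0 @ rev la"
  have "sorted (rev la)" using assms(1) by (simp add: sorted_wrt_rev)
  then have "sorted ?Z" by (auto simp: sorted_append)
  then have "?Z ! (i - 1 - length \<mu>) \<le> ?Z ! (i - length \<mu>)"
    using assms(2,3) by (intro sorted_nth_mono) auto
  moreover have "\<not> i - 1 < length \<mu>" "\<not> i < length \<mu>" using assms(2) by auto
  ultimately show "(\<mu> @ ?Z) ! (i - 1) \<le> (\<mu> @ ?Z) ! i"
    by (simp only: nth_append[of \<mu>] if_False)
qed (use assms in auto)

lemma schur_series_adj:
  assumes "sorted_wrt (\<ge>) la" "length \<mu> < i"
  shows "schur_series \<mu> la (map_key (adj i) m) = schur_series \<mu> la m"
proof -
  define N where "N = Max (insert (Suc i) (keys m))"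
  have N: "Suc i \<le> N" "keys m \<subseteq> {..N}" by (auto simp: N_def)
  have keys: "keys (map_key (adj i) m) \<subseteq> {..N}"
  proof
    fix x assume "x \<in> keys (map_key (adj i) m)"
    then have "adj i x \<in> keys m" by (simp add: keys_map_key)
    then have "adj i x \<le> N" using N by auto
    then show "x \<in> {..N}" using N(1) by (auto simp: adj_eq split: if_splits)
  qed
  let ?K = "key_sum (\<mu> @ replicate (N - length \<mu>) 0 @ rev la)"
  have N': "length \<mu> \<le> N" using assms N by simp
  have "schur_series \<mu> la (map_key (adj i) m) = lookup ?K (map_key (adj i) m)"
    by (rule schur_series_coeff[OF N' keys])
  also have "\<dots> = lookup (permute_vars (adj i) ?K) m"
    by (rule lookup_permute_vars[symmetric]) simp
  also have "permute_vars (adj i) ?K = ?K"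
    using assms N by (intro key_sum_tail_symmetric) auto
  also have "lookup ?K m = schur_series \<mu> la m"
    by (rule schur_series_coeff[OF N' N(2), symmetric])
  finally show ?thesis .
qed

lemma schur_series_in_P_as:
  assumes "sorted_wrt (\<ge>) la"
  shows "schur_series \<mu> la \<in> P_as"
proof -
  have "schur_series \<mu> la \<in> P_plus (length \<mu>)"
    using schur_series_positive_keys schur_series_degree schur_series_adj[OF assms]
    by (rule P_plus_if_symmetric)
  then show ?thesis by (auto simp: P_as_def)
qed

text \<open>
  Both truncations are obtained from key polynomials with \<open>n - length \<mu>\<close> zeros, in which \<open>x\<close> stands
  in front of and behind the same entries. So they differ by a chain, which is cut down to the part that
  \<open>W_fin\<close> absorbs, and its result is symmetric in the variables that \<open>W_fin\<close> symmetrises.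
\<close>
lemma trunc_vars_W_fin:
  assumes "sorted_wrt (\<ge>) (x # la)" "length \<mu> \<le> n"
  shows "trunc_vars n (schur_series \<mu> (x # la)) = W_fin (length \<mu>) n (trunc_vars n (schur_series (\<mu> @ [x]) la))"
proof -
  let ?k = "length \<mu>"
  let ?Z = "replicate (n - ?k) 0 @ rev la"
  let ?m = "min (length ?Z) (n - ?k - 1)"
  have g: "trunc_vars n (schur_series \<mu> (x # la)) = restrict_vars n (key_sum (\<mu> @ ?Z @ [x]))"
    using trunc_vars_schur_series[of n n \<mu> "x # la"] assms(2) by simp
  have f: "trunc_vars n (schur_series (\<mu> @ [x]) la) = restrict_vars n (key_sum (\<mu> @ x # ?Z))"
    using trunc_vars_schur_series[of n "Suc n" "\<mu> @ [x]" la] assms(2) by simp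
  have "\<forall>z\<in>set ?Z. z \<le> x" using assms(1) by auto
  then have "key_sum (\<mu> @ ?Z @ [x]) = xi_chain ?k (length ?Z) (key_sum (\<mu> @ x # ?Z))"
    using key_sum_move[of ?Z x \<mu> "[]"] by simp
  then have chain: "trunc_vars n (schur_series \<mu> (x # la)) = xi_chain ?k ?m (trunc_vars n (schur_series (\<mu> @ [x]) la))"
    unfolding f g using restrict_vars_xi_chain[OF assms(2)] by simp
  have sym: "permute_vars (adj i) (restrict_vars n (key_sum (\<mu> @ ?Z @ [x]))) = restrict_vars n (key_sum (\<mu> @ ?Z @ [x]))"
    if "?k < i" "i < n" for i
  proof -
    have "permute_vars (adj i) (restrict_vars n (key_sum (\<mu> @ ?Z @ [x]))) =
        restrict_vars n (permute_vars (adj i) (key_sum (\<mu> @ ?Z @ [x])))"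
      using that by (intro restrict_vars_permute_vars[symmetric]) auto
    also have "permute_vars (adj i) (key_sum (\<mu> @ ?Z @ [x])) = key_sum (\<mu> @ ?Z @ [x])"
      using key_sum_tail_symmetric[OF assms(1), of \<mu> i "n - ?k"] that by simp
    finally show ?thesis .
  qed
  have "W_fin ?k n (trunc_vars n (schur_series (\<mu> @ [x]) la)) = xi_chain ?k ?m (trunc_vars n (schur_series (\<mu> @ [x]) la))"
  proof (rule W_fin_xi_chain)
    show "?k + ?m < n \<or> ?m = 0" by auto
    show "permute_vars (adj i) (xi_chain ?k ?m (trunc_vars n (schur_series (\<mu> @ [x]) la))) =
        xi_chain ?k ?m (trunc_vars n (schur_series (\<mu> @ [x]) la))" if "?k < i" "i < n" for i
      using sym[OF that] unfolding chain[symmetric] g .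
  qed
  then show ?thesis by (simp only: chain)
qed

lemma W_schur_series:
  assumes "sorted_wrt (\<ge>) (x # la)"
  shows "W (length \<mu>) (schur_series (\<mu> @ [x]) la) = schur_series \<mu> (x # la)"
  unfolding W_def
proof (rule the_equality)
  show "schur_series \<mu> (x # la) \<in> P_as \<and> (\<forall>n\<ge>length \<mu>. trunc_vars n (schur_series \<mu> (x # la)) =
      W_fin (length \<mu>) n (trunc_vars n (schur_series (\<mu> @ [x]) la)))"
    using schur_series_in_P_as[OF assms] trunc_vars_W_fin[OF assms] by blast
  fix g assume "g \<in> P_as \<and> (\<forall>n\<ge>length \<mu>. trunc_vars n g = W_fin (length \<mu>) n (trunc_vars n (schur_series (\<mu> @ [x]) la)))"
  then show "g = schur_series \<mu> (x # la)"
    using schur_series_in_P_as[OF assms] trunc_vars_W_fin[OF assms]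
    by (intro P_as_eqI[of _ _ "length \<mu>"]) auto
qed

theorem as_schur_eq_schur_series:
  assumes "sorted_wrt (\<ge>) la"
  shows "as_schur \<mu> la = schur_series \<mu> la"
  using assms
proof (induction la arbitrary: \<mu>)
  case Nil
  then show ?case by (simp add: key_poly_eq_key_sum schur_series_Nil)
next
  case (Cons x la)
  then show ?case using W_schur_series[OF Cons.prems] by simp
qed

theorem theorem4p6:
  fixes \<mu> la :: "nat list"
  assumes "(\<mu>, la) \<in> Sigma_pairs"
  shows "has_formal_sum (x_pow (\<mu> @ rev la)) (labellings \<mu> la) (as_schur \<mu> la)"
proof -
  have "sorted_wrt (\<ge>) la" using assms by (simp add: Sigma_pairs_def is_partition_def)
  then show ?thesis by (simp only: as_schur_eq_schur_series has_formal_sum_schur_series)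
qed

end
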